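(* Let $1/2<\alpha<1$ and $0<T<\infty$. Let $\mathcal{H}$ be a separable Hilbert space, and let $\mathcal{L},\mathcal{M}$ be self-adjoint operators on $\mathcal{H}$ that are diagonalisable (can be written in the infinite dimensional matrix form) with respect to some basis $\{e_\xi\}_{\xi\in\mathcal{I}}$ of $\mathcal{H}$, where $\mathcal{I}$ is a countable set, with $\mathcal{L}e_\xi=\lambda_\xi e_\xi$, $\mathcal{M}e_\xi=\mu_\xi e_\xi$ and eigenvalues $\lambda_\xi,\mu_\xi\in\mathbb{R}$ satisfying $\lambda_\xi\ge c_L>0$ and $\mu_\xi\ge c_M>0$ for all $\xi\in\mathcal{I}$, where $c_L,c_M$ are some constants. Let $\varphi\in\mathcal{H}^1_{\mathcal{L}}\cap\mathcal{H}^1_{\mathcal{M}}$ and $f\in L^2([0,T];\mathcal{H})\cap L^2([0,T];\mathcal{H}^{-1,1}_{\mathcal{L},\mathcal{M}})$. Then there exists a unique solution $u(t)$ of the problem $$\mathcal{D}_t^\alpha[u(t)+\mathcal{L}u(t)]+\mathcal{M}u(t)=f(t),\quad 0<t<T,\qquad u(0)=\varphi,$$ such that $u\in L^2([0,T];\mathcal{H}^1_{\mathcal{M}})\cap W^\alpha([0,T];\mathcal{H}^1_{\mathcal{L}})$. This solution can be written in the form $$u(t)=\sum_{\xi\in\mathcal{I}}\varphi_\xi E_{\alpha,1}\left(-\frac{\mu_\xi}{1+\lambda_\xi}t^\alpha\right)e_\xi+\sum_{\xi\in\mathcal{I}}\left[\frac{1}{1+\lambda_\xi}\int_0^t s^{\alpha-1}E_{\alpha,\alpha}\left(-\frac{\mu_\xi}{1+\lambda_\xi}s^\alpha\right)f_\xi(t-s)\,ds\right]e_\xi,$$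 where $\varphi_\xi=(\varphi,e_\xi)_{\mathcal{H}}$ and $f_\xi(t)=(f(t),e_\xi)_{\mathcal{H}}$.
   Context: Basis expansions: elements $g$ of $\mathcal{H}$ are expanded in the basis as $g=\sum_{\xi\in\mathcal{I}}g_\xi e_\xi$ with $g_\xi=(g,e_\xi)_{\mathcal{H}}$, where $(\cdot,\cdot)_{\mathcal{H}}$ is the inner product of $\mathcal{H}$. Mittag-Leffler type function: $E_{\alpha,\beta}(z)=\sum_{m=0}^\infty \frac{z^m}{\Gamma(\alpha m+\beta)}$, where $\Gamma$ is the Euler gamma function. Fractional calculus on $[0,T]$, for $0<\alpha<1$: the Riemann-Liouville fractional integral of an integrable function $g$ is $I^\alpha[g](t)=\frac{1}{\Gamma(\alpha)}\int_0^t(t-s)^{\alpha-1}g(s)\,ds$; the Caputo fractional derivative of a differentiable function $g$ is $\mathcal{D}_t^\alpha[g](t)=I^{1-\alpha}[g'](t)=\frac{1}{\Gamma(1-\alpha)}\int_0^t\frac{g'(s)}{(t-s)^\alpha}\,ds$. Spaces: for $l,m\in\mathbb{R}$, $\mathcal{H}^{l,m}_{\mathcal{L},\mathcal{M}}=\{u\in\mathcal{H}:\mathcal{L}^l\mathcal{M}^m u\in\mathcal{H}\}$, $\mathcal{H}^l_{\mathcal{L}}=\{u\in\mathcal{H}:\mathcal{L}^l u\in\mathcal{H}\}$, $\mathcal{H}^m_{\mathcal{M}}=\{u\in\mathcal{H}:\mathcal{M}^m u\in\mathcal{H}\}$, where the powers act by $\mathcal{L}^l e_\xi=\lambda_\xi^l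 e_\xi$, $\mathcal{M}^m e_\xi=\mu_\xi^m e_\xi$, with norms $\|\mathcal{L}^l\mathcal{M}^m u\|_{\mathcal{H}}$, $\|\mathcal{L}^l u\|_{\mathcal{H}}$, $\|\mathcal{M}^m u\|_{\mathcal{H}}$ respectively. For a separable Hilbert space $X$ and $0<\alpha\le1$, $W^\alpha([0,T];X)$ is the space of all $L^2$-integrable functions $g:[0,T]\to X$ with $L^2$-integrable $\mathcal{D}_t^\alpha g:[0,T]\to X$, such that $\|g\|_{W^\alpha([0,T];X)}=\|g\|_{L^2([0,T];X)}+\|\mathcal{D}_t^\alpha g\|_{L^2([0,T];X)}<\infty$. A generalised solution of the problem is a function $u\in L^2([0,T];\mathcal{H}^1_{\mathcal{L}})\cap L^2([0,T];\mathcal{H}^1_{\mathcal{M}})\cap W^\alpha([0,T];\mathcal{H}^1_{\mathcal{L}})$ satisfying the equation and the initial condition.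
   Formalization: The Caputo derivative is read weakly: D_t^α g = h means I^{1-α}[g-g(0)](t) = ∫_0^t h ds for a.e. t. With the literal I^{1-α}[g'] existence fails for f merely in L^2, as the solution need not be differentiable. The equation holds a.e. and uniqueness is a.e. *)

theory Defs
  imports "HOL-Analysis.Analysis"
begin

subsection \<open>Hilbert spaces over the reals or the complex numbers\<close>

text \<open>
  Up to isometric isomorphism the only types of sort
  \<open>{real_normed_field, euclidean_space}\<close> are the reals and the complex numbers, and conjugation
  is the reflection in the line spanned by \<open>1\<close>.
\<close>

definition scalar_cnj :: "'k::{real_normed_field,euclidean_space} \<Rightarrow> 'k"
  where "scalar_cnj c = of_real (2 * (c \<bullet> 1)) - c"

lemma scalar_cnj_real: "scalar_cnj (r :: real) = r"
  by (simp add: scalar_cnj_def)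

lemma scalar_cnj_complex: "scalar_cnj (z :: complex) = cnj z"
  by (simp add: scalar_cnj_def complex_eq_iff inner_complex_def)

text \<open>Completeness and separability are the type class constraints on \<open>'h\<close>.\<close>

locale hilbert_space = vector_space scl
  for scl :: "'k::{real_normed_field,euclidean_space}
               \<Rightarrow> 'h::{banach,second_countable_topology} \<Rightarrow> 'h" +
  fixes ip :: "'h \<Rightarrow> 'h \<Rightarrow> 'k"
  assumes scl_of_real: "scl (of_real r) x = r *\<^sub>R x"
    and ip_add_left: "ip (x + y) z = ip x z + ip y z"
    and ip_scl_left: "ip (scl c x) z = c * ip x z"
    and ip_cnj: "ip y x = scalar_cnj (ip x y)"
    and ip_self: "ip x x = of_real ((norm x)\<^sup>2)"

lemma hilbert_space_real_inner:
  "hilbert_space (scaleR :: real \<Rightarrow> 'h \<Rightarrow> 'h)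
     (inner :: 'h \<Rightarrow> 'h::{real_inner,banach,second_countable_topology} \<Rightarrow> real)"
  by unfold_locales
     (auto simp: scalar_cnj_real inner_add_left inner_commute power2_norm_eq_inner algebra_simps)

definition orthonormal_basis ::
  "('k::{real_normed_field,euclidean_space} \<Rightarrow> 'h::{banach,second_countable_topology} \<Rightarrow> 'h)
    \<Rightarrow> ('h \<Rightarrow> 'h \<Rightarrow> 'k) \<Rightarrow> 'i set \<Rightarrow> ('i \<Rightarrow> 'h) \<Rightarrow> bool"
  where "orthonormal_basis scl ip I e \<longleftrightarrow>
    (\<forall>\<xi>\<in>I. \<forall>\<eta>\<in>I. ip (e \<xi>) (e \<eta>) = (if \<xi> = \<eta> then 1 else 0)) \<and>
    (\<forall>g. ((\<lambda>\<xi>. scl (ip g (e \<xi>)) (e \<xi>)) has_sum g) I)"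

text \<open>
  A (possibly unbounded) operator is given by its domain \<open>D\<close> and a function \<open>A\<close> whose values
  outside \<open>D\<close> are irrelevant.  The last conjunct says that the graph of \<open>A\<close> is
  the graph of its adjoint, domains included.
\<close>

definition self_adjoint_operator ::
  "('k::{real_normed_field,euclidean_space} \<Rightarrow> 'h::{banach,second_countable_topology} \<Rightarrow> 'h)
    \<Rightarrow> ('h \<Rightarrow> 'h \<Rightarrow> 'k) \<Rightarrow> 'h set \<Rightarrow> ('h \<Rightarrow> 'h) \<Rightarrow> bool"
  where "self_adjoint_operator scl ip D A \<longleftrightarrow>
    0 \<in> D \<and>
    (\<forall>x\<in>D. \<forall>y\<in>D. x + y \<in> D \<and> A (x + y) = A x + A y) \<and>
    (\<forall>c. \<forall>x\<in>D. scl c x \<in> D \<and> A (scl c x) = scl c (A x)) \<and>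
    closure D = UNIV \<and>
    (\<forall>x y. (x \<in> D \<and> A x = y) \<longleftrightarrow> (\<forall>z\<in>D. ip (A z) x = ip z y))"

subsection \<open>Powers of diagonal operators and the associated spaces\<close>

text \<open>
  \<open>diag_op scl ip I e a\<close> is the operator with \<open>e \<xi> \<mapsto> a \<xi> e \<xi>\<close> on its maximal domain.
  The powers are the cases \<open>a \<xi> = \<lambda>\<^sub>\<xi> powr l\<close>, \<open>a \<xi> = \<mu>\<^sub>\<xi> powr m\<close>, and
  \<open>a \<xi> = \<lambda>\<^sub>\<xi> powr l * \<mu>\<^sub>\<xi> powr m\<close>.
\<close>

definition diag_domain ::
  "('k::{real_normed_field,euclidean_space} \<Rightarrow> 'h::{banach,second_countable_topology} \<Rightarrow> 'h)
    \<Rightarrow> ('h \<Rightarrow> 'h \<Rightarrow> 'k) \<Rightarrow> 'i set \<Rightarrow> ('i \<Rightarrow> 'h) \<Rightarrow> ('i \<Rightarrow> real) \<Rightarrow> 'h set"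
  where "diag_domain scl ip I e a =
    {u. (\<lambda>\<xi>. a \<xi> *\<^sub>R scl (ip u (e \<xi>)) (e \<xi>)) summable_on I}"

definition diag_op ::
  "('k::{real_normed_field,euclidean_space} \<Rightarrow> 'h::{banach,second_countable_topology} \<Rightarrow> 'h)
    \<Rightarrow> ('h \<Rightarrow> 'h \<Rightarrow> 'k) \<Rightarrow> 'i set \<Rightarrow> ('i \<Rightarrow> 'h) \<Rightarrow> ('i \<Rightarrow> real) \<Rightarrow> 'h \<Rightarrow> 'h"
  where "diag_op scl ip I e a u = (\<Sum>\<^sub>\<infinity>\<xi>\<in>I. a \<xi> *\<^sub>R scl (ip u (e \<xi>)) (e \<xi>))"

definition L2 :: "real \<Rightarrow> (real \<Rightarrow> 'h::{banach,second_countable_topology}) set"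
  where "L2 T = {g. g \<in> borel_measurable (lebesgue_on {0..T}) \<and>
                    integrable (lebesgue_on {0..T}) (\<lambda>t. (norm (g t))\<^sup>2)}"

text \<open>
  \<open>L2_space T X A\<close> is \<open>L\<^sup>2([0,T];X)\<close> for a space \<open>X\<close> with norm \<open>\<lambda>u. norm (A u)\<close>.
  As \<open>A\<close> is an isometry of \<open>X\<close> into \<open>'h\<close>, measurability with respect to \<open>X\<close> is
  measurability of \<open>A \<circ> g\<close>.
\<close>

definition L2_space ::
  "real \<Rightarrow> 'h set \<Rightarrow> ('h \<Rightarrow> 'h::{banach,second_countable_topology}) \<Rightarrow> (real \<Rightarrow> 'h) set"
  where "L2_space T X A =
    {g. (AE t in lebesgue_on {0..T}. g t \<in> X) \<and> (\<lambda>t. A (g t)) \<in> L2 T}"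

subsection \<open>Fractional calculus\<close>

definition rl_integral ::
  "real \<Rightarrow> (real \<Rightarrow> 'h::{banach,second_countable_topology}) \<Rightarrow> real \<Rightarrow> 'h"
  where "rl_integral \<alpha> g t =
    (1 / Gamma \<alpha>) *\<^sub>R (LINT s:{0..t}|lebesgue. (t - s) powr (\<alpha> - 1) *\<^sub>R g s)"

text \<open>
  The Caputo derivative \<open>h = I\<^sup>1\<^sup>-\<^sup>\<alpha>[g']\<close> has to be read in a weak sense: functions in
  \<open>W\<^sup>\<alpha>\<close> need not have a classical derivative (and for data in \<open>L\<^sup>2\<close> solutions in general do
  not).  Integrating the identity once from \<open>0\<close> to \<open>t\<close>, and using that fractional integrals
  commute, gives \<open>I\<^sup>1\<^sup>-\<^sup>\<alpha>[g - g(0)](t) = \<integral>\<^sub>0\<^sup>t h\<close>, in which \<open>g'\<close> no longer occurs; that is,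
  \<open>h\<close> is the weak derivative of \<open>I\<^sup>1\<^sup>-\<^sup>\<alpha>[g - g(0)]\<close>.  Lemma \<open>has_caputo_derivative_classical\<close>
  below recovers the formula \<open>h = I\<^sup>1\<^sup>-\<^sup>\<alpha>[g']\<close> for absolutely continuous \<open>g\<close>.  The value \<open>g 0\<close>
  is the pointwise one; for \<open>\<alpha> > 1/2\<close> the existence of a square integrable \<open>h\<close> forces it to be the
  value at \<open>0\<close> of the continuous representative of \<open>g\<close>.
\<close>

definition has_caputo_derivative ::
  "real \<Rightarrow> real \<Rightarrow> (real \<Rightarrow> 'h::{banach,second_countable_topology}) \<Rightarrow> (real \<Rightarrow> 'h) \<Rightarrow> bool"
  where "has_caputo_derivative \<alpha> T g h \<longleftrightarrow>
    integrable (lebesgue_on {0..T}) g \<and>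
    integrable (lebesgue_on {0..T}) h \<and>
    (AE t in lebesgue_on {0..T}.
       rl_integral (1 - \<alpha>) (\<lambda>s. g s - g 0) t = (LINT s:{0..t}|lebesgue. h s))"

lemma has_caputo_derivative_classical:
  fixes g g' :: "real \<Rightarrow> 'h::{banach,second_countable_topology}"
  assumes \<alpha>: "0 < \<alpha>" "\<alpha> < 1" and T: "0 < T"
    and g': "set_integrable lborel {0..T} g'"
    and g: "\<And>t. t \<in> {0..T} \<Longrightarrow> g t = g 0 + (LINT s:{0..t}|lborel. g' s)"
  shows "has_caputo_derivative \<alpha> T g (rl_integral (1 - \<alpha>) g')"
proof -
  define G where "G q = indicator {0..T} q *\<^sub>R g' q" for q
  define k where "k r = indicator {0<..T} r * r powr (- \<alpha>)" for r :: real
  define C where "C = 1 / Gamma (1 - \<alpha>)"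
  have G: "integrable lborel G"
    using g' by (simp add: G_def[abs_def] set_integrable_def)
  then have Gm[measurable]: "G \<in> borel_measurable borel"
    by (auto dest: borel_measurable_integrable)
  have km[measurable]: "k \<in> borel_measurable borel"
    unfolding k_def[abs_def] by measurable
  have k0: "0 \<le> k r" for r by (simp add: k_def)
  have k: "integrable lborel k"
  proof -
    have "(\<lambda>r. r powr (- \<alpha>)) absolutely_integrable_on {0<..T}"
      using \<alpha> T by (intro nonnegative_absolutely_integrable_1 integrable_on_powr_from_0') auto
    then have "integrable lebesgue k"
      by (simp add: set_integrable_def k_def[abs_def])
    then show ?thesis by (simp add: integrable_completion)
  qed
  have kaff: "integrable lborel (\<lambda>s. k (s - q))" "integrable lborel (\<lambda>s. k (q - s))" for q
    using lborel_integrable_real_affine[OF k, of 1 "- q"]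
          lborel_integrable_real_affine[OF k, of "- 1" q] by simp_all
  have kint: "(LINT s|lborel. k (s - q)) = (LINT s|lborel. k s)" for q
    using lborel_integral_real_affine[of 1 k "- q"] by simp
  have F1: "integrable (lborel \<Otimes>\<^sub>M lborel) (\<lambda>(q, s). k (s - q) *\<^sub>R G q)"
  proof (rule lborel_pair.Fubini_integrable)
    show "integrable lborel (\<lambda>q. LINT s|lborel. norm (case (q, s) of (q, s) \<Rightarrow> k (s - q) *\<^sub>R G q))"
      using G by (simp add: k0 kint)
    show "AE q in lborel. integrable lborel (\<lambda>s. case (q, s) of (q, s) \<Rightarrow> k (s - q) *\<^sub>R G q)"
      by (simp add: kaff)
  qed measurable
  have F1': "integrable (lborel \<Otimes>\<^sub>M lborel) (\<lambda>(q, s). indicator {..t} s *\<^sub>R k (s - q) *\<^sub>R G q)" for t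
    by (rule Bochner_Integration.integrable_bound[OF F1]) (measurable, auto split: split_indicator)
  have F2: "integrable (lborel \<Otimes>\<^sub>M lborel) (\<lambda>(q, s). k (t - s) *\<^sub>R G q)" for t
  proof (rule lborel_pair.Fubini_integrable)
    show "integrable lborel (\<lambda>q. LINT s|lborel. norm (case (q, s) of (q, s) \<Rightarrow> k (t - s) *\<^sub>R G q))"
      using G by (simp add: k0)
    show "AE q in lborel. integrable lborel (\<lambda>s. case (q, s) of (q, s) \<Rightarrow> k (t - s) *\<^sub>R G q)"
      by (simp add: kaff)
  qed measurable
  have F2': "integrable (lborel \<Otimes>\<^sub>M lborel) (\<lambda>(q, s). indicator {q..} s *\<^sub>R k (t - s) *\<^sub>R G q)" for t
  proof (rule Bochner_Integration.integrable_bound[OF F2[of t]])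
    have "(\<lambda>p. (if fst p \<le> snd p then 1 else 0) *\<^sub>R k (t - snd p) *\<^sub>R G (fst p))
        \<in> borel_measurable (lborel \<Otimes>\<^sub>M lborel)"
      by measurable
    then show "(\<lambda>(q, s). indicator {q..} s *\<^sub>R k (t - s) *\<^sub>R G q) \<in> borel_measurable (lborel \<Otimes>\<^sub>M lborel)"
      by (rule measurable_cong[THEN iffD1, rotated]) (auto split: split_indicator)
  qed (auto split: split_indicator)
  have rl: "rl_integral (1 - \<alpha>) g' s = C *\<^sub>R (LINT q|lborel. k (s - q) *\<^sub>R G q)" if "s \<in> {0..T}" for s
  proof -
    have "(\<lambda>q. indicator {0..s} q *\<^sub>R (s - q) powr (1 - \<alpha> - 1) *\<^sub>R g' q) = (\<lambda>q. k (s - q) *\<^sub>R G q)"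
      using that by (auto simp: fun_eq_iff k_def G_def split: split_indicator)
    then show ?thesis
      by (simp add: rl_integral_def C_def set_lebesgue_integral_def integral_completion)
  qed
  have gG: "g s - g 0 = (LINT q|lborel. indicator {q..} s *\<^sub>R G q)" if "s \<in> {0..T}" for s
  proof -
    have "(\<lambda>q. indicator {0..s} q *\<^sub>R g' q) = (\<lambda>q. indicator {q..} s *\<^sub>R G q)"
      using that by (auto simp: fun_eq_iff G_def split: split_indicator)
    then show ?thesis
      using g[OF that] by (simp add: set_lebesgue_integral_def)
  qed
  have i1: "integrable (lebesgue_on {0..T}) (rl_integral (1 - \<alpha>) g')"
  proof -
    have "integrable lborel (\<lambda>s. LINT q|lborel. k (s - q) *\<^sub>R G q)"
      using lborel_pair.integrable_snd[OF F1] by simp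
    then have "integrable lborel (\<lambda>s. indicator {0..T} s *\<^sub>R C *\<^sub>R (LINT q|lborel. k (s - q) *\<^sub>R G q))"
      by (intro integrable_mult_indicator integrable_scaleR_right) auto
    also have "(\<lambda>s. indicator {0..T} s *\<^sub>R C *\<^sub>R (LINT q|lborel. k (s - q) *\<^sub>R G q))
      = (\<lambda>s. indicator {0..T} s *\<^sub>R rl_integral (1 - \<alpha>) g' s)"
      by (auto simp: fun_eq_iff rl split: split_indicator)
    finally show ?thesis
      by (subst integrable_restrict_space)
         (auto simp: integrable_completion dest: borel_measurable_integrable)
  qed
  have i2: "integrable (lebesgue_on {0..T}) g"
  proof -
    have "integrable (lborel \<Otimes>\<^sub>M lborel) (\<lambda>(q, s). indicator {0..T} s *\<^sub>R indicator {q..} s *\<^sub>R G q)"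
    proof (rule lborel_pair.Fubini_integrable)
      have "(\<lambda>p. indicator {0..T} (snd p) *\<^sub>R (if fst p \<le> snd p then 1 else 0) *\<^sub>R G (fst p))
        \<in> borel_measurable (lborel \<Otimes>\<^sub>M lborel)"
        by measurable
      then show m: "(\<lambda>(q, s). indicator {0..T} s *\<^sub>R indicator {q..} s *\<^sub>R G q) \<in> borel_measurable (lborel \<Otimes>\<^sub>M lborel)"
        by (rule measurable_cong[THEN iffD1, rotated]) (auto split: split_indicator)
      have *: "integrable lborel (\<lambda>s. indicator {0..T} s *\<^sub>R indicator {q..} s *\<^sub>R G q)" for q
      proof (rule Bochner_Integration.integrable_bound)
        show "integrable lborel (\<lambda>s. indicator {0..T} s *\<^sub>R G q)"
          by (intro integrable_scaleR_left integrable_real_indicator) (auto simp: emeasure_lborel_Icc_eq)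
      qed (measurable, auto split: split_indicator)
      show "AE q in lborel. integrable lborel (\<lambda>s. case (q, s) of (q, s) \<Rightarrow> indicator {0..T} s *\<^sub>R indicator {q..} s *\<^sub>R G q)"
        using * by simp
      show "integrable lborel (\<lambda>q. LINT s|lborel. norm (case (q, s) of (q, s) \<Rightarrow> indicator {0..T} s *\<^sub>R indicator {q..} s *\<^sub>R G q))"
      proof (rule Bochner_Integration.integrable_bound)
        show "integrable lborel (\<lambda>q. T *\<^sub>R norm (G q))" using G by auto
        show "(\<lambda>q. LINT s|lborel. norm (case (q, s) of (q, s) \<Rightarrow> indicator {0..T} s *\<^sub>R indicator {q..} s *\<^sub>R G q))
          \<in> borel_measurable lborel"
          using m by measurable
        have "(LINT s|lborel. norm (indicator {0..T} s *\<^sub>R indicator {q..} s *\<^sub>R G q)) \<le> T * norm (G q)" for q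
        proof -
          have "(LINT s|lborel. norm (indicator {0..T} s *\<^sub>R indicator {q..} s *\<^sub>R G q))
            \<le> (LINT s|lborel. indicator {0..T} s *\<^sub>R norm (G q))"
            by (intro integral_mono integrable_norm * integrable_scaleR_left integrable_real_indicator)
               (auto simp: emeasure_lborel_Icc_eq split: split_indicator)
          also have "\<dots> = T * norm (G q)" using T by simp
          finally show ?thesis .
        qed
        then show "AE q in lborel. norm (LINT s|lborel. norm (case (q, s) of (q, s) \<Rightarrow> indicator {0..T} s *\<^sub>R indicator {q..} s *\<^sub>R G q))
          \<le> norm (T *\<^sub>R norm (G q))"
          using T by (auto intro!: AE_I2 simp: abs_mult)
      qed
    qed
    then have "integrable lborel (\<lambda>s. LINT q|lborel. indicator {0..T} s *\<^sub>R indicator {q..} s *\<^sub>R G q)"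
      using lborel_pair.integrable_snd by fastforce
    then have "integrable lborel (\<lambda>s. indicator {0..T} s *\<^sub>R g 0
        + (LINT q|lborel. indicator {0..T} s *\<^sub>R indicator {q..} s *\<^sub>R G q))"
      by (intro Bochner_Integration.integrable_add integrable_scaleR_left integrable_real_indicator) (auto simp: emeasure_lborel_Icc_eq)
    also have "(\<lambda>s. indicator {0..T} s *\<^sub>R g 0
        + (LINT q|lborel. indicator {0..T} s *\<^sub>R indicator {q..} s *\<^sub>R G q)) = (\<lambda>s. indicator {0..T} s *\<^sub>R g s)"
    proof
      fix s
      show "indicator {0..T} s *\<^sub>R g 0 + (LINT q|lborel. indicator {0..T} s *\<^sub>R indicator {q..} s *\<^sub>R G q)
        = indicator {0..T} s *\<^sub>R g s"
        using gG[of s] by (auto simp: algebra_simps split: split_indicator)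
    qed
    finally show ?thesis
      by (subst integrable_restrict_space)
         (auto simp: integrable_completion dest: borel_measurable_integrable)
  qed
  have "rl_integral (1 - \<alpha>) (\<lambda>s. g s - g 0) t = (LINT s:{0..t}|lebesgue. rl_integral (1 - \<alpha>) g' s)"
    if t: "t \<in> {0..T}" for t
  proof -
    have e1: "indicator {0..t} s *\<^sub>R (t - s) powr (1 - \<alpha> - 1) *\<^sub>R (g s - g 0)
        = (LINT q|lborel. indicator {q..} s *\<^sub>R k (t - s) *\<^sub>R G q)" for s
    proof (cases "s \<in> {0..t}")
      case True
      have "(LINT q|lborel. indicator {q..} s *\<^sub>R k (t - s) *\<^sub>R G q)
        = (LINT q|lborel. k (t - s) *\<^sub>R indicator {q..} s *\<^sub>R G q)"
        by (intro Bochner_Integration.integral_cong) (auto simp: mult.commute)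
      also have "\<dots> = k (t - s) *\<^sub>R (LINT q|lborel. indicator {q..} s *\<^sub>R G q)"
        by (rule integral_scaleR_right)
      also have "(LINT q|lborel. indicator {q..} s *\<^sub>R G q) = g s - g 0"
        using True t gG[of s] by simp
      finally show ?thesis
        using True t by (auto simp: k_def split: split_indicator)
    next
      case False
      then have "(\<lambda>q. indicator {q..} s *\<^sub>R k (t - s) *\<^sub>R G q) = (\<lambda>q. 0)"
        by (auto simp: fun_eq_iff k_def G_def split: split_indicator)
      with False show ?thesis by simp
    qed
    have e2: "indicator {0..t} s *\<^sub>R rl_integral (1 - \<alpha>) g' s
        = C *\<^sub>R (LINT q|lborel. indicator {..t} s *\<^sub>R k (s - q) *\<^sub>R G q)" for s
    proof (cases "s \<in> {0..t}")
      case True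
      then show ?thesis using rl[of s] t by simp
    next
      case False
      then have "(\<lambda>q. indicator {..t} s *\<^sub>R k (s - q) *\<^sub>R G q) = (\<lambda>q. 0)"
        by (auto simp: fun_eq_iff k_def G_def split: split_indicator)
      with False show ?thesis by simp
    qed
    have inner_eq: "(LINT s|lborel. indicator {q..} s *\<^sub>R k (t - s) *\<^sub>R G q)
        = (LINT s|lborel. indicator {..t} s *\<^sub>R k (s - q) *\<^sub>R G q)" for q
    proof -
      have "(LINT s|lborel. indicator {..t} s *\<^sub>R k (s - q) *\<^sub>R G q)
        = (LINT s|lborel. indicator {..t} (t + q - s) *\<^sub>R k (t + q - s - q) *\<^sub>R G q)"
        using lborel_integral_real_affine[of "- 1" "\<lambda>s. indicator {..t} s *\<^sub>R k (s - q) *\<^sub>R G q" "t + q"]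
        by simp
      also have "\<dots> = (LINT s|lborel. indicator {q..} s *\<^sub>R k (t - s) *\<^sub>R G q)"
        by (intro Bochner_Integration.integral_cong) (auto split: split_indicator)
      finally show ?thesis by simp
    qed
    have sw: "(LINT s|lborel. LINT q|lborel. indicator {q..} s *\<^sub>R k (t - s) *\<^sub>R G q)
        = (LINT s|lborel. LINT q|lborel. indicator {..t} s *\<^sub>R k (s - q) *\<^sub>R G q)"
      by (simp only: lborel_pair.Fubini_integral[OF F1'[of t]]
          lborel_pair.Fubini_integral[OF F2'[of t]] inner_eq)
    have m1: "(\<lambda>s. LINT q|lborel. indicator {q..} s *\<^sub>R k (t - s) *\<^sub>R G q) \<in> borel_measurable lborel"
      using lborel_pair.integrable_snd[OF F2'[of t]] by (rule borel_measurable_integrable)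
    have m2: "(\<lambda>s. LINT q|lborel. indicator {..t} s *\<^sub>R k (s - q) *\<^sub>R G q) \<in> borel_measurable lborel"
      using lborel_pair.integrable_snd[OF F1'[of t]] by (rule borel_measurable_integrable)
    have "rl_integral (1 - \<alpha>) (\<lambda>s. g s - g 0) t
        = C *\<^sub>R (LINT s|lborel. LINT q|lborel. indicator {q..} s *\<^sub>R k (t - s) *\<^sub>R G q)"
      unfolding rl_integral_def set_lebesgue_integral_def e1 C_def
      by (simp only: integral_completion[OF m1])
    also have "\<dots> = (LINT s|lborel. C *\<^sub>R (LINT q|lborel. indicator {..t} s *\<^sub>R k (s - q) *\<^sub>R G q))"
      by (simp only: sw integral_scaleR_right)
    also have "\<dots> = (LINT s:{0..t}|lebesgue. rl_integral (1 - \<alpha>) g' s)"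
      unfolding set_lebesgue_integral_def e2
      by (rule integral_completion[symmetric]) (use m2 in measurable)
    finally show ?thesis .
  qed
  then show ?thesis
    unfolding has_caputo_derivative_def using i1 i2
    by (auto intro!: AE_I2)
qed

text \<open>
  \<open>frac_sobolev \<alpha> T X A\<close> is \<open>W\<^sup>\<alpha>([0,T];X)\<close>, with \<open>X\<close> normed as in \<open>L2_space\<close>. Since the
  spaces \<open>X\<close> used here embed continuously in \<open>'h\<close>, the integrals defining the Caputo derivative
  may be taken in \<open>'h\<close>.
\<close>

definition frac_sobolev ::
  "real \<Rightarrow> real \<Rightarrow> 'h set \<Rightarrow> ('h \<Rightarrow> 'h::{banach,second_countable_topology}) \<Rightarrow> (real \<Rightarrow> 'h) set"
  where "frac_sobolev \<alpha> T X A =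
    {g \<in> L2_space T X A. \<exists>h \<in> L2_space T X A. has_caputo_derivative \<alpha> T g h}"

definition mittag_leffler :: "real \<Rightarrow> real \<Rightarrow> real \<Rightarrow> real"
  where "mittag_leffler \<alpha> \<beta> z = (\<Sum>m. z ^ m / Gamma (\<alpha> * real m + \<beta>))"

subsection \<open>The problem\<close>

definition solves_problem ::
  "real \<Rightarrow> real \<Rightarrow> ('h \<Rightarrow> 'h) \<Rightarrow> ('h \<Rightarrow> 'h) \<Rightarrow> 'h \<Rightarrow> (real \<Rightarrow> 'h)
    \<Rightarrow> (real \<Rightarrow> 'h::{banach,second_countable_topology}) \<Rightarrow> bool"
  where "solves_problem \<alpha> T L M \<phi> f u \<longleftrightarrow>
    (\<exists>w. has_caputo_derivative \<alpha> T (\<lambda>t. u t + L (u t)) w \<and>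
         (AE t in lebesgue_on {0..T}. w t + M (u t) = f t)) \<and>
    u 0 = \<phi>"

end

theory Submission
  imports Defs
begin

text \<open>
  In the eigenbasis the problem decouples into the relaxation equations
  \<open>D\<^sup>\<alpha> u\<^sub>\<xi> + k u\<^sub>\<xi> = f\<^sub>\<xi> / (1 + \<lambda>\<^sub>\<xi>)\<close> with \<open>k = \<mu>\<^sub>\<xi> / (1 + \<lambda>\<^sub>\<xi>)\<close>. Let
  \<open>R(t) = t\<^sup>\<alpha>\<^sup>-\<^sup>1 E\<^bsub>\<alpha>,\<alpha>\<^esub>(-k t\<^sup>\<alpha>)\<close>. Termwise integration of the power series gives
  \<open>I\<^sup>1\<^sup>-\<^sup>\<alpha> R = E\<^bsub>\<alpha>,1\<^esub>(-k t\<^sup>\<alpha>) = 1 - k \<integral> R\<close>, and with associativity of convolution this identity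
  yields both existence and uniqueness for the scalar equations. The Volterra equation
  \<open>R + k (t\<^sup>\<alpha>\<^sup>-\<^sup>1 / \<Gamma>(\<alpha>)) * R = t\<^sup>\<alpha>\<^sup>-\<^sup>1 / \<Gamma>(\<alpha>)\<close> forces \<open>0 < R \<le> t\<^sup>\<alpha>\<^sup>-\<^sup>1 / \<Gamma>(\<alpha>)\<close>, uniformly in \<open>k\<close>; since \<open>\<alpha> > 1/2\<close> the
  bound is square integrable, so by Cauchy-Schwarz the series for \<open>u\<close>, \<open>L u\<close> and \<open>M u\<close> converge for every
  \<open>t\<close> and stay bounded on \<open>[0,T]\<close>. The assumption on \<open>L\<^sup>-\<^sup>1 M f\<close> is what controls \<open>M u\<close>.
\<close>

subsection \<open>The Mittag-Leffler function\<close>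

text \<open>With \<open>w = u_xi - phi_xi\<close> the weak equation is
  \<open>a * w = 1 * (F - k w)\<close>, where \<open>a\<close> is the kernel of the fractional
  integral of order \<open>1 - \<alpha>\<close>, \<open>1\<close> is the indicator of the positive
  axis and \<open>F\<close> absorbs the initial value. The identity
  \<open>a * R + k (1 * R) = 1\<close> gives existence, because
  \<open>a * (R * F) = (1 - k (1 * R)) * F\<close>; convolving the equation with \<open>R\<close>
  turns it into \<open>1 * w = 1 * (R * F)\<close>, which gives uniqueness. Derivatives are never
  found by differentiating a series: that of \<open>u + L u\<close> is taken to be
  \<open>f - M u\<close>, that of \<open>u\<close> to be \<open>(1 + L)^(-1) (f - M u)\<close>, and
  only integrated identities are checked. The rates may be unbounded or accumulate at
  \<open>0\<close>, so no decay of \<open>R\<close> in the rate is used. All weights come from the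
  factor \<open>1 / (1 + lam)\<close>, which absorbs \<open>L\<close> and leaves at most
  \<open>L^(-1) M\<close> of \<open>M\<close>. Each scalar identity holds off a null set depending
  on the coefficient; a countable index set unites these. For \<open>t > 0\<close> uniqueness is
  meant almost everywhere, because the weak equation sees only integrals.\<close>

lemma Gamma_lower_bound:
  fixes x A :: real
  assumes x: "1 \<le> x" and A: "0 < A"
  shows "A powr (x - 1) * exp (- A) \<le> Gamma x"
proof (rule has_integral_le)
  \<comment> \<open>Only \<open>t >= A\<close> is kept of the Gamma integral, and there
    \<open>t powr (x - 1) >= A powr (x - 1)\<close>. As \<open>A\<close> is free, the bound beats
    every geometric rate in \<open>x\<close>.\<close>
  have "((\<lambda>t. A powr (x - 1) * exp (- 1 * t)) has_integral A powr (x - 1) * (exp (- 1 * A) / 1)) {A..}"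
    by (intro has_integral_mult_right has_integral_exp_minus_to_infinity) simp
  then show "((\<lambda>t. if t \<in> {A..} then A powr (x - 1) * exp (- t) else 0) has_integral
      A powr (x - 1) * exp (- A)) UNIV"
    by (simp only: has_integral_restrict_UNIV) simp
  have "((\<lambda>t. t powr (x - 1) / exp t) has_integral Gamma x) {0..}"
    using x by (intro Gamma_integral_real) simp
  then show "((\<lambda>t. if t \<in> {0..} then t powr (x - 1) / exp t else 0) has_integral Gamma x) UNIV"
    by (simp only: has_integral_restrict_UNIV)
  show "(if t \<in> {A..} then A powr (x - 1) * exp (- t) else 0)
      \<le> (if t \<in> {0..} then t powr (x - 1) / exp t else 0)" for t
    using x A by (auto simp: exp_minus field_simps intro!: powr_mono2)
qed

lemma summable_mittag_leffler:
  fixes \<alpha> \<beta> z :: real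
  assumes \<alpha>: "0 < \<alpha>" and \<beta>: "0 < \<beta>"
  shows "summable (\<lambda>m. z ^ m / Gamma (\<alpha> * real m + \<beta>))"
proof -
  \<comment> \<open>\<open>A powr \<alpha> = B\<close> makes the lower bound for
    \<open>Gamma (\<alpha> * real m + \<beta>)\<close> a constant times \<open>B ^ m\<close>, and
    \<open>B >= 2 * \<bar>z\<bar>\<close> leaves the ratio \<open>1 / 2\<close>.\<close>
  define B where "B = 2 * (\<bar>z\<bar> + 1)"
  define A where "A = B powr (1 / \<alpha>)"
  have B: "0 < B" by (simp add: B_def)
  then have A: "0 < A" and AB: "A powr \<alpha> = B"
    using \<alpha> by (auto simp: A_def powr_powr)
  define C where "C = exp A * A powr (1 - \<beta>)"
  \<comment> \<open>From index \<open>N\<close> on the argument of Gamma is at least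
    \<open>1\<close>, the range of \<open>Gamma_lower_bound\<close>.\<close>
  obtain N where N: "1 / \<alpha> \<le> real N" using real_arch_simple by blast
  have le: "norm (z ^ m / Gamma (\<alpha> * real m + \<beta>)) \<le> C * (1 / 2) ^ m" if m: "N \<le> m" for m
  proof -
    have "1 \<le> \<alpha> * real N" using N \<alpha> by (simp add: field_simps)
    also have "\<dots> \<le> \<alpha> * real m" using m \<alpha> by simp
    finally have 1: "1 \<le> \<alpha> * real m + \<beta>" using \<beta> by simp
    have lower: "A powr (\<alpha> * real m + \<beta> - 1) * exp (- A) \<le> Gamma (\<alpha> * real m + \<beta>)"
      by (rule Gamma_lower_bound[OF 1 A])
    have pos: "0 < A powr (\<alpha> * real m + \<beta> - 1) * exp (- A)" using A by simp
    have "A powr (\<alpha> * real m + \<beta> - 1) = (A powr \<alpha>) powr real m * A powr (\<beta> - 1)"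
      by (simp add: powr_powr powr_add[symmetric] algebra_simps)
    also have "\<dots> = B ^ m * A powr (\<beta> - 1)"
      using B by (simp add: AB powr_realpow)
    finally have eq: "A powr (\<alpha> * real m + \<beta> - 1) * exp (- A) = B ^ m * A powr (\<beta> - 1) * exp (- A)"
      by simp
    have "norm (z ^ m / Gamma (\<alpha> * real m + \<beta>)) \<le> \<bar>z\<bar> ^ m / (A powr (\<alpha> * real m + \<beta> - 1) * exp (- A))"
    proof -
      have "norm (z ^ m / Gamma (\<alpha> * real m + \<beta>)) = \<bar>z\<bar> ^ m / Gamma (\<alpha> * real m + \<beta>)"
        using lower pos by (simp add: power_abs)
      then show ?thesis using lower pos by (simp only:) (intro frac_le, auto)
    qed
    also have "\<dots> = C * (\<bar>z\<bar> / B) ^ m"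
    proof -
      have "inverse (A powr (\<beta> - 1)) = A powr (1 - \<beta>)"
        by (simp add: powr_minus[symmetric])
      then show ?thesis
        unfolding eq by (simp add: C_def exp_minus power_mult_distrib power_inverse divide_inverse inverse_mult_distrib)
    qed
    also have "\<dots> \<le> C * (1 / 2) ^ m"
      using B by (intro mult_left_mono power_mono) (auto simp: C_def B_def field_simps)
    finally show ?thesis .
  qed
  show ?thesis
    by (rule summable_comparison_test'[of "\<lambda>m. C * (1 / 2) ^ m" N])
       (intro summable_mult summable_geometric, simp, rule le)
qed

text \<open>Splitting off the term \<open>m = 0\<close> shifts the second parameter by \<alpha>.
  With \<open>\<beta> = \<alpha>\<close> this becomes the Volterra equation of the resolvent, with
  \<open>\<beta> = 1\<close> the formula for its primitive.\<close>

lemma mittag_leffler_rec: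
  assumes "0 < \<alpha>" "0 < \<beta>"
  shows "mittag_leffler \<alpha> \<beta> z = 1 / Gamma \<beta> + z * mittag_leffler \<alpha> (\<alpha> + \<beta>) z"
proof -
  have "mittag_leffler \<alpha> \<beta> z
    = 1 / Gamma \<beta> + (\<Sum>m. z ^ Suc m / Gamma (\<alpha> * real (Suc m) + \<beta>))"
    using suminf_split_head[OF summable_mittag_leffler[OF assms, of z]]
    by (simp add: mittag_leffler_def)
  also have "(\<lambda>m. z ^ Suc m / Gamma (\<alpha> * real (Suc m) + \<beta>))
    = (\<lambda>m. z * (z ^ m / Gamma (\<alpha> * real m + (\<alpha> + \<beta>))))"
    by (simp add: algebra_simps)
  also have "suminf \<dots> = z * mittag_leffler \<alpha> (\<alpha> + \<beta>) z"
    unfolding mittag_leffler_def using assms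
    by (intro suminf_mult summable_mittag_leffler) auto
  finally show ?thesis .
qed

lemma mittag_leffler_0: "mittag_leffler \<alpha> \<beta> 0 = 1 / Gamma \<beta>"
  unfolding mittag_leffler_def
  by (subst suminf_finite[of "{0}"]) auto

lemma continuous_mittag_leffler:
  assumes "0 < \<alpha>" "0 < \<beta>"
  shows "isCont (mittag_leffler \<alpha> \<beta>) z"
proof -
  have "isCont (\<lambda>z. \<Sum>m. inverse (Gamma (\<alpha> * real m + \<beta>)) * z ^ m) z"
    using summable_mittag_leffler[OF assms]
    by (intro isCont_powser_converges_everywhere) (simp add: field_simps)
  then show ?thesis
    by (simp add: mittag_leffler_def[abs_def] field_simps)
qed

lemma borel_measurable_mittag_leffler [measurable]:
  assumes "0 < \<alpha>" "0 < \<beta>"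
  shows "mittag_leffler \<alpha> \<beta> \<in> borel_measurable borel"
  using continuous_mittag_leffler[OF assms]
  by (intro borel_measurable_continuous_onI) (simp add: continuous_on_eq_continuous_at)

section \<open>Fractional integrals of Mittag-Leffler functions\<close>

lemma has_bochner_integral_Beta_scaled:
  fixes a b t :: real
  assumes a: "0 < a" and b: "0 < b" and t: "0 < t"
  shows "has_bochner_integral lborel (\<lambda>s. indicator {0<..<t} s * (s powr (a - 1) * (t - s) powr (b - 1)))
           (t powr (a + b - 1) * Beta a b)"
proof -
  define h where "h s = indicator {0<..<1} s * (s powr (a - 1) * (1 - s) powr (b - 1))" for s :: real
  \<comment> \<open>At both endpoints the product vanishes because \<open>0 powr x = 0\<close> for
    every real \<open>x\<close>, so the open and the closed interval give the same
    integrand.\<close>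
  have h: "indicator {0..1} s *\<^sub>R (s powr (a - 1) * (1 - s) powr (b - 1)) = h s" for s
    by (cases "s = 0 \<or> s = 1") (auto simp: h_def split: split_indicator)
  have "integrable lborel h"
    using integrable_Beta[OF a b] unfolding set_integrable_def h by simp
  moreover have "integral\<^sup>L lborel h = Beta a b"
    using set_borel_integral_eq_integral(2)[OF integrable_Beta[OF a b]]
      integral_unique[OF has_integral_Beta_real[OF a b]]
    unfolding set_lebesgue_integral_def h by simp
  ultimately have "has_bochner_integral lborel (\<lambda>s. t powr (a + b - 2) * h s) (t powr (a + b - 2) * Beta a b)"
    by (intro has_bochner_integral_mult_right) (auto simp: has_bochner_integral_iff)
  also have "(\<lambda>s. t powr (a + b - 2) * h s)
      = (\<lambda>s. indicator {0<..<t} (0 + t * s) * ((0 + t * s) powr (a - 1) * (t - (0 + t * s)) powr (b - 1)))"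
  proof
    fix s
    show "t powr (a + b - 2) * h s
      = indicator {0<..<t} (0 + t * s) * ((0 + t * s) powr (a - 1) * (t - (0 + t * s)) powr (b - 1))"
    proof (cases "s \<in> {0<..<1}")
      case True
      have "t - t * s = t * (1 - s)" by (simp add: algebra_simps)
      then have "(t * s) powr (a - 1) * (t - t * s) powr (b - 1)
         = t powr (a - 1) * t powr (b - 1) * (s powr (a - 1) * (1 - s) powr (b - 1))"
        using True t by (simp only: powr_mult) simp
      also have "t powr (a - 1) * t powr (b - 1) = t powr (a + b - 2)"
        by (simp add: powr_add[symmetric] algebra_simps)
      finally show ?thesis using True t by (simp add: h_def)
    next
      case False
      then show ?thesis using t by (auto simp: h_def zero_less_mult_iff split: split_indicator)
    qed
  qed
  \<comment> \<open>The missing factor \<open>1 / t\<close> is the Jacobian of the substitution that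
    scales the unit interval to \<open>(0,t)\<close>.\<close>
  also have "t powr (a + b - 2) * Beta a b = (t powr (a + b - 1) * Beta a b) /\<^sub>R \<bar>t\<bar>"
    using t powr_diff[of t "a + b - 1" 1] by (simp add: algebra_simps divide_inverse)
  finally show ?thesis
    using t by (subst lborel_has_bochner_integral_real_affine_iff[of t _ _ 0]) auto
qed

text \<open>Computed termwise: every term of the series is a Beta integral.\<close>

lemma has_bochner_integral_mittag_leffler:
  assumes \<alpha>: "0 < \<alpha>" and \<beta>: "0 < \<beta>" and \<gamma>: "0 < \<gamma>" and t: "0 < t"
  shows "has_bochner_integral lborel
     (\<lambda>s. indicator {0<..<t} s * ((t - s) powr (\<beta> - 1) / Gamma \<beta> *
            (s powr (\<gamma> - 1) * mittag_leffler \<alpha> \<gamma> (z * s powr \<alpha>))))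
     (t powr (\<beta> + \<gamma> - 1) * mittag_leffler \<alpha> (\<beta> + \<gamma>) (z * t powr \<alpha>))"
proof -
  define p where "p m = \<alpha> * real m + \<gamma>" for m
  have p: "0 < p m" for m using \<alpha> \<gamma> by (auto simp: p_def intro: add_nonneg_pos)
  define q where "q s = indicator {0<..<t} s * ((t - s) powr (\<beta> - 1) / Gamma \<beta> * s powr (\<gamma> - 1))" for s
  define F where "F z m s = q s * ((z * s powr \<alpha>) ^ m / Gamma (p m))" for z m s
  have G\<beta>: "0 < Gamma \<beta>" using \<beta> by (rule Gamma_real_pos)
  have q0: "0 \<le> q s" for s using G\<beta> by (simp add: q_def)
  have F: "has_bochner_integral lborel (F z m)
      (t powr (\<beta> + \<gamma> - 1) * ((z * t powr \<alpha>) ^ m / Gamma (\<alpha> * real m + (\<beta> + \<gamma>))))" for z m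
  proof -
    have "has_bochner_integral lborel
       (\<lambda>s. z ^ m / (Gamma (p m) * Gamma \<beta>) * (indicator {0<..<t} s * (s powr (p m - 1) * (t - s) powr (\<beta> - 1))))
       (z ^ m / (Gamma (p m) * Gamma \<beta>) * (t powr (p m + \<beta> - 1) * Beta (p m) \<beta>))"
      by (intro has_bochner_integral_mult_right has_bochner_integral_Beta_scaled p \<beta> t)
    also have "(\<lambda>s. z ^ m / (Gamma (p m) * Gamma \<beta>) * (indicator {0<..<t} s * (s powr (p m - 1) * (t - s) powr (\<beta> - 1))))
       = F z m"
    proof
      fix s
      have "s powr (p m - 1) = s powr (\<gamma> - 1) * (s powr \<alpha>) ^ m" if "0 < s"
        using that by (simp add: p_def powr_realpow[symmetric] powr_powr powr_add[symmetric] algebra_simps)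
      then show "z ^ m / (Gamma (p m) * Gamma \<beta>) * (indicator {0<..<t} s * (s powr (p m - 1) * (t - s) powr (\<beta> - 1))) = F z m s"
        by (auto simp: F_def q_def power_mult_distrib mult_ac split: split_indicator)
    qed
    also have "z ^ m / (Gamma (p m) * Gamma \<beta>) * (t powr (p m + \<beta> - 1) * Beta (p m) \<beta>)
       = t powr (\<beta> + \<gamma> - 1) * ((z * t powr \<alpha>) ^ m / Gamma (\<alpha> * real m + (\<beta> + \<gamma>)))"
    proof -
      have e1: "t powr (p m + \<beta> - 1) = t powr (\<beta> + \<gamma> - 1) * (t powr \<alpha>) ^ m"
        using t by (simp add: p_def powr_realpow[symmetric] powr_powr powr_add[symmetric] algebra_simps)
      have e2: "Gamma (p m + \<beta>) = Gamma (\<alpha> * real m + (\<beta> + \<gamma>))" by (simp add: p_def add_ac)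
      show ?thesis
        unfolding e1 Beta_def e2
        using G\<beta> Gamma_real_pos[OF p, of m] by (simp add: power_mult_distrib)
    qed
    finally show ?thesis .
  qed
  \<comment> \<open>The absolute value of a term is the same term at \<open>\<bar>z\<bar>\<close>,
    so the absolute convergence needed to exchange sum and integral is the same Beta computation
    with \<open>\<bar>z\<bar>\<close> in place of \<open>z\<close>.\<close>
  have norm_F: "norm (F z m s) = F \<bar>z\<bar> m s" for m s
    using q0[of s] Gamma_real_pos[OF p, of m]
    by (simp add: F_def abs_mult power_abs abs_div_pos)
  have sum: "summable (\<lambda>m. (w * t powr \<alpha>) ^ m / Gamma (\<alpha> * real m + (\<beta> + \<gamma>)))" for w
    using \<alpha> \<beta> \<gamma> by (intro summable_mittag_leffler) auto
  have int: "integrable lborel (F z m)" for m using F by (simp add: has_bochner_integral_iff)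
  have ae: "AE s in lborel. summable (\<lambda>m. norm (F z m s))"
    unfolding norm_F unfolding F_def p_def
    by (intro AE_I2 summable_mult summable_mittag_leffler \<alpha> \<gamma>)
  have sumint: "summable (\<lambda>m. LINT s|lborel. norm (F z m s))"
    unfolding norm_F has_bochner_integral_integral_eq[OF F]
    by (intro summable_mult sum)
  have S: "(\<Sum>m. F z m s) = indicator {0<..<t} s * ((t - s) powr (\<beta> - 1) / Gamma \<beta> *
            (s powr (\<gamma> - 1) * mittag_leffler \<alpha> \<gamma> (z * s powr \<alpha>)))" for s
  proof -
    have "(\<Sum>m. F z m s) = q s * mittag_leffler \<alpha> \<gamma> (z * s powr \<alpha>)"
      unfolding F_def p_def mittag_leffler_def
      by (intro suminf_mult summable_mittag_leffler \<alpha> \<gamma>)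
    then show ?thesis by (simp add: q_def)
  qed
  have "integrable lborel (\<lambda>s. \<Sum>m. F z m s)"
    by (rule integrable_suminf[OF int ae sumint])
  moreover have "(LINT s|lborel. (\<Sum>m. F z m s))
      = t powr (\<beta> + \<gamma> - 1) * mittag_leffler \<alpha> (\<beta> + \<gamma>) (z * t powr \<alpha>)"
    unfolding integral_suminf[OF int ae sumint] has_bochner_integral_integral_eq[OF F] mittag_leffler_def
    by (intro suminf_mult sum)
  ultimately show ?thesis
    by (simp only: has_bochner_integral_iff S simp_thms)
qed

section \<open>Positivity and bounds on the negative half-line\<close>

lemma has_bochner_integral_powr_Ioo:
  fixes a t :: real
  assumes a: "0 < a" and t: "0 < t"
  shows "has_bochner_integral lborel (\<lambda>s. indicator {0<..<t} s * s powr (a - 1)) (t powr a / a)"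
proof -
  have "has_bochner_integral lborel
      (\<lambda>s. indicator {0<..<t} s * (s powr (a - 1) * (t - s) powr (1 - 1))) (t powr (a + 1 - 1) * Beta a 1)"
    using a t by (intro has_bochner_integral_Beta_scaled) auto
  also have "(\<lambda>s. indicator {0<..<t} s * (s powr (a - 1) * (t - s) powr (1 - 1)))
      = (\<lambda>s. indicator {0<..<t} s * s powr (a - 1))"
    by (auto simp: fun_eq_iff split: split_indicator)
  also have "Beta a 1 = 1 / a"
  proof -
    have "a \<notin> \<int>\<^sub>\<le>\<^sub>0" using a by (auto elim!: nonpos_Ints_cases)
    then show ?thesis using Gamma_plus1[of a] Gamma_real_pos[OF a] by (simp add: Beta_def)
  qed
  finally show ?thesis by simp
qed

text \<open>At a first zero \<open>t0\<close> of the resolvent \<open>R\<close> one compares the Volterra equation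
  \<open>R + a * R = a\<close> at \<open>t0\<close> and at a slightly smaller \<open>t1\<close>: since \<open>a (t0 - s) / a (t1 - s)\<close> decreases in
  \<open>s\<close>, the past up to \<open>t1\<close> contributes too little, and the remaining short piece cannot make up for it.\<close>

lemma mittag_leffler_pos:
  assumes \<alpha>: "0 < \<alpha>" "\<alpha> < 1" and x: "0 \<le> x"
  shows "0 < mittag_leffler \<alpha> \<alpha> (- x)"
proof (rule ccontr)
  \<comment> \<open>Rate \<open>1\<close> is enough: every \<open>x >= 0\<close> equals
    \<open>t powr \<alpha>\<close> for \<open>t = x powr (1 / \<alpha>)\<close>, so a nonpositive
    value of the function is a nonpositive value of \<open>P\<close>. The singular factor is kept
    apart because \<open>P\<close>, unlike \<open>R\<close>, is continuous at
    \<open>0\<close>.\<close>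
  define P where "P t = mittag_leffler \<alpha> \<alpha> (- (t powr \<alpha>))" for t
  define R where "R t = t powr (\<alpha> - 1) * P t" for t
  define a where "a t = t powr (\<alpha> - 1) / Gamma \<alpha>" for t
  have G: "0 < Gamma \<alpha>" using \<alpha> by (intro Gamma_real_pos) simp
  have a_pos: "0 < a t" if "0 < t" for t using that G by (simp add: a_def)
  have volterra: "has_bochner_integral lborel (\<lambda>s. indicator {0<..<t} s * (a (t - s) * R s)) (a t - R t)"
    if t: "0 < t" for t
  proof -
    have "a t - R t = t powr (\<alpha> + \<alpha> - 1) * mittag_leffler \<alpha> (\<alpha> + \<alpha>) (- 1 * t powr \<alpha>)"
    proof -
      have "R t = t powr (\<alpha> - 1) * (1 / Gamma \<alpha> + (- (t powr \<alpha>)) * mittag_leffler \<alpha> (\<alpha> + \<alpha>) (- (t powr \<alpha>)))"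
        using \<alpha> by (simp only: R_def P_def mittag_leffler_rec[of \<alpha> \<alpha> "- (t powr \<alpha>)"])
      also have "\<dots> = a t - t powr (\<alpha> - 1) * t powr \<alpha> * mittag_leffler \<alpha> (\<alpha> + \<alpha>) (- (t powr \<alpha>))"
        by (simp add: a_def algebra_simps)
      also have "t powr (\<alpha> - 1) * t powr \<alpha> = t powr (\<alpha> + \<alpha> - 1)"
        by (simp add: powr_add[symmetric] algebra_simps)
      finally show ?thesis by simp
    qed
    moreover have "(\<lambda>s. indicator {0<..<t} s * (a (t - s) * R s))
      = (\<lambda>s. indicator {0<..<t} s * ((t - s) powr (\<alpha> - 1) / Gamma \<alpha> *
            (s powr (\<alpha> - 1) * mittag_leffler \<alpha> \<alpha> (- 1 * s powr \<alpha>))))"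
      by (simp add: a_def R_def P_def)
    ultimately show ?thesis
      using has_bochner_integral_mittag_leffler[of \<alpha> \<alpha> \<alpha> t "- 1"] \<alpha> t by (simp only:)
  qed
  assume neg: "\<not> 0 < mittag_leffler \<alpha> \<alpha> (- x)"
  define t' where "t' = x powr (1 / \<alpha>)"
  have t': "0 \<le> t'" "P t' \<le> 0"
    using neg x \<alpha> by (auto simp: t'_def P_def powr_powr)
  have contP: "continuous_on {0..} P"
  proof -
    have "continuous_on UNIV (mittag_leffler \<alpha> \<alpha>)"
      using \<alpha> by (simp add: continuous_on_eq_continuous_at continuous_mittag_leffler)
    moreover have "continuous_on {0..} (\<lambda>t. - (t powr \<alpha>))"
      by (intro continuous_on_minus continuous_on_powr' continuous_on_id continuous_on_const)
        (use \<alpha> in auto)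
    ultimately show ?thesis
      unfolding P_def by (rule continuous_on_compose2) auto
  qed
  define S where "S = {0..t'} \<inter> P -` {..0}"
  have "continuous_on {0..t'} P" by (rule continuous_on_subset[OF contP]) auto
  then have "closed S" unfolding S_def
    by (intro continuous_closed_preimage) auto
  moreover have "bounded S"
    by (rule bounded_subset[OF bounded_closed_interval[of 0 t']]) (auto simp: S_def)
  moreover have "t' \<in> S" using t' by (auto simp: S_def)
  ultimately obtain t0 where "t0 \<in> S" and min: "\<And>t. t \<in> S \<Longrightarrow> t0 \<le> t"
    using compact_attains_inf[of S] by (auto simp: compact_eq_bounded_closed)
  then have t0: "0 \<le> t0" "t0 \<le> t'" "P t0 \<le> 0" by (auto simp: S_def)
  have P_pos: "0 < P t" if "0 \<le> t" "t < t0" for t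
    using min[of t] that t0 by (auto simp: S_def not_less[symmetric])
  have "P 0 = 1 / Gamma \<alpha>" by (simp add: P_def mittag_leffler_0)
  then have t0_pos: "0 < t0" using t0 G by (cases "t0 = 0") auto
  have R_pos: "0 < R t" if "0 < t" "t < t0" for t
    using that P_pos[of t] by (simp add: R_def)
  have R_t0: "R t0 \<le> 0" using t0 by (simp add: R_def mult_nonneg_nonpos)
  \<comment> \<open>The two caps serve the two sides of the final comparison:
    \<open>\<delta> <= t0 / 2\<close> keeps \<open>t1 / t0 >= 1 / 2\<close>, and the second cap
    makes the integral of \<open>a\<close> over \<open>(0,\<delta>)\<close>, which is
    \<open>\<delta> powr \<alpha> / (\<alpha> * Gamma \<alpha>)\<close>, at most
    \<open>1 / 4\<close>.\<close>
  define \<delta> where "\<delta> = min (t0 / 2) ((\<alpha> * Gamma \<alpha> / 4) powr (1 / \<alpha>))"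
  have \<delta>: "0 < \<delta>" "\<delta> \<le> t0 / 2" using t0_pos \<alpha> less_imp_neq[OF G] by (auto simp: \<delta>_def)
  have "\<delta> powr \<alpha> \<le> ((\<alpha> * Gamma \<alpha> / 4) powr (1 / \<alpha>)) powr \<alpha>"
    using \<delta> \<alpha> by (intro powr_mono2) (auto simp: \<delta>_def)
  also have "\<dots> = \<alpha> * Gamma \<alpha> / 4" using \<alpha> G by (simp add: powr_powr)
  finally have \<delta>\<alpha>: "\<delta> powr \<alpha> \<le> \<alpha> * Gamma \<alpha> / 4" .
  have "continuous_on {t0 - \<delta>..t0} R"
    unfolding R_def using \<delta> t0_pos
    by (intro continuous_intros continuous_on_subset[OF contP]) auto
  \<comment> \<open>A maximum point bounds \<open>R\<close> on the last piece by
    \<open>R t1\<close>; it lies strictly before \<open>t0\<close> because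
    \<open>R t0 <= 0 < R (t0 - \<delta>)\<close>.\<close>
  then obtain t1 where t1: "t0 - \<delta> \<le> t1" "t1 \<le> t0" and max: "\<And>t. t0 - \<delta> \<le> t \<Longrightarrow> t \<le> t0 \<Longrightarrow> R t \<le> R t1"
    using continuous_attains_sup[of "{t0 - \<delta>..t0}" R] \<delta> by auto
  have R_t1: "0 < R t1"
    using R_pos[of "t0 - \<delta>"] max[of "t0 - \<delta>"] \<delta> t0_pos by simp
  then have t1_lt: "t1 < t0" using R_t0 t1 by (cases "t1 = t0") auto
  have t1_pos: "0 < t1" "t0 / 2 \<le> t1" using t1 \<delta> t0_pos by auto
  define d where "d = t0 - t1"
  have d: "0 < d" "d \<le> \<delta>" using t1 t1_lt by (auto simp: d_def)
  define q where "q = a t0 / a t1"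
  have tail: "has_bochner_integral lborel (\<lambda>s. indicator {t1<..<t0} s * a (t0 - s)) (d powr \<alpha> / (\<alpha> * Gamma \<alpha>))"
  proof -
    have "has_bochner_integral lborel
        (\<lambda>s. indicator {0<..<d} (t0 + - 1 * s) * (t0 + - 1 * s) powr (\<alpha> - 1)) ((d powr \<alpha> / \<alpha>) /\<^sub>R \<bar>- 1\<bar>)"
      using lborel_has_bochner_integral_real_affine_iff[of "- 1" "\<lambda>s. indicator {0<..<d} s * s powr (\<alpha> - 1)" "d powr \<alpha> / \<alpha>" t0]
        has_bochner_integral_powr_Ioo[of \<alpha> d] d \<alpha> by simp
    then have "has_bochner_integral lborel
        (\<lambda>s. (indicator {0<..<d} (t0 + - 1 * s) * (t0 + - 1 * s) powr (\<alpha> - 1)) / Gamma \<alpha>) (((d powr \<alpha> / \<alpha>) /\<^sub>R \<bar>- 1\<bar>) / Gamma \<alpha>)"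
      using G by (intro has_bochner_integral_divide) auto
    moreover have "(\<lambda>s. (indicator {0<..<d} (t0 + - 1 * s) * (t0 + - 1 * s) powr (\<alpha> - 1)) / Gamma \<alpha>)
        = (\<lambda>s. indicator {t1<..<t0} s * a (t0 - s))"
      by (auto simp: fun_eq_iff a_def d_def split: split_indicator)
    ultimately show ?thesis by simp
  qed
  \<comment> \<open>In the Volterra integral at \<open>t0\<close>, the past before \<open>t1\<close>
    is at most \<open>q\<close> times the Volterra integral at \<open>t1\<close>, whose value is
    \<open>a t1 - R t1\<close>; the rest is at most \<open>R t1\<close> times the integral of
    \<open>a\<close> over a length \<open>d\<close>.\<close>
  have "a t0 - R t0 \<le> q * (a t1 - R t1) + R t1 * (d powr \<alpha> / (\<alpha> * Gamma \<alpha>))"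
  proof -
    have upper: "has_bochner_integral lborel (\<lambda>s. q * (indicator {0<..<t1} s * (a (t1 - s) * R s))
        + R t1 * (indicator {t1<..<t0} s * a (t0 - s)))
        (q * (a t1 - R t1) + R t1 * (d powr \<alpha> / (\<alpha> * Gamma \<alpha>)))"
      by (intro has_bochner_integral_add has_bochner_integral_mult_right volterra t1_pos tail)
    have "AE s in lborel. indicator {0<..<t0} s * (a (t0 - s) * R s)
       \<le> q * (indicator {0<..<t1} s * (a (t1 - s) * R s)) + R t1 * (indicator {t1<..<t0} s * a (t0 - s))"
      using AE_lborel_singleton[of t1]
    proof eventually_elim
      case (elim s)
      have "a (t0 - s) * R s \<le> q * (a (t1 - s) * R s)" if s: "0 < s" "s < t1"
      proof -
        have "t0 / t1 \<le> (t0 - s) / (t1 - s)"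
          using s t1_lt by (simp add: field_simps)
        then have "((t0 - s) / (t1 - s)) powr (\<alpha> - 1) \<le> (t0 / t1) powr (\<alpha> - 1)"
          using \<alpha> t0_pos t1_pos by (intro powr_mono2') auto
        then have "(t0 - s) powr (\<alpha> - 1) * t1 powr (\<alpha> - 1) \<le> t0 powr (\<alpha> - 1) * (t1 - s) powr (\<alpha> - 1)"
          using s t1_lt by (simp add: powr_divide field_simps)
        then have "a (t0 - s) \<le> q * a (t1 - s)"
          using s t1_pos G by (simp add: q_def a_def field_simps)
        then show ?thesis
          using mult_right_mono[of "a (t0 - s)" "q * a (t1 - s)" "R s"] R_pos[of s] s t1_lt by (simp add: mult_ac)
      qed
      moreover have "a (t0 - s) * R s \<le> R t1 * a (t0 - s)" if s: "t1 < s" "s < t0"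
        using max[of s] t1 s a_pos[of "t0 - s"] by (simp add: mult.commute)
      ultimately show ?case
        using elim t1_lt t1_pos by (auto split: split_indicator)
    qed
    then show ?thesis
      using integral_mono_AE[of lborel, OF integrable.intros[OF volterra[OF t0_pos]]
          integrable.intros[OF upper]]
      unfolding has_bochner_integral_integral_eq[OF volterra[OF t0_pos]] has_bochner_integral_integral_eq[OF upper]
      by simp
  qed
  moreover have "q * a t1 = a t0" using a_pos[OF t1_pos(1)] by (simp add: q_def)
  \<comment> \<open>The terms \<open>q * a t1\<close> and \<open>a t0\<close> cancel and
    \<open>R t0 <= 0\<close> is dropped. So \<open>q\<close>, which is at least
    \<open>t1 / t0 >= 1 / 2\<close>, would be at most \<open>1 / 4\<close>.\<close>
  ultimately have "R t1 * q \<le> R t1 * (d powr \<alpha> / (\<alpha> * Gamma \<alpha>))"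
    using R_t0 by (simp add: algebra_simps)
  then have le: "q \<le> d powr \<alpha> / (\<alpha> * Gamma \<alpha>)"
    using R_t1 by (rule mult_left_le_imp_le)
  have "q = (t1 / t0) powr (1 - \<alpha>)"
    using t0_pos t1_pos less_imp_neq[OF G] \<alpha> by (simp add: q_def a_def powr_divide powr_diff)
  also have "\<dots> \<ge> (t1 / t0) powr 1"
    using t0_pos t1_pos t1_lt \<alpha> by (intro powr_mono') auto
  finally have "t1 / t0 \<le> q" using t0_pos t1_pos by simp
  moreover have "1 / 2 \<le> t1 / t0" using t0_pos t1_pos by (simp add: field_simps)
  moreover have "d powr \<alpha> / (\<alpha> * Gamma \<alpha>) \<le> 1 / 4"
  proof -
    have "d powr \<alpha> \<le> \<delta> powr \<alpha>" using d \<alpha> by (intro powr_mono2) auto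
    then show ?thesis using \<delta>\<alpha> \<alpha> G by (simp add: field_simps)
  qed
  ultimately show False using le by simp
qed

text \<open>Up to a positive power of \<open>t\<close>, the value is the fractional integral of
  order \<beta> of the positive function \<open>s powr (\<alpha> - 1) * mittag_leffler \<alpha>
  \<alpha> (- (s powr \<alpha>))\<close>. The point \<open>x = 0\<close> stands apart because there
  \<open>t\<close> would be \<open>0\<close>.\<close>

lemma mittag_leffler_nonneg:
  assumes \<alpha>: "0 < \<alpha>" "\<alpha> < 1" and \<beta>: "0 < \<beta>" and x: "0 \<le> x"
  shows "0 \<le> mittag_leffler \<alpha> (\<beta> + \<alpha>) (- x)"
proof (cases "x = 0")
  case True
  then show ?thesis using Gamma_real_pos[of "\<beta> + \<alpha>"] \<alpha> \<beta> by (simp add: mittag_leffler_0)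
next
  case False
  define t where "t = x powr (1 / \<alpha>)"
  have t: "0 < t" "- 1 * t powr \<alpha> = - x" using False x \<alpha> by (auto simp: t_def powr_powr)
  have "has_bochner_integral lborel
     (\<lambda>s. indicator {0<..<t} s * ((t - s) powr (\<beta> - 1) / Gamma \<beta> *
            (s powr (\<alpha> - 1) * mittag_leffler \<alpha> \<alpha> (- 1 * s powr \<alpha>))))
     (t powr (\<beta> + \<alpha> - 1) * mittag_leffler \<alpha> (\<beta> + \<alpha>) (- 1 * t powr \<alpha>))"
    using \<alpha> \<beta> t by (intro has_bochner_integral_mittag_leffler) auto
  moreover have "0 \<le> indicator {0<..<t} s * ((t - s) powr (\<beta> - 1) / Gamma \<beta> *
            (s powr (\<alpha> - 1) * mittag_leffler \<alpha> \<alpha> (- 1 * s powr \<alpha>)))" for s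
    using mittag_leffler_pos[OF \<alpha>, of "s powr \<alpha>"] Gamma_real_pos[OF \<beta>] by simp
  ultimately have "0 \<le> t powr (\<beta> + \<alpha> - 1) * mittag_leffler \<alpha> (\<beta> + \<alpha>) (- 1 * t powr \<alpha>)"
    by (metis (no_types, lifting) has_bochner_integral_integral_eq integral_nonneg_AE AE_I2)
  then show ?thesis using t by (simp add: zero_le_mult_iff)
qed

lemma mittag_leffler_diag_le:
  assumes \<alpha>: "0 < \<alpha>" "\<alpha> < 1" and x: "0 \<le> x"
  shows "mittag_leffler \<alpha> \<alpha> (- x) \<le> 1 / Gamma \<alpha>"
  using mittag_leffler_rec[of \<alpha> \<alpha> "- x"] mittag_leffler_nonneg[of \<alpha> \<alpha> x] assms by simp

text \<open>The lower bound is \<open>mittag_leffler_nonneg\<close> at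
  \<open>\<beta> = 1 - \<alpha>\<close>; the upper one is the recurrence at
  \<open>\<beta> = 1\<close>, whose correction
  \<open>- x * mittag_leffler \<alpha> (\<alpha> + 1) (- x)\<close> is nonpositive.\<close>

lemma mittag_leffler_1_bounds:
  assumes \<alpha>: "0 < \<alpha>" "\<alpha> < 1" and x: "0 \<le> x"
  shows "0 \<le> mittag_leffler \<alpha> 1 (- x)" "mittag_leffler \<alpha> 1 (- x) \<le> 1"
  using mittag_leffler_nonneg[of \<alpha> "1 - \<alpha>" x] mittag_leffler_nonneg[of \<alpha> 1 x]
    mittag_leffler_rec[of \<alpha> 1 "- x"] assms by (auto simp: add.commute)

subsection \<open>Convolutions on the real line\<close>

text \<open>The Bochner integral is \<open>0\<close> where the integrand is not integrable. For
  integrable factors this can happen only on a null set, which is why additivity and associativity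
  are stated almost everywhere.\<close>

definition convolution :: "(real \<Rightarrow> real) \<Rightarrow> (real \<Rightarrow> 'b::{banach,second_countable_topology}) \<Rightarrow> real \<Rightarrow> 'b"
  where "convolution k g t = (LINT s|lborel. k (t - s) *\<^sub>R g s)"

lemma integrable_convolution_product:
  fixes g :: "real \<Rightarrow> 'b::{banach,second_countable_topology}"
  assumes k: "integrable lborel k" and g: "integrable lborel g"
  shows "integrable (lborel \<Otimes>\<^sub>M lborel) (\<lambda>(s, t). k (t - s) *\<^sub>R g s)"
proof (rule lborel_pair.Fubini_integrable)
  have [measurable]: "k \<in> borel_measurable borel" "g \<in> borel_measurable borel"
    using k g by (auto dest: borel_measurable_integrable)
  show "(\<lambda>(s, t). k (t - s) *\<^sub>R g s) \<in> borel_measurable (lborel \<Otimes>\<^sub>M lborel)"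
    by measurable
  have kn: "integrable lborel (\<lambda>t. k (t - s))" for s
    using lborel_integrable_real_affine[OF k, of 1 "- s"] by simp
  have "(LINT t|lborel. \<bar>k (t - s)\<bar>) = (LINT t|lborel. \<bar>k t\<bar>)" for s
    using lborel_integral_real_affine[of 1 "\<lambda>t. \<bar>k t\<bar>" "- s"] by simp
  then show "integrable lborel (\<lambda>s. LINT t|lborel. norm (case (s, t) of (s, t) \<Rightarrow> k (t - s) *\<^sub>R g s))"
    using g by simp
  show "AE s in lborel. integrable lborel (\<lambda>t. case (s, t) of (s, t) \<Rightarrow> k (t - s) *\<^sub>R g s)"
    using kn by simp
qed

lemma integrable_convolution:
  fixes g :: "real \<Rightarrow> 'b::{banach,second_countable_topology}"
  assumes k: "integrable lborel k" and g: "integrable lborel g"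
  shows "integrable lborel (convolution k g)"
  using lborel_pair.integrable_snd[OF integrable_convolution_product[OF k g]]
  by (simp add: convolution_def[abs_def])

lemma AE_integrable_convolution:
  fixes g :: "real \<Rightarrow> 'b::{banach,second_countable_topology}"
  assumes k: "integrable lborel k" and g: "integrable lborel g"
  shows "AE t in lborel. integrable lborel (\<lambda>s. k (t - s) *\<^sub>R g s)"
  using lborel_pair.AE_integrable_snd[OF integrable_convolution_product[OF k g]] by simp

text \<open>Fubini for \<open>k (t - s) * l (s - q)\<close> times \<open>g q\<close>; it applies at
  every \<open>t\<close> where the iterated convolution of the absolute values converges, hence at
  almost every \<open>t\<close>.\<close>

lemma convolution_assoc:
  fixes g :: "real \<Rightarrow> 'b::{banach,second_countable_topology}"
  assumes k: "integrable lborel k" and l: "integrable lborel l" and g: "integrable lborel g"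
  shows "AE t in lborel. convolution k (convolution l g) t = convolution (convolution k l) g t"
proof -
  have [measurable]: "k \<in> borel_measurable borel" "l \<in> borel_measurable borel" "g \<in> borel_measurable borel"
    using k l g by (auto dest: borel_measurable_integrable)
  have "AE t in lborel. integrable lborel
     (\<lambda>s. \<bar>k (t - s)\<bar> *\<^sub>R convolution (\<lambda>s. \<bar>l s\<bar>) (\<lambda>s. norm (g s)) s)"
    using k l g by (intro AE_integrable_convolution integrable_convolution integrable_abs integrable_norm)
  then show ?thesis
  proof eventually_elim
    case (elim t)
    define H where "H = (\<lambda>s q. k (t - s) *\<^sub>R l (s - q) *\<^sub>R g q)"
    have [measurable]: "(\<lambda>(s, q). H s q) \<in> borel_measurable (lborel \<Otimes>\<^sub>M lborel)"
      unfolding H_def by measurable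
    have H: "integrable (lborel \<Otimes>\<^sub>M lborel) (\<lambda>(s, q). H s q)"
    proof (rule lborel_pair.Fubini_integrable)
      have "(\<lambda>s. LINT q|lborel. norm (H s q)) = (\<lambda>s. \<bar>k (t - s)\<bar> *\<^sub>R convolution (\<lambda>s. \<bar>l s\<bar>) (\<lambda>s. norm (g s)) s)"
        by (simp add: H_def convolution_def abs_mult mult.assoc)
      then show "integrable lborel (\<lambda>s. LINT q|lborel. norm (case (s, q) of (s, q) \<Rightarrow> H s q))"
        using elim by simp
      show "AE s in lborel. integrable lborel (\<lambda>q. case (s, q) of (s, q) \<Rightarrow> H s q)"
        using AE_integrable_convolution[OF l g] by eventually_elim (simp add: H_def del: scaleR_scaleR)
    qed measurable
    have "AE q in lborel. (LINT s|lborel. H s q) = convolution k l (t - q) *\<^sub>R g q"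
      using lborel_pair.AE_integrable_snd[OF H]
    proof eventually_elim
      case (elim q)
      show ?case
      \<comment> \<open>Dividing by \<open>norm (g q)\<close> shows that the scalar factor alone is
        integrable, so \<open>g q\<close> can be pulled out; where \<open>g q = 0\<close> both sides
        vanish.\<close>
      proof (cases "g q = 0")
        case False
        have "integrable lborel (\<lambda>s. norm (H s q) / norm (g q))"
          using elim by (intro integrable_divide integrable_norm) simp
        then have "integrable lborel (\<lambda>s. \<bar>k (t - s) * l (s - q)\<bar>)"
          using False by (simp add: H_def abs_mult)
        then have "integrable lborel (\<lambda>s. k (t - s) * l (s - q))"
          by (subst (asm) integrable_abs_iff) measurable
        then have "(LINT s|lborel. H s q) = (LINT s|lborel. k (t - s) * l (s - q)) *\<^sub>R g q"
          by (simp add: H_def)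
        also have "(LINT s|lborel. k (t - s) * l (s - q)) = convolution k l (t - q)"
          using lborel_integral_real_affine[of 1 "\<lambda>s. k (t - s) * l (s - q)" q]
          by (simp add: convolution_def algebra_simps)
        finally show ?thesis .
      qed (simp add: H_def)
    qed
    moreover have "(\<lambda>q. LINT s|lborel. H s q) \<in> borel_measurable lborel"
      by (rule borel_measurable_integrable) (rule lborel_pair.integrable_snd[OF H])
    moreover have [measurable]: "convolution k l \<in> borel_measurable borel"
      using integrable_convolution[OF k l] by (auto dest: borel_measurable_integrable)
    have "(\<lambda>q. convolution k l (t - q) *\<^sub>R g q) \<in> borel_measurable lborel" by measurable
    ultimately have "convolution (convolution k l) g t = (LINT q|lborel. LINT s|lborel. H s q)"
      unfolding convolution_def[of "convolution k l"]
      by (intro integral_cong_AE) auto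
    also have "\<dots> = (LINT s|lborel. LINT q|lborel. H s q)"
      using H by (rule lborel_pair.Fubini_integral)
    also have "\<dots> = convolution k (convolution l g) t"
      by (simp add: H_def convolution_def del: scaleR_scaleR)
    finally show ?case by simp
  qed
qed

lemma convolution_commute:
  fixes k l :: "real \<Rightarrow> real"
  shows "convolution k l t = convolution l k t"
  unfolding convolution_def
  using lborel_integral_real_affine[of "- 1" "\<lambda>s. k (t - s) *\<^sub>R l s" t] by (simp add: mult.commute)

lemma AE_convolution_diff:
  fixes g h :: "real \<Rightarrow> 'b::{banach,second_countable_topology}"
  assumes "integrable lborel k" "integrable lborel g" "integrable lborel h"
  shows "AE t in lborel. convolution k (\<lambda>s. g s - h s) t = convolution k g t - convolution k h t"
  using AE_integrable_convolution[OF assms(1,2)] AE_integrable_convolution[OF assms(1,3)]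
  by eventually_elim (simp add: convolution_def scaleR_diff_right)

lemma AE_convolution_add_left:
  fixes g :: "real \<Rightarrow> 'b::{banach,second_countable_topology}"
  assumes "integrable lborel k" "integrable lborel l" "integrable lborel g"
  shows "AE t in lborel. convolution (\<lambda>s. k s + l s) g t = convolution k g t + convolution l g t"
  using AE_integrable_convolution[OF assms(1,3)] AE_integrable_convolution[OF assms(2,3)]
  by eventually_elim (simp add: convolution_def scaleR_add_left)

lemma convolution_scaleR_right:
  "convolution k (\<lambda>s. c *\<^sub>R g s) t = c *\<^sub>R convolution k g t"
  unfolding convolution_def by (subst integral_scaleR_right[symmetric]) (simp add: mult.commute)

lemma convolution_scale_left:
  "convolution (\<lambda>s. c * k s) g t = c *\<^sub>R convolution k g t"
  unfolding convolution_def by (subst integral_scaleR_right[symmetric]) simp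

text \<open>In each coordinate the positive and the negative part are densities of finite measures
  that agree on all half-lines \<open>{x<..}\<close>. Such measures coincide, so the densities agree
  almost everywhere, and equal positive and negative parts are zero.\<close>

lemma AE_indefinite_integral_zero:
  fixes g :: "real \<Rightarrow> 'b::euclidean_space"
  assumes g: "integrable lborel g"
    and z: "\<And>x. (LINT s|lborel. indicator {x<..} s *\<^sub>R g s) = 0"
  shows "AE x in lborel. g x = 0"
proof -
  have "AE x in lborel. g x \<bullet> b = 0" if b: "b \<in> Basis" for b
  proof -
    define h where "h x = g x \<bullet> b" for x
    have h: "integrable lborel h" using g by (simp add: h_def[abs_def])
    then have [measurable]: "h \<in> borel_measurable borel" by (auto dest: borel_measurable_integrable)
    have hz: "(LINT s|lborel. indicator {x<..} s * h s) = 0" for x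
    proof -
      have "(LINT s|lborel. indicator {x<..} s * h s) = (LINT s|lborel. (indicator {x<..} s *\<^sub>R g s) \<bullet> b)"
        by (simp add: h_def)
      also have "\<dots> = (LINT s|lborel. indicator {x<..} s *\<^sub>R g s) \<bullet> b"
        by (rule integral_inner_left) (intro integrable_mult_indicator g impI, simp)
      finally show ?thesis using z by simp
    qed
    have eq: "emeasure (density lborel (\<lambda>x. ennreal (f x))) {x<..} = ennreal (LINT s|lborel. indicator {x<..} s * f s)"
      if "integrable lborel f" "\<And>x. 0 \<le> f x" for f and x :: real
    proof -
      have [measurable]: "f \<in> borel_measurable borel" using that by (auto dest: borel_measurable_integrable)
      have "emeasure (density lborel (\<lambda>x. ennreal (f x))) {x<..} = (\<integral>\<^sup>+ s. ennreal (f s) * indicator {x<..} s \<partial>lborel)"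
        by (simp add: emeasure_density)
      also have "\<dots> = (\<integral>\<^sup>+ s. ennreal (indicator {x<..} s * f s) \<partial>lborel)"
        by (intro nn_integral_cong) (auto split: split_indicator)
      also have "\<dots> = ennreal (LINT s|lborel. indicator {x<..} s * f s)"
        using that integrable_mult_indicator[OF _ that(1), of "{x<..}"]
        by (intro nn_integral_eq_integral) auto
      finally show ?thesis .
    qed
    have p: "integrable lborel (\<lambda>x. max 0 (h x))" "integrable lborel (\<lambda>x. max 0 (- h x))"
      using h by auto
    have "density lborel (\<lambda>x. ennreal (max 0 (h x))) = density lborel (\<lambda>x. ennreal (max 0 (- h x)))"
    proof (rule measure_eqI_lessThan)
      fix x
      have "(LINT s|lborel. indicator {x<..} s * max 0 (h s)) - (LINT s|lborel. indicator {x<..} s * max 0 (- h s))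
         = (LINT s|lborel. indicator {x<..} s * max 0 (h s) - indicator {x<..} s * max 0 (- h s))"
        using integrable_mult_indicator[OF _ p(1), of "{x<..}"] integrable_mult_indicator[OF _ p(2), of "{x<..}"]
        by (intro Bochner_Integration.integral_diff[symmetric]) auto
      also have "\<dots> = (LINT s|lborel. indicator {x<..} s * h s)"
        by (intro Bochner_Integration.integral_cong) (auto split: split_indicator)
      finally show "emeasure (density lborel (\<lambda>x. ennreal (max 0 (h x)))) {x<..} = emeasure (density lborel (\<lambda>x. ennreal (max 0 (- h x)))) {x<..}"
        using p hz by (simp add: eq)
    qed (use p in \<open>auto simp: eq\<close>)
    then have "AE x in lborel. ennreal (max 0 (h x)) = ennreal (max 0 (- h x))"
      by (intro sigma_finite_measure.density_unique[OF sigma_finite_lborel]) auto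
    then show ?thesis
      by eventually_elim (auto simp: h_def max_def split: if_splits)
  qed
  then have "AE x in lborel. \<forall>b\<in>Basis. g x \<bullet> b = 0"
    by (simp add: AE_finite_all)
  then show ?thesis
    by eventually_elim (simp add: euclidean_all_zero_iff)
qed

subsection \<open>The scalar fractional relaxation equation\<close>

text \<open>Vanishing at nonpositive arguments makes convolution with a truncated kernel causal: its
  value at \<open>t\<close> depends only on data before \<open>t\<close>.\<close>

definition truncate :: "real \<Rightarrow> (real \<Rightarrow> real) \<Rightarrow> real \<Rightarrow> real"
  where "truncate T k r = indicator {0<..T} r * k r"

lemma borel_measurable_truncate [measurable]:
  "k \<in> borel_measurable borel \<Longrightarrow> truncate T k \<in> borel_measurable borel"
  unfolding truncate_def[abs_def] by measurable

lemma borel_measurable_kernel_integrand: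
  fixes g :: "real \<Rightarrow> 'b::{banach,second_countable_topology}"
  assumes t: "t \<in> {0..T}" and g: "g \<in> borel_measurable (lebesgue_on {0..T})"
    and [measurable]: "\<kappa> \<in> borel_measurable borel"
  shows "(\<lambda>s. indicator {0..t} s *\<^sub>R \<kappa> (t - s) *\<^sub>R g s) \<in> borel_measurable lebesgue"
proof -
  have "(\<lambda>s. indicator {0..T} s *\<^sub>R g s) \<in> borel_measurable lebesgue"
    using g by (subst (asm) borel_measurable_restrict_space_iff) auto
  moreover have "(\<lambda>s. indicator {0..t} s *\<^sub>R \<kappa> (t - s)) \<in> borel_measurable lebesgue"
    by (rule measurable_completion) measurable
  ultimately have "(\<lambda>s. (indicator {0..t} s *\<^sub>R \<kappa> (t - s)) *\<^sub>R (indicator {0..T} s *\<^sub>R g s)) \<in> borel_measurable lebesgue"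
    by (rule borel_measurable_scaleR[rotated])
  moreover have "(\<lambda>s. (indicator {0..t} s *\<^sub>R \<kappa> (t - s)) *\<^sub>R (indicator {0..T} s *\<^sub>R g s))
      = (\<lambda>s. indicator {0..t} s *\<^sub>R \<kappa> (t - s) *\<^sub>R g s)"
    using t by (auto simp: fun_eq_iff split: split_indicator)
  ultimately show ?thesis by simp
qed

text \<open>Passes from Lebesgue integrals over \<open>[0,t]\<close> to convolutions of Borel
  functions on the line. The kernel removes \<open>s >= t\<close>, the support of \<open>g'\<close>
  removes \<open>s < 0\<close>, and \<open>t - s <= T\<close> for the remaining \<open>s\<close>;
  only the null point \<open>s = t\<close> is treated differently.\<close>

lemma set_integral_eq_convolution:
  fixes g g' :: "real \<Rightarrow> 'b::{banach,second_countable_topology}"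
  assumes t: "t \<in> {0..T}" and g: "g \<in> borel_measurable (lebesgue_on {0..T})"
    and [measurable]: "\<kappa> \<in> borel_measurable borel" "g' \<in> borel_measurable borel"
    and eq: "AE s in lborel. s \<in> {0..T} \<longrightarrow> g' s = g s" and z: "\<And>s. s < 0 \<Longrightarrow> g' s = 0"
  shows "(LINT s:{0..t}|lebesgue. \<kappa> (t - s) *\<^sub>R g s) = convolution (truncate T \<kappa>) g' t"
proof -
  have "convolution (truncate T \<kappa>) g' t = (LINT s|lebesgue. truncate T \<kappa> (t - s) *\<^sub>R g' s)"
    unfolding convolution_def by (subst integral_completion) measurable
  also have "\<dots> = (LINT s:{0..t}|lebesgue. \<kappa> (t - s) *\<^sub>R g s)"
    unfolding set_lebesgue_integral_def
  proof (rule integral_cong_AE)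
    show "(\<lambda>s. indicator {0..t} s *\<^sub>R \<kappa> (t - s) *\<^sub>R g s) \<in> borel_measurable lebesgue"
      by (rule borel_measurable_kernel_integrand[OF t g]) measurable
    show "(\<lambda>s. truncate T \<kappa> (t - s) *\<^sub>R g' s) \<in> borel_measurable lebesgue"
      by (rule measurable_completion) measurable
    have "AE s in lborel. truncate T \<kappa> (t - s) *\<^sub>R g' s = indicator {0..t} s *\<^sub>R \<kappa> (t - s) *\<^sub>R g s"
      using eq AE_lborel_singleton[of t]
    proof eventually_elim
      case (elim s)
      then show ?case using t z[of s]
        by (auto simp: truncate_def split: split_indicator)
    qed
    then show "AE s in lebesgue. truncate T \<kappa> (t - s) *\<^sub>R g' s = indicator {0..t} s *\<^sub>R \<kappa> (t - s) *\<^sub>R g s"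
      by (rule AE_completion)
  qed
  finally show ?thesis by simp
qed

lemma AE_lebesgue_on_Icc_iff:
  "(AE x in lebesgue_on {0..T::real}. P x) \<longleftrightarrow> (AE x in lborel. x \<in> {0..T} \<longrightarrow> P x)"
  by (subst AE_restrict_space_iff) (auto simp: AE_completion_iff)

text \<open>Fubini is used on products of \<open>lborel\<close>, so Lebesgue measurable data have to
  be replaced by Borel functions. The replacement is made coordinate by coordinate, hence the
  finite-dimensional value type.\<close>

lemma borel_version:
  fixes f :: "real \<Rightarrow> 'b::euclidean_space"
  assumes f: "f \<in> borel_measurable (lebesgue_on {0..T})"
  obtains f' where "f' \<in> borel_measurable borel" "AE s in lborel. s \<in> {0..T} \<longrightarrow> f' s = f s"
    "\<And>s. s \<notin> {0..T} \<Longrightarrow> f' s = 0"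
proof -
  have m: "(\<lambda>s. indicator {0..T} s *\<^sub>R f s) \<in> borel_measurable lebesgue"
    using f by (subst (asm) borel_measurable_restrict_space_iff) auto
  have "\<exists>h. h \<in> borel_measurable lborel \<and> (AE s in lborel. (indicator {0..T} s *\<^sub>R f s) \<bullet> b = h s)" for b
  proof -
    have "(\<lambda>s. (indicator {0..T} s *\<^sub>R f s) \<bullet> b) \<in> borel_measurable lebesgue"
      using m by (intro borel_measurable_inner) auto
    then show ?thesis using completion_ex_borel_measurable_real by blast
  qed
  then obtain h where h: "\<And>b. h b \<in> borel_measurable lborel"
      "\<And>b. AE s in lborel. (indicator {0..T} s *\<^sub>R f s) \<bullet> b = h b s"
    by metis
  define f' where "f' s = indicator {0..T} s *\<^sub>R (\<Sum>b\<in>Basis. h b s *\<^sub>R b)" for s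
  have [measurable]: "h b \<in> borel_measurable borel" for b using h(1) by simp
  have "f' \<in> borel_measurable borel" unfolding f'_def[abs_def] by measurable
  moreover have "AE s in lborel. \<forall>b\<in>Basis. (indicator {0..T} s *\<^sub>R f s) \<bullet> b = h b s"
    using h(2) by (intro AE_finite_allI) auto
  then have "AE s in lborel. s \<in> {0..T} \<longrightarrow> f' s = f s"
  proof eventually_elim
    case (elim s)
    show ?case
    proof
      assume "s \<in> {0..T}"
      then have "f' s = (\<Sum>b\<in>Basis. (f s \<bullet> b) *\<^sub>R b)"
        using elim by (simp add: f'_def)
      then show "f' s = f s" by (simp add: euclidean_representation)
    qed
  qed
  ultimately show thesis by (rule that) (simp add: f'_def)
qed

lemma integrable_lebesgue_on_iff:
  fixes f f' :: "real \<Rightarrow> 'b::{banach,second_countable_topology}"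
  assumes f: "f \<in> borel_measurable (lebesgue_on {0..T})" and [measurable]: "f' \<in> borel_measurable borel"
    and ae: "AE s in lborel. s \<in> {0..T} \<longrightarrow> f' s = f s" and z: "\<And>s. s \<notin> {0..T} \<Longrightarrow> f' s = 0"
  shows "integrable (lebesgue_on {0..T}) f \<longleftrightarrow> integrable lborel f'"
    and "integral\<^sup>L (lebesgue_on {0..T}) f = integral\<^sup>L lborel f'"
proof -
  have m: "(\<lambda>s. indicator {0..T} s *\<^sub>R f s) \<in> borel_measurable lebesgue"
    using f by (subst (asm) borel_measurable_restrict_space_iff) auto
  have "AE s in lborel. indicator {0..T} s *\<^sub>R f s = f' s"
    using ae by eventually_elim (use z in \<open>auto split: split_indicator\<close>)
  then have ae': "AE s in lebesgue. indicator {0..T} s *\<^sub>R f s = f' s"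
    by (rule AE_completion)
  have m': "f' \<in> borel_measurable lebesgue" by (rule measurable_completion) measurable
  have "integrable (lebesgue_on {0..T}) f \<longleftrightarrow> integrable lebesgue (\<lambda>s. indicator {0..T} s *\<^sub>R f s)"
    by (rule integrable_restrict_space) simp
  also have "\<dots> \<longleftrightarrow> integrable lebesgue f'"
    by (rule integrable_cong_AE[OF m m' ae'])
  also have "\<dots> \<longleftrightarrow> integrable lborel f'" by (rule integrable_completion) measurable
  finally show "integrable (lebesgue_on {0..T}) f \<longleftrightarrow> integrable lborel f'" .
  have "integral\<^sup>L (lebesgue_on {0..T}) f = (LINT s|lebesgue. indicator {0..T} s *\<^sub>R f s)"
    by (rule integral_restrict_space) simp
  also have "\<dots> = integral\<^sup>L lebesgue f'"
    by (rule integral_cong_AE[OF m m' ae'])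
  also have "\<dots> = integral\<^sup>L lborel f'" by (rule integral_completion) measurable
  finally show "integral\<^sup>L (lebesgue_on {0..T}) f = integral\<^sup>L lborel f'" .
qed

text \<open>Reconciles the solution formula, where \<open>f\<close> carries the argument
  \<open>t - s\<close>, with the convolution form, where the kernel does. An affine substitution
  also preserves non-integrability, so no regularity is asked of \<open>F\<close>.\<close>

lemma set_integral_reflect:
  fixes F :: "real \<Rightarrow> 'b::euclidean_space"
  shows "(LINT s:{0..t}|lebesgue. h s *\<^sub>R F (t - s)) = (LINT s:{0..t}|lebesgue. h (t - s) *\<^sub>R F s)"
proof -
  have "(LINT s:{0..t}|lebesgue. h s *\<^sub>R F (t - s))
     = (LINT s|lebesgue. indicator {0..t} (t - s) *\<^sub>R h (t - s) *\<^sub>R F s)"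
    using lebesgue_integral_real_affine[of "- 1" "\<lambda>s. indicator {0..t} s *\<^sub>R h s *\<^sub>R F (t - s)" t]
    by (simp add: set_lebesgue_integral_def)
  also have "\<dots> = (LINT s:{0..t}|lebesgue. h (t - s) *\<^sub>R F s)"
    unfolding set_lebesgue_integral_def
    by (intro Bochner_Integration.integral_cong) (auto split: split_indicator)
  finally show ?thesis .
qed

lemma integrable_truncate_powr:
  assumes a: "0 < a"
  shows "integrable lborel (truncate T (\<lambda>s. c * s powr (a - 1)))"
proof (cases "0 < T")
  case True
  show ?thesis
  proof (rule Bochner_Integration.integrable_bound)
    show "integrable lborel (\<lambda>s. c * (indicator {0<..<T + 1} s * s powr (a - 1)))"
      using has_bochner_integral_powr_Ioo[OF a, of "T + 1"] True
      by (intro integrable_mult_right) (auto simp: has_bochner_integral_iff)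
    show "truncate T (\<lambda>s. c * s powr (a - 1)) \<in> borel_measurable lborel"
      by measurable
  qed (auto simp: truncate_def abs_mult split: split_indicator)
next
  case False
  then have "truncate T (\<lambda>s. c * s powr (a - 1)) = (\<lambda>s. 0)"
    by (auto simp: truncate_def fun_eq_iff)
  then show ?thesis by simp
qed

section \<open>The resolvent and its kernel identities\<close>

locale fractional_relaxation =
  fixes \<alpha> k T :: real
  assumes \<alpha>: "0 < \<alpha>" "\<alpha> < 1" and k: "0 \<le> k" and T: "0 < T"
begin

definition resolvent :: "real \<Rightarrow> real"
  where "resolvent s = s powr (\<alpha> - 1) * mittag_leffler \<alpha> \<alpha> (- k * s powr \<alpha>)"

text \<open>Truncating the kernels to \<open>(0,T]\<close> makes them integrable on the whole line, where convolution is
  associative, and does not affect the values on \<open>[0,T]\<close>.\<close>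

abbreviation "rK \<equiv> truncate T resolvent"
abbreviation "aK \<equiv> truncate T (\<lambda>s. 1 / Gamma (1 - \<alpha>) * s powr (1 - \<alpha> - 1))"
abbreviation "oK \<equiv> truncate T (\<lambda>s. 1)"

lemma resolvent_bounds: "0 \<le> resolvent s" "resolvent s \<le> 1 / Gamma \<alpha> * s powr (\<alpha> - 1)"
proof -
  have "0 \<le> k * s powr \<alpha>" using k by simp
  from mittag_leffler_pos[OF \<alpha> this] mittag_leffler_diag_le[OF \<alpha> this]
  show "0 \<le> resolvent s" "resolvent s \<le> 1 / Gamma \<alpha> * s powr (\<alpha> - 1)"
    using mult_left_mono[of _ "1 / Gamma \<alpha>" "s powr (\<alpha> - 1)"] by (auto simp: resolvent_def)
qed

lemma borel_measurable_resolvent [measurable]: "resolvent \<in> borel_measurable borel"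
proof -
  have "mittag_leffler \<alpha> \<alpha> \<in> borel_measurable borel"
    using \<alpha> by (intro borel_measurable_mittag_leffler) auto
  then have [measurable]: "(\<lambda>s. mittag_leffler \<alpha> \<alpha> (- k * s powr \<alpha>)) \<in> borel_measurable borel"
    by (rule measurable_compose[rotated]) measurable
  show ?thesis unfolding resolvent_def[abs_def] by measurable
qed

lemma integrable_kernels: "integrable lborel rK" "integrable lborel aK" "integrable lborel oK"
proof -
  show "integrable lborel rK"
  proof (rule Bochner_Integration.integrable_bound)
    show "integrable lborel (truncate T (\<lambda>s. 1 / Gamma \<alpha> * s powr (\<alpha> - 1)))"
      using \<alpha> by (intro integrable_truncate_powr)
    show "rK \<in> borel_measurable lborel" by measurable
    have "\<bar>resolvent s\<bar> \<le> \<bar>1 / Gamma \<alpha> * s powr (\<alpha> - 1)\<bar>" for s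
      using resolvent_bounds[of s] by linarith
    then show "AE s in lborel. norm (rK s) \<le> norm (truncate T (\<lambda>s. 1 / Gamma \<alpha> * s powr (\<alpha> - 1)) s)"
      by (intro AE_I2) (auto simp: truncate_def split: split_indicator)
  qed
  show "integrable lborel aK"
    using \<alpha> by (intro integrable_truncate_powr) simp
  have "oK = truncate T (\<lambda>s. 1 * s powr (1 - 1))"
    by (auto simp: truncate_def fun_eq_iff)
  then show "integrable lborel oK"
    using integrable_truncate_powr[of 1 T 1] by simp
qed

text \<open>The order \<open>1 - \<alpha>\<close> of the fractional integral and the parameter
  \<alpha> of the resolvent add up to \<open>1\<close>, so the power of \<open>r\<close> in front
  disappears.\<close>

lemma convolution_aK_rK:
  "convolution aK rK r = mittag_leffler \<alpha> 1 (- k * r powr \<alpha>)" if "0 < r" "r \<le> T"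
proof -
  have "(\<lambda>s. aK (r - s) *\<^sub>R rK s) = (\<lambda>s. indicator {0<..<r} s * ((r - s) powr (1 - \<alpha> - 1) / Gamma (1 - \<alpha>) *
            (s powr (\<alpha> - 1) * mittag_leffler \<alpha> \<alpha> (- k * s powr \<alpha>))))"
    using that by (auto simp: fun_eq_iff truncate_def resolvent_def split: split_indicator)
  moreover have "has_bochner_integral lborel (\<lambda>s. indicator {0<..<r} s * ((r - s) powr (1 - \<alpha> - 1) / Gamma (1 - \<alpha>) *
            (s powr (\<alpha> - 1) * mittag_leffler \<alpha> \<alpha> (- k * s powr \<alpha>))))
      (r powr (1 - \<alpha> + \<alpha> - 1) * mittag_leffler \<alpha> (1 - \<alpha> + \<alpha>) (- k * r powr \<alpha>))"
    using \<alpha> that by (intro has_bochner_integral_mittag_leffler) auto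
  ultimately show ?thesis
    using that by (simp add: convolution_def has_bochner_integral_iff)
qed

lemma convolution_oK_rK:
  "convolution oK rK r = r powr \<alpha> * mittag_leffler \<alpha> (1 + \<alpha>) (- k * r powr \<alpha>)" if "0 < r" "r \<le> T"
proof -
  have "(\<lambda>s. oK (r - s) *\<^sub>R rK s) = (\<lambda>s. indicator {0<..<r} s * ((r - s) powr (1 - 1) / Gamma 1 *
            (s powr (\<alpha> - 1) * mittag_leffler \<alpha> \<alpha> (- k * s powr \<alpha>))))"
    using that by (auto simp: fun_eq_iff truncate_def resolvent_def split: split_indicator)
  moreover have "has_bochner_integral lborel (\<lambda>s. indicator {0<..<r} s * ((r - s) powr (1 - 1) / Gamma 1 *
            (s powr (\<alpha> - 1) * mittag_leffler \<alpha> \<alpha> (- k * s powr \<alpha>))))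
      (r powr (1 + \<alpha> - 1) * mittag_leffler \<alpha> (1 + \<alpha>) (- k * r powr \<alpha>))"
    using \<alpha> that by (intro has_bochner_integral_mittag_leffler) auto
  ultimately show ?thesis
    using that by (simp add: convolution_def has_bochner_integral_iff)
qed

text \<open>This is \<open>mittag_leffler_rec\<close> at \<open>\<beta> = 1\<close>, with the
  remainder recognised as the primitive of the resolvent. It later converts the initial value into a
  source term.\<close>

lemma set_integral_resolvent:
  assumes t: "t \<in> {0..T}"
  shows "mittag_leffler \<alpha> 1 (- k * t powr \<alpha>) = 1 - k * (LINT s:{0..t}|lebesgue. resolvent (t - s))"
proof (cases "t = 0")
  case True
  have "(\<lambda>s. indicator {0..0} s *\<^sub>R resolvent (0 - s)) = (\<lambda>s. 0)"
    by (auto simp: fun_eq_iff resolvent_def split: split_indicator)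
  then show ?thesis
    unfolding set_lebesgue_integral_def True by (simp add: mittag_leffler_0)
next
  case False
  have "(LINT s:{0..t}|lebesgue. resolvent (t - s) *\<^sub>R 1) = convolution rK (indicator {0..T}) t"
    by (rule set_integral_eq_convolution[OF t]) auto
  also have "\<dots> = convolution rK oK t"
    unfolding convolution_def
    by (intro integral_cong_AE, measurable, use AE_lborel_singleton[of 0] in eventually_elim)
       (auto simp: truncate_def split: split_indicator)
  also have "\<dots> = t powr \<alpha> * mittag_leffler \<alpha> (1 + \<alpha>) (- k * t powr \<alpha>)"
    using t False by (subst convolution_commute, subst convolution_oK_rK) auto
  finally show ?thesis
    using mittag_leffler_rec[of \<alpha> 1 "- k * t powr \<alpha>"] \<alpha> by (simp add: add.commute)
qed

text \<open>On \<open>r <= T\<close> the kernels satisfy \<open>aK * rK + k (oK * rK) = oK\<close>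
  pointwise; beyond \<open>T\<close> truncation destroys this. For \<open>t <= T\<close> an argument
  \<open>t - s > T\<close> requires \<open>s < 0\<close>, where \<open>g\<close> vanishes.\<close>

lemma convolution_aK_oK:
  fixes g :: "real \<Rightarrow> 'b::{banach,second_countable_topology}"
  assumes g: "integrable lborel g" and z: "\<And>s. s < 0 \<Longrightarrow> g s = 0"
  shows "AE t in lborel. t \<in> {0..T} \<longrightarrow>
    convolution (convolution aK rK) g t + k *\<^sub>R convolution (convolution oK rK) g t = convolution oK g t"
proof -
  have K: "convolution aK rK r + k * convolution oK rK r = oK r" if "r \<le> T" for r
  proof (cases "0 < r")
    case True
    then show ?thesis
      using that \<alpha> mittag_leffler_rec[of \<alpha> 1 "- k * r powr \<alpha>"]
      unfolding convolution_aK_rK[OF True that] convolution_oK_rK[OF True that]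
      by (simp add: truncate_def add.commute)
  next
    case False
    then have "(\<lambda>s. aK (r - s) *\<^sub>R rK s) = (\<lambda>s. 0)" "(\<lambda>s. oK (r - s) *\<^sub>R rK s) = (\<lambda>s. 0)"
      by (auto simp: fun_eq_iff truncate_def split: split_indicator)
    then show ?thesis using False by (simp add: convolution_def truncate_def)
  qed
  have "AE t in lborel. convolution (\<lambda>r. convolution aK rK r + k * convolution oK rK r) g t
      = convolution (convolution aK rK) g t + convolution (\<lambda>r. k * convolution oK rK r) g t"
    by (intro AE_convolution_add_left integrable_convolution integrable_mult_right integrable_kernels g)
  then show ?thesis
  proof eventually_elim
    case (elim t)
    have "convolution (\<lambda>r. convolution aK rK r + k * convolution oK rK r) g t = convolution oK g t" if "t \<in> {0..T}"
      unfolding convolution_def[of _ g]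
    proof (intro Bochner_Integration.integral_cong refl)
      fix s
      show "(convolution aK rK (t - s) + k * convolution oK rK (t - s)) *\<^sub>R g s = oK (t - s) *\<^sub>R g s"
        using that K[of "t - s"] z[of s] by (cases "s < 0") auto
    qed
    then show ?case using elim by (simp add: convolution_scale_left)
  qed
qed


lemma convolution_cong_Icc:
  fixes g h :: "real \<Rightarrow> 'b::{banach,second_countable_topology}"
  assumes t: "t \<in> {0..T}"
    and [measurable]: "\<kappa> \<in> borel_measurable borel" "g \<in> borel_measurable borel" "h \<in> borel_measurable borel"
    and eq: "AE s in lborel. s \<in> {0..T} \<longrightarrow> g s = h s"
    and z: "\<And>s. s < 0 \<Longrightarrow> g s = 0" "\<And>s. s < 0 \<Longrightarrow> h s = 0"
  shows "convolution (truncate T \<kappa>) g t = convolution (truncate T \<kappa>) h t"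
  unfolding convolution_def
proof (rule integral_cong_AE)
  show "AE s in lborel. truncate T \<kappa> (t - s) *\<^sub>R g s = truncate T \<kappa> (t - s) *\<^sub>R h s"
    using eq
  proof eventually_elim
    case (elim s)
    then show ?case using t z[of s]
      by (cases "s < 0") (auto simp: truncate_def split: split_indicator)
  qed
qed measurable

lemma rl_integral_eq_convolution:
  fixes g g' :: "real \<Rightarrow> 'b::{banach,second_countable_topology}"
  assumes t: "t \<in> {0..T}" and g: "g \<in> borel_measurable (lebesgue_on {0..T})"
    and g': "g' \<in> borel_measurable borel"
    and eq: "AE s in lborel. s \<in> {0..T} \<longrightarrow> g' s = g s" and z: "\<And>s. s < 0 \<Longrightarrow> g' s = 0"
  shows "rl_integral (1 - \<alpha>) g t = convolution aK g' t"
proof -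
  have "rl_integral (1 - \<alpha>) g t
      = (1 / Gamma (1 - \<alpha>)) *\<^sub>R convolution (truncate T (\<lambda>s. s powr (1 - \<alpha> - 1))) g' t"
    unfolding rl_integral_def
    by (subst set_integral_eq_convolution[OF t g _ g' eq z, of "\<lambda>s. s powr (1 - \<alpha> - 1)"]) auto
  also have "\<dots> = convolution (\<lambda>s. 1 / Gamma (1 - \<alpha>) * truncate T (\<lambda>s. s powr (1 - \<alpha> - 1)) s) g' t"
    by (rule convolution_scale_left[symmetric])
  also have "(\<lambda>s. 1 / Gamma (1 - \<alpha>) * truncate T (\<lambda>s. s powr (1 - \<alpha> - 1)) s) = aK"
    by (auto simp: truncate_def fun_eq_iff)
  finally show ?thesis .
qed

lemma set_integral_eq_convolution_oK:
  fixes g g' :: "real \<Rightarrow> 'b::{banach,second_countable_topology}"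
  assumes t: "t \<in> {0..T}" and g: "g \<in> borel_measurable (lebesgue_on {0..T})"
    and g': "g' \<in> borel_measurable borel"
    and eq: "AE s in lborel. s \<in> {0..T} \<longrightarrow> g' s = g s" and z: "\<And>s. s < 0 \<Longrightarrow> g' s = 0"
  shows "(LINT s:{0..t}|lebesgue. g s) = convolution oK g' t"
  using set_integral_eq_convolution[OF t g _ g' eq z, of "\<lambda>_. 1"] by simp

lemma convolution_rK_neg:
  assumes "\<And>s. s < 0 \<Longrightarrow> F s = 0" "t < 0"
  shows "convolution rK F t = 0"
proof -
  have "rK (t - s) *\<^sub>R F s = 0" for s
    using assms by (cases "s < 0") (auto simp: truncate_def)
  then show ?thesis by (simp add: convolution_def del: scaleR_eq_0_iff)
qed

section \<open>Existence and uniqueness for the scalar equation\<close>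

lemma borel_measurable_lebesgue_onI:
  "g \<in> borel_measurable borel \<Longrightarrow> g \<in> borel_measurable (lebesgue_on S)"
  by (intro measurable_restrict_space1 measurable_completion) simp

text \<open>With \<open>w = rK * F\<close>, associativity and the kernel identity give \<open>aK * w
  = (aK * rK) * F = oK * F - k (oK * rK) * F = oK * (F - k w)\<close>.\<close>

lemma resolvent_solves:
  fixes F w :: "real \<Rightarrow> 'b::euclidean_space"
  assumes F: "integrable (lebesgue_on {0..T}) F"
    and w: "\<And>t. t \<in> {0..T} \<Longrightarrow> w t = (LINT s:{0..t}|lebesgue. resolvent (t - s) *\<^sub>R F s)"
  shows "w \<in> borel_measurable (lebesgue_on {0..T})"
    and "AE t in lebesgue_on {0..T}. rl_integral (1 - \<alpha>) w t = (LINT s:{0..t}|lebesgue. F s - k *\<^sub>R w s)"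
proof -
  have Fm: "F \<in> borel_measurable (lebesgue_on {0..T})" using F by (rule borel_measurable_integrable)
  obtain F' where F': "F' \<in> borel_measurable borel" "AE s in lborel. s \<in> {0..T} \<longrightarrow> F' s = F s"
      "\<And>s. s \<notin> {0..T} \<Longrightarrow> F' s = 0"
    by (rule borel_version[OF Fm]) blast
  have iF': "integrable lborel F'" using F integrable_lebesgue_on_iff(1)[OF Fm F'] by simp
  have z: "F' s = 0" if "s < 0" for s using F'(3) that by simp
  define w' where "w' = convolution rK F'"
  have iw': "integrable lborel w'" unfolding w'_def by (intro integrable_convolution integrable_kernels iF')
  then have bw': "w' \<in> borel_measurable borel" by (auto dest: borel_measurable_integrable)
  have ww': "w t = w' t" if "t \<in> {0..T}" for t
    unfolding w[OF that] w'_def by (rule set_integral_eq_convolution[OF that Fm _ F'(1,2) z]) auto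
  have zw': "w' s = 0" if "s < 0" for s unfolding w'_def using z that by (rule convolution_rK_neg)
  show wm: "w \<in> borel_measurable (lebesgue_on {0..T})"
    using borel_measurable_lebesgue_onI[OF bw'] by (rule measurable_cong[THEN iffD1, rotated]) (simp add: ww')
  have kernel_eq: "AE t in lborel. t \<in> {0..T} \<longrightarrow> convolution (convolution aK rK) F' t
      + k *\<^sub>R convolution (convolution oK rK) F' t = convolution oK F' t"
    by (rule convolution_aK_oK) (use iF' z in auto)
  have "AE t in lborel. t \<in> {0..T} \<longrightarrow> convolution aK w' t = convolution oK (\<lambda>s. F' s - k *\<^sub>R w' s) t"
    using convolution_assoc[OF integrable_kernels(2,1) iF'] convolution_assoc[OF integrable_kernels(3,1) iF']
      AE_convolution_diff[OF integrable_kernels(3) iF' integrable_scaleR_right[OF iw', of k]]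
      kernel_eq
  proof eventually_elim
    case (elim t)
    show ?case
    proof
      assume t: "t \<in> {0..T}"
      have "convolution oK (\<lambda>s. F' s - k *\<^sub>R w' s) t = convolution oK F' t - k *\<^sub>R convolution (convolution oK rK) F' t"
        using elim(2,3) by (simp add: convolution_scaleR_right w'_def)
      also have "\<dots> = convolution (convolution aK rK) F' t"
        using elim(4)[rule_format, OF t] by (metis add_diff_cancel_right')
      finally show "convolution aK w' t = convolution oK (\<lambda>s. F' s - k *\<^sub>R w' s) t"
        using elim(1) by (simp add: w'_def)
    qed
  qed
  then have "AE t in lborel. t \<in> {0..T} \<longrightarrow> rl_integral (1 - \<alpha>) w t = (LINT s:{0..t}|lebesgue. F s - k *\<^sub>R w s)"
  proof eventually_elim
    case (elim t)
    show ?case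
    proof
      assume t: "t \<in> {0..T}"
      have "rl_integral (1 - \<alpha>) w t = convolution aK w' t"
        using ww' zw' by (intro rl_integral_eq_convolution[OF t wm bw']) auto
      moreover have "(LINT s:{0..t}|lebesgue. F s - k *\<^sub>R w s) = convolution oK (\<lambda>s. F' s - k *\<^sub>R w' s) t"
      proof (rule set_integral_eq_convolution_oK[OF t])
        show "(\<lambda>s. F s - k *\<^sub>R w s) \<in> borel_measurable (lebesgue_on {0..T})"
          using Fm wm by measurable
        show "(\<lambda>s. F' s - k *\<^sub>R w' s) \<in> borel_measurable borel" using F'(1) bw' by measurable
        show "AE s in lborel. s \<in> {0..T} \<longrightarrow> F' s - k *\<^sub>R w' s = F s - k *\<^sub>R w s"
          using F'(2) by eventually_elim (simp add: ww')
      qed (simp add: z zw')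
      ultimately show "rl_integral (1 - \<alpha>) w t = (LINT s:{0..t}|lebesgue. F s - k *\<^sub>R w s)"
        using elim t by simp
    qed
  qed
  then show "AE t in lebesgue_on {0..T}. rl_integral (1 - \<alpha>) w t = (LINT s:{0..t}|lebesgue. F s - k *\<^sub>R w s)"
    by (simp add: AE_lebesgue_on_Icc_iff)
qed

text \<open>On \<open>[0,T]\<close> the convolution is the primitive of \<open>d\<close>, which is
  continuous; vanishing almost everywhere it vanishes everywhere, and then so do all tail integrals
  of \<open>d\<close>.\<close>

lemma AE_zero_of_convolution_oK:
  fixes d :: "real \<Rightarrow> 'b::euclidean_space"
  assumes d: "integrable lborel d" and z: "\<And>s. s \<notin> {0..T} \<Longrightarrow> d s = 0"
    and conv: "AE t in lborel. t \<in> {0..T} \<longrightarrow> convolution oK d t = 0"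
  shows "AE s in lborel. d s = 0"
proof -
  have bd[measurable]: "d \<in> borel_measurable borel" using d by (auto dest: borel_measurable_integrable)
  define \<Phi> where "\<Phi> t = (LINT s|lborel. indicator {0..t} s *\<^sub>R d s)" for t
  have conv_eq: "convolution oK d t = \<Phi> t" if t: "t \<in> {0..T}" for t
    unfolding convolution_def \<Phi>_def
  proof (rule integral_cong_AE)
    show "AE s in lborel. oK (t - s) *\<^sub>R d s = indicator {0..t} s *\<^sub>R d s"
      using AE_lborel_singleton[of t]
      by eventually_elim (use t z in \<open>auto simp: truncate_def split: split_indicator\<close>)
  qed measurable
  have "integrable (lebesgue_on {0..T}) d"
    using d z by (subst integrable_lebesgue_on_iff(1)[of d T d]) (auto intro: borel_measurable_lebesgue_onI)
  then have "continuous_on {0..T} (\<lambda>x. integral\<^sup>L (lebesgue_on {0..x}) d)"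
    by (rule indefinite_integral_continuous_real)
  moreover have "integral\<^sup>L (lebesgue_on {0..x}) d = \<Phi> x" for x
    unfolding \<Phi>_def by (subst integral_restrict_space, simp, rule integral_completion) measurable
  ultimately have cont: "continuous_on {0..T} \<Phi>" by simp
  \<comment> \<open>The set where the continuous primitive is nonzero is open and null, hence
    empty.\<close>
  define U where "U = {0<..<T} \<inter> \<Phi> -` (- {0})"
  have "continuous_on {0<..<T} \<Phi>" by (rule continuous_on_subset[OF cont]) auto
  then have "open U" unfolding U_def by (intro continuous_open_preimage) auto
  moreover have "AE t in lborel. t \<notin> U"
    using conv by eventually_elim (auto simp: U_def conv_eq)
  then have "U \<in> null_sets lborel"
    using \<open>open U\<close> by (subst (asm) AE_iff_null_sets[symmetric]) auto
  then have "negligible U" by (simp add: negligible_iff_null_sets null_sets_completionI)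
  ultimately have "U = {}" using open_not_negligible by blast
  then have "\<Phi> t = 0" if "t \<in> {0<..<T}" for t using that by (auto simp: U_def)
  then have \<Phi>0: "\<Phi> t = 0" if "t \<in> {0..T}" for t
    using continuous_constant_on_closure[of "{0<..<T}" \<Phi> 0 t] cont T that by simp
  have int: "integrable lborel (\<lambda>s. indicator {0..x} s *\<^sub>R d s)" for x :: real
    by (intro integrable_mult_indicator d) simp
  have "(LINT s|lborel. indicator {x<..} s *\<^sub>R d s) = 0" for x
  proof -
    consider "x < 0" | "x \<in> {0..T}" | "T < x" by force
    then show ?thesis
    proof cases
      case 1
      then have "(\<lambda>s. indicator {x<..} s *\<^sub>R d s) = (\<lambda>s. indicator {0..T} s *\<^sub>R d s)"
        using z by (auto simp: fun_eq_iff split: split_indicator)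
      then show ?thesis using \<Phi>0[of T] T by (simp add: \<Phi>_def)
    next
      case 2
      have "(\<lambda>s. indicator {x<..} s *\<^sub>R d s) = (\<lambda>s. indicator {0..T} s *\<^sub>R d s - indicator {0..x} s *\<^sub>R d s)"
        using z 2 by (force simp: fun_eq_iff split: split_indicator)
      then have "(LINT s|lborel. indicator {x<..} s *\<^sub>R d s) = \<Phi> T - \<Phi> x"
        unfolding \<Phi>_def by (simp add: Bochner_Integration.integral_diff[OF int int])
      then show ?thesis using \<Phi>0 2 T by simp
    next
      case 3
      then have "(\<lambda>s. indicator {x<..} s *\<^sub>R d s) = (\<lambda>s. 0)"
        using z by (auto simp: fun_eq_iff split: split_indicator)
      then show ?thesis by simp
    qed
  qed
  then show ?thesis by (rule AE_indefinite_integral_zero[OF d])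
qed

text \<open>Convolving \<open>aK * w = oK * (F - k w)\<close> with \<open>rK\<close> and using that
  scalar kernels commute gives \<open>(aK * rK) * w + k (oK * rK) * w = oK * (rK * F)\<close>. The
  kernel identity reduces the left side to \<open>oK * w\<close>, so the difference of
  \<open>w\<close> and \<open>rK * F\<close> has zero primitive.\<close>

lemma resolvent_unique:
  fixes F w :: "real \<Rightarrow> 'b::euclidean_space"
  assumes F: "integrable (lebesgue_on {0..T}) F" and w: "integrable (lebesgue_on {0..T}) w"
    and eq: "AE t in lebesgue_on {0..T}. rl_integral (1 - \<alpha>) w t = (LINT s:{0..t}|lebesgue. F s - k *\<^sub>R w s)"
  shows "AE t in lebesgue_on {0..T}. w t = (LINT s:{0..t}|lebesgue. resolvent (t - s) *\<^sub>R F s)"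
proof -
  have Fm: "F \<in> borel_measurable (lebesgue_on {0..T})" using F by (rule borel_measurable_integrable)
  obtain F' where F': "F' \<in> borel_measurable borel" "AE s in lborel. s \<in> {0..T} \<longrightarrow> F' s = F s"
      "\<And>s. s \<notin> {0..T} \<Longrightarrow> F' s = 0"
    by (rule borel_version[OF Fm]) blast
  have iF': "integrable lborel F'" using F integrable_lebesgue_on_iff(1)[OF Fm F'] by simp
  have z: "F' s = 0" if "s < 0" for s using F'(3) that by simp
  have wm: "w \<in> borel_measurable (lebesgue_on {0..T})" using w by (rule borel_measurable_integrable)
  obtain w' where w': "w' \<in> borel_measurable borel" "AE s in lborel. s \<in> {0..T} \<longrightarrow> w' s = w s"
      "\<And>s. s \<notin> {0..T} \<Longrightarrow> w' s = 0"
    by (rule borel_version[OF wm]) blast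
  have iw': "integrable lborel w'" using w integrable_lebesgue_on_iff(1)[OF wm w'] by simp
  have zw: "w' s = 0" if "s < 0" for s using w'(3) that by simp
  define G where "G s = F' s - k *\<^sub>R w' s" for s
  have iG: "integrable lborel G" unfolding G_def[abs_def] using iF' iw' by simp
  have zG: "G s = 0" if "s < 0" for s using z zw that by (simp add: G_def)
  have [measurable]: "F' \<in> borel_measurable borel" "w' \<in> borel_measurable borel" "G \<in> borel_measurable borel"
    using iG F'(1) w'(1) by (auto dest: borel_measurable_integrable)
  have "AE t in lborel. t \<in> {0..T} \<longrightarrow> convolution aK w' t = convolution oK G t"
    using eq unfolding AE_lebesgue_on_Icc_iff
  proof eventually_elim
    case (elim t)
    show ?case
    proof
      assume t: "t \<in> {0..T}"
      have "rl_integral (1 - \<alpha>) w t = convolution aK w' t"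
        by (rule rl_integral_eq_convolution[OF t wm w'(1,2) zw])
      moreover have "(LINT s:{0..t}|lebesgue. F s - k *\<^sub>R w s) = convolution oK G t"
      proof (rule set_integral_eq_convolution_oK[OF t])
        show "(\<lambda>s. F s - k *\<^sub>R w s) \<in> borel_measurable (lebesgue_on {0..T})"
          using Fm wm by measurable
        show "AE s in lborel. s \<in> {0..T} \<longrightarrow> G s = F s - k *\<^sub>R w s"
          using F'(2) w'(2) by eventually_elim (simp add: G_def)
      qed (simp_all add: zG)
      ultimately show "convolution aK w' t = convolution oK G t"
        using elim t by simp
    qed
  qed
  moreover have ai: "integrable lborel (convolution aK w')" "integrable lborel (convolution oK G)"
    by (intro integrable_convolution integrable_kernels iw' iG)+
  moreover have "convolution aK w' s = 0" "convolution oK G s = 0" if "s < 0" for s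
  proof -
    have "aK (s - q) *\<^sub>R w' q = 0" "oK (s - q) *\<^sub>R G q = 0" for q
      using that zw[of q] zG[of q] by (cases "q < 0"; auto simp: truncate_def)+
    then show "convolution aK w' s = 0" "convolution oK G s = 0"
      by (simp_all add: convolution_def del: scaleR_eq_0_iff)
  qed
  \<comment> \<open>The equation is known only almost everywhere on \<open>[0,T]\<close> and may
    fail beyond \<open>T\<close>. Causality of \<open>rK\<close> asks for no more, so the convolved
    equation holds at every \<open>t\<close> of \<open>[0,T]\<close>.\<close>
  ultimately have rr: "convolution rK (convolution aK w') t = convolution rK (convolution oK G) t" if "t \<in> {0..T}" for t
    using borel_measurable_integrable[OF ai(1)] borel_measurable_integrable[OF ai(2)] that
    by (intro convolution_cong_Icc) auto
  define v where "v = convolution rK F'"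
  have iv: "integrable lborel v" unfolding v_def by (intro integrable_convolution integrable_kernels iF')
  have comm: "convolution rK aK = convolution aK rK" "convolution rK oK = convolution oK rK"
    by (auto simp: fun_eq_iff convolution_commute[of rK])
  have io: "integrable lborel (convolution oK rK)" by (intro integrable_convolution integrable_kernels)
  have kernel_eq: "AE t in lborel. t \<in> {0..T} \<longrightarrow> convolution (convolution aK rK) w' t
      + k *\<^sub>R convolution (convolution oK rK) w' t = convolution oK w' t"
    by (rule convolution_aK_oK) (use iw' zw in auto)
  have "AE t in lborel. t \<in> {0..T} \<longrightarrow> convolution oK w' t = convolution oK v t"
    using convolution_assoc[OF integrable_kernels(1,2) iw'] convolution_assoc[OF integrable_kernels(1,3) iG]
      convolution_assoc[OF integrable_kernels(3,1) iF']
      AE_convolution_diff[OF io iF' integrable_scaleR_right[OF iw', of k]]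
      kernel_eq
  proof eventually_elim
    case (elim t)
    show ?case
    proof
      assume t: "t \<in> {0..T}"
      have "convolution (convolution aK rK) w' t = convolution (convolution oK rK) G t"
        using elim(1,2) rr[OF t] by (simp only: comm)
      also have "\<dots> = convolution (convolution oK rK) F' t - k *\<^sub>R convolution (convolution oK rK) w' t"
        using elim(4) by (simp add: G_def[abs_def] convolution_scaleR_right)
      finally have "convolution (convolution aK rK) w' t + k *\<^sub>R convolution (convolution oK rK) w' t
          = convolution oK v t"
        using elim(3) by (simp add: v_def)
      then show "convolution oK w' t = convolution oK v t" using elim(5) t by simp
    qed
  qed
  \<comment> \<open>\<open>v\<close> may be nonzero beyond \<open>T\<close>, so the difference is
    cut off; by causality its convolution with \<open>oK\<close> is unchanged on
    \<open>[0,T]\<close>.\<close>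
  moreover define d where "d s = indicator {0..T} s *\<^sub>R (w' s - v s)" for s
  have id: "integrable lborel d"
    unfolding d_def[abs_def] using iw' iv by (intro integrable_mult_indicator) auto
  have [measurable]: "d \<in> borel_measurable borel" "v \<in> borel_measurable borel"
    using id iv by (auto dest: borel_measurable_integrable)
  have zv: "v s = 0" if "s < 0" for s unfolding v_def using z that by (rule convolution_rK_neg)
  have "convolution oK d t = convolution oK (\<lambda>s. w' s - v s) t" if "t \<in> {0..T}" for t
    using zw zv by (intro convolution_cong_Icc[OF that]) (auto simp: d_def)
  moreover note AE_convolution_diff[OF integrable_kernels(3) iw' iv]
  ultimately have "AE t in lborel. t \<in> {0..T} \<longrightarrow> convolution oK d t = 0"
    by (auto elim!: eventually_elim2)
  then have "AE s in lborel. d s = 0"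
    by (intro AE_zero_of_convolution_oK[OF id]) (auto simp: d_def)
  then have "AE t in lborel. t \<in> {0..T} \<longrightarrow> w t = (LINT s:{0..t}|lebesgue. resolvent (t - s) *\<^sub>R F s)"
    using w'(2)
  proof eventually_elim
    case (elim t)
    show ?case
    proof
      assume t: "t \<in> {0..T}"
      have "(LINT s:{0..t}|lebesgue. resolvent (t - s) *\<^sub>R F s) = v t"
        unfolding v_def by (rule set_integral_eq_convolution[OF t Fm _ F'(1,2) z]) auto
      then show "w t = (LINT s:{0..t}|lebesgue. resolvent (t - s) *\<^sub>R F s)"
        using elim t by (simp add: d_def)
    qed
  qed
  then show ?thesis by (simp add: AE_lebesgue_on_Icc_iff)
qed

end

text \<open>The squared \<open>L2\<close> norm on \<open>(0,T]\<close> of the majorant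
  \<open>s powr (\<alpha> - 1) / Gamma \<alpha>\<close>. The exponent has the form
  \<open>a - 1\<close> with \<open>a = 2 * \<alpha> - 1\<close>, which is positive exactly when
  \<open>\<alpha> > 1 / 2\<close>.\<close>

definition kernel_square :: "real \<Rightarrow> real \<Rightarrow> real"
  where "kernel_square \<alpha> T = (LINT s|lborel. truncate T (\<lambda>s. (1 / Gamma \<alpha>)\<^sup>2 * s powr (2 * \<alpha> - 1 - 1)) s)"

lemma kernel_square_nonneg: "0 \<le> kernel_square \<alpha> T"
  unfolding kernel_square_def by (intro integral_nonneg_AE AE_I2) (simp add: truncate_def)

lemma (in fractional_relaxation) resolvent_integral_bound:
  fixes F :: "real \<Rightarrow> 'b::euclidean_space"
  assumes half: "1 / 2 < \<alpha>" and Fm: "F \<in> borel_measurable (lebesgue_on {0..T})"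
    and F2: "integrable (lebesgue_on {0..T}) (\<lambda>s. (norm (F s))\<^sup>2)" and t: "t \<in> {0..T}"
  shows "(norm (LINT s:{0..t}|lebesgue. resolvent (t - s) *\<^sub>R F s))\<^sup>2
    \<le> kernel_square \<alpha> T * (LINT s|lebesgue_on {0..T}. (norm (F s))\<^sup>2)"
proof -
  obtain F' where F'[measurable]: "F' \<in> borel_measurable borel" and F'': "AE s in lborel. s \<in> {0..T} \<longrightarrow> F' s = F s"
      "\<And>s. s \<notin> {0..T} \<Longrightarrow> F' s = 0"
    by (rule borel_version[OF Fm]) blast
  define N where "N = (LINT s|lborel. (norm (F' s))\<^sup>2)"
  have iN: "integrable lborel (\<lambda>s. (norm (F' s))\<^sup>2)"
      and N: "(LINT s|lebesgue_on {0..T}. (norm (F s))\<^sup>2) = N"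
  proof -
    have *: "(\<lambda>s. (norm (F s))\<^sup>2) \<in> borel_measurable (lebesgue_on {0..T})"
      "(\<lambda>s. (norm (F' s))\<^sup>2) \<in> borel_measurable borel"
      "AE s in lborel. s \<in> {0..T} \<longrightarrow> (norm (F' s))\<^sup>2 = (norm (F s))\<^sup>2"
      "\<And>s. s \<notin> {0..T} \<Longrightarrow> (norm (F' s))\<^sup>2 = 0"
      using F'' Fm by (auto elim!: eventually_mono)
    show "integrable lborel (\<lambda>s. (norm (F' s))\<^sup>2)" using F2 integrable_lebesgue_on_iff(1)[OF *] by simp
    show "(LINT s|lebesgue_on {0..T}. (norm (F s))\<^sup>2) = N"
      unfolding N_def by (rule integrable_lebesgue_on_iff(2)[OF *])
  qed
  define A where "A s = truncate T (\<lambda>s. 1 / Gamma \<alpha> * s powr (\<alpha> - 1)) (t - s)" for s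
  have [measurable]: "A \<in> borel_measurable borel" unfolding A_def[abs_def] by measurable
  have A2: "(A s)\<^sup>2 = truncate T (\<lambda>s. (1 / Gamma \<alpha>)\<^sup>2 * s powr (2 * \<alpha> - 1 - 1)) (t - s)" for s
    by (auto simp: A_def truncate_def power_mult_distrib power2_eq_square powr_add[symmetric] algebra_simps split: split_indicator)
  have A0: "0 \<le> A s" for s
    using \<alpha> by (auto simp: A_def truncate_def intro!: divide_nonneg_nonneg less_imp_le[OF Gamma_real_pos] split: split_indicator)
  have rA: "\<bar>rK (t - s)\<bar> \<le> A s" for s
    using resolvent_bounds[of "t - s"] by (auto simp: A_def truncate_def split: split_indicator)
  have iA: "integrable lborel (truncate T (\<lambda>s. (1 / Gamma \<alpha>)\<^sup>2 * s powr (2 * \<alpha> - 1 - 1)))"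
    using half by (intro integrable_truncate_powr) simp
  have iA2: "integrable lborel (\<lambda>s. (A s)\<^sup>2)"
    using lborel_integrable_real_affine[OF iA, of "- 1" t] by (simp add: A2)
  have IA2: "(LINT s|lborel. (A s)\<^sup>2) = kernel_square \<alpha> T"
    unfolding A2 kernel_square_def
    using lborel_integral_real_affine[of "- 1" "truncate T (\<lambda>s. (1 / Gamma \<alpha>)\<^sup>2 * s powr (2 * \<alpha> - 1 - 1))" t] by simp
  have w: "(LINT s:{0..t}|lebesgue. resolvent (t - s) *\<^sub>R F s) = convolution rK F' t"
    using F'' by (intro set_integral_eq_convolution[OF t Fm _ F']) auto
  \<comment> \<open>Working with nonnegative extended integrals avoids having to know convergence
    first: a nonintegrable integrand has integral \<open>0\<close>, and the bound is then
    trivial.\<close>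
  have le: "ennreal (norm (convolution rK F' t)) \<le> (\<integral>\<^sup>+s. ennreal (A s) * ennreal (norm (F' s)) \<partial>lborel)"
  proof (cases "integrable lborel (\<lambda>s. rK (t - s) *\<^sub>R F' s)")
    case True
    then have "ennreal (norm (convolution rK F' t)) \<le> (\<integral>\<^sup>+s. norm (rK (t - s) *\<^sub>R F' s) \<partial>lborel)"
      unfolding convolution_def by (rule integral_norm_bound_ennreal)
    also have "\<dots> \<le> (\<integral>\<^sup>+s. ennreal (A s) * ennreal (norm (F' s)) \<partial>lborel)"
      using rA A0 by (intro nn_integral_mono) (simp add: ennreal_mult[symmetric] mult_right_mono)
    finally show ?thesis .
  qed (simp add: convolution_def not_integrable_integral_eq)
  have "ennreal ((norm (convolution rK F' t))\<^sup>2) = (ennreal (norm (convolution rK F' t)))\<^sup>2"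
    by (simp add: ennreal_power)
  also have "\<dots> \<le> (\<integral>\<^sup>+s. ennreal (A s) * ennreal (norm (F' s)) \<partial>lborel)\<^sup>2"
    using le by (rule power_mono) simp
  also have "\<dots> \<le> (\<integral>\<^sup>+s. (ennreal (A s))\<^sup>2 \<partial>lborel) * (\<integral>\<^sup>+s. (ennreal (norm (F' s)))\<^sup>2 \<partial>lborel)"
    by (rule Cauchy_Schwarz_nn_integral) measurable
  also have "(\<integral>\<^sup>+s. (ennreal (A s))\<^sup>2 \<partial>lborel) = ennreal (kernel_square \<alpha> T)"
    using nn_integral_eq_integral[OF iA2] IA2 A0 by (simp add: ennreal_power)
  also have "(\<integral>\<^sup>+s. (ennreal (norm (F' s)))\<^sup>2 \<partial>lborel) = ennreal N"
    using nn_integral_eq_integral[OF iN] by (simp add: ennreal_power N_def)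
  also have "ennreal (kernel_square \<alpha> T) * ennreal N = ennreal (kernel_square \<alpha> T * N)"
    by (simp add: ennreal_mult N_def kernel_square_nonneg)
  finally show ?thesis
    unfolding w N by (subst (asm) ennreal_le_iff) (simp_all add: N_def kernel_square_nonneg)
qed

text \<open>With \<open>B\<close> the majorant of the resolvent at \<open>t - s\<close>, the
  integrand is at most \<open>B^2 + (norm (F s))^2\<close>, and \<open>B^2\<close> is integrable
  because \<open>\<alpha> > 1 / 2\<close>.\<close>

lemma (in fractional_relaxation) integrable_resolvent_integrand:
  fixes F :: "real \<Rightarrow> 'b::{banach,second_countable_topology}"
  assumes half: "1 / 2 < \<alpha>" and Fm: "F \<in> borel_measurable (lebesgue_on {0..T})"
    and F2: "integrable (lebesgue_on {0..T}) (\<lambda>s. (norm (F s))\<^sup>2)" and t: "t \<in> {0..T}"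
  shows "integrable lebesgue (\<lambda>s. indicator {0..t} s *\<^sub>R resolvent (t - s) *\<^sub>R F s)"
proof (rule Bochner_Integration.integrable_bound)
  define A where "A = truncate T (\<lambda>s. (1 / Gamma \<alpha>)\<^sup>2 * s powr (2 * \<alpha> - 1 - 1))"
  have [measurable]: "A \<in> borel_measurable borel" by (simp add: A_def)
  have "integrable lborel A" unfolding A_def using half by (intro integrable_truncate_powr) simp
  then have "integrable lborel (\<lambda>s. A (t - s))"
    using lborel_integrable_real_affine[of A "- 1" t] by simp
  then have "integrable lebesgue (\<lambda>s. A (t - s))" by (subst integrable_completion) measurable
  moreover have "integrable lebesgue (\<lambda>s. indicator {0..T} s *\<^sub>R (norm (F s))\<^sup>2)"
    using F2 by (subst (asm) integrable_restrict_space) auto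
  ultimately show "integrable lebesgue (\<lambda>s. A (t - s) + indicator {0..T} s *\<^sub>R (norm (F s))\<^sup>2)" by simp
  show "(\<lambda>s. indicator {0..t} s *\<^sub>R resolvent (t - s) *\<^sub>R F s) \<in> borel_measurable lebesgue"
    by (rule borel_measurable_kernel_integrand[OF t Fm]) measurable
  have "AE s in lborel. norm (indicator {0..t} s *\<^sub>R resolvent (t - s) *\<^sub>R F s)
      \<le> norm (A (t - s) + indicator {0..T} s *\<^sub>R (norm (F s))\<^sup>2)"
    using AE_lborel_singleton[of t]
  proof eventually_elim
    case (elim s)
    show ?case
    proof (cases "s \<in> {0..t}")
      case True
      define r where "r = resolvent (t - s)"
      define B where "B = 1 / Gamma \<alpha> * (t - s) powr (\<alpha> - 1)"
      have rB: "0 \<le> r" "r \<le> B" using resolvent_bounds by (auto simp: r_def B_def)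
      have "A (t - s) = B\<^sup>2"
        using True t elim
        by (simp add: A_def truncate_def B_def power_mult_distrib power2_eq_square powr_add[symmetric] algebra_simps)
      moreover have "r * norm (F s) \<le> B\<^sup>2 + (norm (F s))\<^sup>2"
      proof -
        have "r * norm (F s) \<le> B * norm (F s)" using rB by (intro mult_right_mono) auto
        also have "\<dots> \<le> B\<^sup>2 + (norm (F s))\<^sup>2"
          using sum_squares_bound[of B "norm (F s)"] mult_nonneg_nonneg[of B "norm (F s)"] rB norm_ge_zero[of "F s"]
          by linarith
        finally show ?thesis .
      qed
      ultimately show ?thesis using True t rB by (simp add: r_def[symmetric])
    next
      case False
      then show ?thesis by (simp add: A_def)
    qed
  qed
  then show "AE s in lebesgue. norm (indicator {0..t} s *\<^sub>R resolvent (t - s) *\<^sub>R F s)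
      \<le> norm (A (t - s) + indicator {0..T} s *\<^sub>R (norm (F s))\<^sup>2)"
    by (rule AE_completion)
qed

subsection \<open>Riemann-Liouville integrals and square integrable functions\<close>

lemma set_integral_kernel_cong_AE:
  fixes g h :: "real \<Rightarrow> 'b::{banach,second_countable_topology}"
  assumes t: "t \<in> {0..T}" and g: "g \<in> borel_measurable (lebesgue_on {0..T})"
    and h: "h \<in> borel_measurable (lebesgue_on {0..T})"
    and \<kappa>: "\<kappa> \<in> borel_measurable borel" and eq: "AE s in lebesgue_on {0..T}. g s = h s"
  shows "(LINT s:{0..t}|lebesgue. \<kappa> (t - s) *\<^sub>R g s) = (LINT s:{0..t}|lebesgue. \<kappa> (t - s) *\<^sub>R h s)"
  unfolding set_lebesgue_integral_def
proof (rule integral_cong_AE)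
  have "AE s in lebesgue. s \<in> {0..T} \<longrightarrow> g s = h s"
    using eq by (subst (asm) AE_restrict_space_iff) auto
  then show "AE s in lebesgue. indicator {0..t} s *\<^sub>R \<kappa> (t - s) *\<^sub>R g s = indicator {0..t} s *\<^sub>R \<kappa> (t - s) *\<^sub>R h s"
    by eventually_elim (use t in \<open>auto split: split_indicator\<close>)
qed (rule borel_measurable_kernel_integrand[OF t] g h \<kappa>)+

lemma set_integral_cong_AE_Icc:
  fixes g h :: "real \<Rightarrow> 'b::{banach,second_countable_topology}"
  assumes "t \<in> {0..T}" "g \<in> borel_measurable (lebesgue_on {0..T})"
    "h \<in> borel_measurable (lebesgue_on {0..T})" "AE s in lebesgue_on {0..T}. g s = h s"
  shows "(LINT s:{0..t}|lebesgue. g s) = (LINT s:{0..t}|lebesgue. h s)"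
  using set_integral_kernel_cong_AE[OF assms(1,2,3) _ assms(4), of "\<lambda>_. 1"] by simp

lemma rl_integral_cong_AE:
  fixes g h :: "real \<Rightarrow> 'b::{banach,second_countable_topology}"
  assumes "t \<in> {0..T}" "g \<in> borel_measurable (lebesgue_on {0..T})"
    "h \<in> borel_measurable (lebesgue_on {0..T})" "AE s in lebesgue_on {0..T}. g s = h s"
  shows "rl_integral \<beta> g t = rl_integral \<beta> h t"
  using set_integral_kernel_cong_AE[OF assms(1,2,3) _ assms(4), of "\<lambda>s. s powr (\<beta> - 1)"]
  by (simp add: rl_integral_def)

lemma rl_integral_scaleR: "rl_integral \<beta> (\<lambda>s. c *\<^sub>R g s) t = c *\<^sub>R rl_integral \<beta> g t"
proof -
  have "(LINT s:{0..t}|lebesgue. (t - s) powr (\<beta> - 1) *\<^sub>R c *\<^sub>R g s)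
     = c *\<^sub>R (LINT s:{0..t}|lebesgue. (t - s) powr (\<beta> - 1) *\<^sub>R g s)"
    unfolding set_lebesgue_integral_def
    by (subst integral_scaleR_right[symmetric]) (simp add: mult_ac)
  then show ?thesis by (simp add: rl_integral_def)
qed

text \<open>The integrand is dominated by a scalar convolution with \<open>norm (g s)\<close>.
  Passing to the norm first matters because \<open>borel_version\<close> needs a finite-dimensional
  range, whereas \<open>g\<close> takes values in a Banach space.\<close>

lemma AE_integrable_rl_integrand:
  fixes g :: "real \<Rightarrow> 'b::{banach,second_countable_topology}"
  assumes \<beta>: "0 < \<beta>" and g: "integrable (lebesgue_on {0..T}) g"
  shows "AE t in lebesgue_on {0..T}. integrable lebesgue (\<lambda>s. indicator {0..t} s *\<^sub>R (t - s) powr (\<beta> - 1) *\<^sub>R g s)"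
proof -
  have gm: "g \<in> borel_measurable (lebesgue_on {0..T})" using g by (rule borel_measurable_integrable)
  then have nm: "(\<lambda>s. norm (g s)) \<in> borel_measurable (lebesgue_on {0..T})" by measurable
  obtain n where n: "n \<in> borel_measurable borel" "AE s in lborel. s \<in> {0..T} \<longrightarrow> n s = norm (g s)"
      "\<And>s. s \<notin> {0..T} \<Longrightarrow> n s = 0"
    by (rule borel_version[OF nm]) blast
  note [measurable] = n(1)
  have "integrable lborel n"
    using integrable_lebesgue_on_iff(1)[OF nm n] g by simp
  then have "AE t in lborel. integrable lborel (\<lambda>s. truncate T (\<lambda>s. 1 * s powr (\<beta> - 1)) (t - s) *\<^sub>R n s)"
    by (intro AE_integrable_convolution integrable_truncate_powr \<beta>)
  then have "AE t in lborel. t \<in> {0..T} \<longrightarrow>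
      integrable lebesgue (\<lambda>s. indicator {0..t} s *\<^sub>R (t - s) powr (\<beta> - 1) *\<^sub>R g s)"
  proof eventually_elim
    case (elim t)
    show ?case
    proof
      assume t: "t \<in> {0..T}"
      show "integrable lebesgue (\<lambda>s. indicator {0..t} s *\<^sub>R (t - s) powr (\<beta> - 1) *\<^sub>R g s)"
      proof (rule Bochner_Integration.integrable_bound)
        show "integrable lebesgue (\<lambda>s. truncate T (\<lambda>s. 1 * s powr (\<beta> - 1)) (t - s) *\<^sub>R n s)"
          using elim by (subst integrable_completion) measurable
        show "(\<lambda>s. indicator {0..t} s *\<^sub>R (t - s) powr (\<beta> - 1) *\<^sub>R g s) \<in> borel_measurable lebesgue"
          by (rule borel_measurable_kernel_integrand[OF t gm]) measurable
        have "AE s in lborel. norm (indicator {0..t} s *\<^sub>R (t - s) powr (\<beta> - 1) *\<^sub>R g s)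
            \<le> norm (truncate T (\<lambda>s. 1 * s powr (\<beta> - 1)) (t - s) *\<^sub>R n s)"
          using n(2) AE_lborel_singleton[of t]
          by eventually_elim (use t in \<open>auto simp: truncate_def split: split_indicator\<close>)
        then show "AE s in lebesgue. norm (indicator {0..t} s *\<^sub>R (t - s) powr (\<beta> - 1) *\<^sub>R g s)
            \<le> norm (truncate T (\<lambda>s. 1 * s powr (\<beta> - 1)) (t - s) *\<^sub>R n s)"
          by (rule AE_completion)
      qed
    qed
  qed
  then show ?thesis by (simp only: AE_lebesgue_on_Icc_iff)
qed

lemma integrable_set_of_lebesgue_on:
  fixes g :: "real \<Rightarrow> 'b::{banach,second_countable_topology}"
  assumes g: "integrable (lebesgue_on {0..T}) g" and t: "t \<in> {0..T}"
  shows "integrable lebesgue (\<lambda>s. indicator {0..t} s *\<^sub>R g s)"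
proof -
  have "integrable lebesgue (\<lambda>s. indicator {0..T} s *\<^sub>R g s)"
    using g by (subst (asm) integrable_restrict_space) auto
  then have "integrable lebesgue (\<lambda>s. indicator {0..t} s *\<^sub>R (indicator {0..T} s *\<^sub>R g s))"
    by (rule integrable_mult_indicator[rotated]) simp
  also have "(\<lambda>s. indicator {0..t} s *\<^sub>R (indicator {0..T} s *\<^sub>R g s)) = (\<lambda>s. indicator {0..t} s *\<^sub>R g s)"
    using t by (auto simp: fun_eq_iff split: split_indicator)
  finally show ?thesis .
qed

lemma square_add_le: "(x + y)\<^sup>2 \<le> 2 * x\<^sup>2 + 2 * y\<^sup>2" for x y :: real
  using sum_squares_bound[of x y] by (simp add: power2_sum)

lemma integrable_lebesgue_on_const: "integrable (lebesgue_on {0..T::real}) (\<lambda>_. c::real)"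
  by (intro finite_measure.integrable_const finite_measure_lebesgue_on) simp

lemma L2_integrable:
  assumes "h \<in> L2 T"
  shows "integrable (lebesgue_on {0..T}) h"
proof (rule Bochner_Integration.integrable_bound)
  show "integrable (lebesgue_on {0..T}) (\<lambda>t. 1 + (norm (h t))\<^sup>2)"
    using assms by (intro Bochner_Integration.integrable_add integrable_lebesgue_on_const) (simp add: L2_def)
  have "norm (h t) \<le> 1 + (norm (h t))\<^sup>2" for t
    using sum_squares_bound[of 1 "norm (h t)"] norm_ge_zero[of "h t"] by (simp del: norm_ge_zero)
  then show "AE t in lebesgue_on {0..T}. norm (h t) \<le> norm (1 + (norm (h t))\<^sup>2)"
    by (intro AE_I2) simp
qed (use assms in \<open>simp add: L2_def\<close>)

lemma L2_mono:
  assumes h: "h \<in> borel_measurable (lebesgue_on {0..T})" and N: "integrable (lebesgue_on {0..T}) N"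
    and le: "\<And>t. t \<in> {0..T} \<Longrightarrow> (norm (h t))\<^sup>2 \<le> N t"
  shows "h \<in> L2 T"
proof -
  have "integrable (lebesgue_on {0..T}) (\<lambda>t. (norm (h t))\<^sup>2)"
  proof (rule Bochner_Integration.integrable_bound[OF N])
    show "(\<lambda>t. (norm (h t))\<^sup>2) \<in> borel_measurable (lebesgue_on {0..T})" using h by measurable
    show "AE t in lebesgue_on {0..T}. norm ((norm (h t))\<^sup>2) \<le> norm (N t)"
      using le by (intro AE_I2) (force simp: abs_real_def)
  qed
  then show ?thesis using h by (simp add: L2_def)
qed

lemma L2_bounded:
  assumes "h \<in> borel_measurable (lebesgue_on {0..T})" "\<And>t. t \<in> {0..T} \<Longrightarrow> (norm (h t))\<^sup>2 \<le> B"
  shows "h \<in> L2 T"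
  using assms(1) integrable_lebesgue_on_const assms(2) by (rule L2_mono)

lemma L2_diff:
  assumes g: "g \<in> L2 T" and h: "h \<in> L2 T"
  shows "(\<lambda>t. g t - h t) \<in> L2 T"
proof (rule L2_mono)
  show "(\<lambda>t. g t - h t) \<in> borel_measurable (lebesgue_on {0..T})"
    using g h by (auto simp: L2_def)
  show "integrable (lebesgue_on {0..T}) (\<lambda>t. 2 * (norm (g t))\<^sup>2 + 2 * (norm (h t))\<^sup>2)"
    using g h by (auto simp: L2_def)
  show "(norm (g t - h t))\<^sup>2 \<le> 2 * (norm (g t))\<^sup>2 + 2 * (norm (h t))\<^sup>2" for t
    by (rule order_trans[OF power_mono[OF norm_triangle_ineq4] square_add_le]) simp
qed

lemma rl_integral_cong:
  assumes "\<And>s. s \<in> {0..t} \<Longrightarrow> g s = h s"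
  shows "rl_integral \<beta> g t = rl_integral \<beta> h t"
proof -
  have "(LINT s:{0..t}|lebesgue. (t - s) powr (\<beta> - 1) *\<^sub>R g s) = (LINT s:{0..t}|lebesgue. (t - s) powr (\<beta> - 1) *\<^sub>R h s)"
    unfolding set_lebesgue_integral_def
    by (intro Bochner_Integration.integral_cong) (use assms in \<open>auto split: split_indicator\<close>)
  then show ?thesis by (simp add: rl_integral_def)
qed

lemma set_integral_cong_Icc:
  fixes g h :: "real \<Rightarrow> 'b::{banach,second_countable_topology}"
  assumes "\<And>s. s \<in> {0..t} \<Longrightarrow> g s = h s"
  shows "(LINT s:{0..t}|lebesgue. g s) = (LINT s:{0..t}|lebesgue. h s)"
  unfolding set_lebesgue_integral_def
  by (intro Bochner_Integration.integral_cong) (use assms in \<open>auto split: split_indicator\<close>)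

lemma set_integral_scaleR:
  fixes g :: "real \<Rightarrow> 'b::{banach,second_countable_topology}"
  shows "(LINT s:A|M. c *\<^sub>R g s) = c *\<^sub>R (LINT s:A|M. g s)"
  unfolding set_lebesgue_integral_def
  by (subst integral_scaleR_right[symmetric]) (simp add: mult.commute)

subsection \<open>Diagonal operators in a Hilbert space\<close>

lemma scalar_cnj_add: "scalar_cnj (a + b) = scalar_cnj a + scalar_cnj b"
  by (simp add: scalar_cnj_def inner_add_left algebra_simps)

lemma scalar_cnj_0 [simp]: "scalar_cnj 0 = 0"
  by (simp add: scalar_cnj_def)

lemma scalar_cnj_scaleR: "scalar_cnj (r *\<^sub>R a) = r *\<^sub>R scalar_cnj a"
  by (simp add: scalar_cnj_def scaleR_diff_right) (simp add: scaleR_conv_of_real)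

lemma inner_1_1: "(1 :: 'k::{real_normed_field,euclidean_space}) \<bullet> 1 = 1"
  using power2_norm_eq_inner[of "1 :: 'k"] by simp

lemma norm_scalar_cnj [simp]: "norm (scalar_cnj a) = norm a"
proof -
  have "(norm (scalar_cnj a))\<^sup>2 = (norm a)\<^sup>2"
    unfolding power2_norm_eq_inner
    by (simp add: scalar_cnj_def of_real_def inner_diff_left inner_diff_right inner_1_1 inner_commute[of 1 a])
  then show ?thesis by simp
qed

context hilbert_space
begin

lemma ip_zero_left [simp]: "ip 0 x = 0"
  using ip_scl_left[of 0 0 x] by simp

lemma ip_scaleR_left: "ip (r *\<^sub>R x) y = r *\<^sub>R ip x y"
  using ip_scl_left[of "of_real r" x y] by (simp add: scl_of_real scaleR_conv_of_real)

lemma ip_add_right: "ip x (y + z) = ip x y + ip x z"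
  by (simp add: ip_cnj[of x] ip_add_left scalar_cnj_add)

lemma ip_scaleR_right: "ip x (r *\<^sub>R y) = r *\<^sub>R ip x y"
  by (simp add: ip_cnj[of x] ip_scaleR_left scalar_cnj_scaleR)

lemma ip_diff_left: "ip (x - y) z = ip x z - ip y z"
  using ip_add_left[of "x - y" y z] by simp

lemma ip_sum_left: "ip (sum f F) z = (\<Sum>\<xi>\<in>F. ip (f \<xi>) z)"
  by (induction F rule: infinite_finite_induct) (auto simp: ip_add_left)

lemma scl_scaleR: "scl (r *\<^sub>R c) x = r *\<^sub>R scl c x"
  by (metis scale_scale scl_of_real scaleR_conv_of_real)

lemma ip_scl_scl: "ip (scl c x) (scl c x) = c * scalar_cnj c * of_real ((norm x)\<^sup>2)"
proof -
  have "ip (scl c x) (scl c x) = c * scalar_cnj (c * ip x x)"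
    by (simp add: ip_scl_left ip_cnj[of "scl c x" x] del: ip_self) (metis ip_cnj ip_scl_left)
  also have "c * ip x x = (norm x)\<^sup>2 *\<^sub>R c"
    by (simp add: ip_self scaleR_conv_of_real)
  finally show ?thesis by (simp add: scalar_cnj_scaleR) (simp add: scaleR_conv_of_real)
qed

lemma norm_scl: "norm (scl c x) = norm c * norm x"
proof -
  have "(norm (scl c x))\<^sup>2 = norm (ip (scl c x) (scl c x))"
    by (simp add: ip_self norm_power)
  also have "\<dots> = (norm c * norm x)\<^sup>2"
    by (simp add: ip_scl_scl norm_mult norm_power power2_eq_square)
  finally show ?thesis by (simp add: power2_eq_iff_nonneg)
qed

text \<open>Conjugation is given only as a reflection of the scalar field. The product is read off
  by computing the inner product of \<open>scl c x\<close> with itself in two ways, which takes a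
  nonzero vector.\<close>

lemma mult_scalar_cnj:
  fixes x :: 'h and c :: 'k
  assumes "x \<noteq> 0"
  shows "c * scalar_cnj c = of_real ((norm c)\<^sup>2)"
proof -
  have "c * scalar_cnj c * of_real ((norm x)\<^sup>2) = of_real ((norm c * norm x)\<^sup>2)"
    using ip_scl_scl[of c x] by (simp only: ip_self norm_scl)
  then show ?thesis using assms by (simp add: power_mult_distrib)
qed

lemma bounded_linear_scl_left: "bounded_linear (\<lambda>c. scl c x)"
  by (rule bounded_linear_intro[where K = "norm x"])
     (auto simp: scale_left_distrib scl_scaleR norm_scl)

text \<open>Only linearity in the first argument is used, since in an abstract scalar field
  multiplicativity of the conjugation is not immediate.\<close>

lemma norm_sum_orthonormal:
  assumes F: "finite F" and on: "\<And>\<xi> \<eta>. \<xi> \<in> F \<Longrightarrow> \<eta> \<in> F \<Longrightarrow> ip (e \<xi>) (e \<eta>) = (if \<xi> = \<eta> then 1 else 0)"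
  shows "(norm (\<Sum>\<xi>\<in>F. scl (c \<xi>) (e \<xi>)))\<^sup>2 = (\<Sum>\<xi>\<in>F. (norm (c \<xi>))\<^sup>2)"
    and "(\<Sum>\<xi>\<in>F. (norm (ip x (e \<xi>)))\<^sup>2) \<le> (norm x)\<^sup>2"
proof -
  have coef: "ip (\<Sum>\<xi>\<in>F. scl (c \<xi>) (e \<xi>)) (e \<eta>) = c \<eta>" if "\<eta> \<in> F" for c \<eta>
  proof -
    have "ip (\<Sum>\<xi>\<in>F. scl (c \<xi>) (e \<xi>)) (e \<eta>) = (\<Sum>\<xi>\<in>F. if \<xi> = \<eta> then c \<eta> else 0)"
      unfolding ip_sum_left ip_scl_left using on that by (intro sum.cong) auto
    then show ?thesis using F that by simp
  qed
  have nz: "e \<xi> \<noteq> 0" if "\<xi> \<in> F" for \<xi> using on[OF that that] by auto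
  have sq: "(norm (\<Sum>\<xi>\<in>F. scl (c \<xi>) (e \<xi>)))\<^sup>2 = (\<Sum>\<xi>\<in>F. (norm (c \<xi>))\<^sup>2)" for c
  proof -
    define s where "s = (\<Sum>\<xi>\<in>F. scl (c \<xi>) (e \<xi>))"
    have "ip s s = (\<Sum>\<xi>\<in>F. c \<xi> * ip (e \<xi>) s)"
      by (subst s_def) (simp add: ip_sum_left ip_scl_left)
    also have "\<dots> = (\<Sum>\<xi>\<in>F. of_real ((norm (c \<xi>))\<^sup>2))"
    proof (intro sum.cong refl)
      fix \<xi> assume \<xi>: "\<xi> \<in> F"
      have "ip (e \<xi>) s = scalar_cnj (c \<xi>)"
        using coef[OF \<xi>] by (simp add: ip_cnj[of "e \<xi>"] s_def)
      then show "c \<xi> * ip (e \<xi>) s = of_real ((norm (c \<xi>))\<^sup>2)"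
        using mult_scalar_cnj[OF nz[OF \<xi>]] by simp
    qed
    finally have "of_real ((norm s)\<^sup>2) = (of_real (\<Sum>\<xi>\<in>F. (norm (c \<xi>))\<^sup>2) :: 'k)"
      by (simp only: ip_self of_real_sum)
    then show ?thesis by (simp only: of_real_eq_iff s_def)
  qed
  then show "(norm (\<Sum>\<xi>\<in>F. scl (c \<xi>) (e \<xi>)))\<^sup>2 = (\<Sum>\<xi>\<in>F. (norm (c \<xi>))\<^sup>2)" .
  \<comment> \<open>Orthogonal projection of \<open>x\<close> onto the span of the family; Bessel's
    inequality is Pythagoras for \<open>x = (x - s) + s\<close>.\<close>
  define s where "s = (\<Sum>\<xi>\<in>F. scl (ip x (e \<xi>)) (e \<xi>))"
  have z: "ip (x - s) (e \<xi>) = 0" if "\<xi> \<in> F" for \<xi>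
    using coef[OF that] by (simp add: ip_diff_left s_def)
  have "ip s (x - s) = 0"
    unfolding s_def ip_sum_left ip_scl_left
    using z by (intro sum.neutral) (auto simp: ip_cnj[of "e _"] s_def)
  moreover from this have "ip (x - s) s = 0" by (simp add: ip_cnj[of "x - s" s])
  ultimately have "ip ((x - s) + s) ((x - s) + s) = ip (x - s) (x - s) + ip s s"
    by (simp only: ip_add_left ip_add_right add_0_left add_0_right)
  then have "of_real ((norm x)\<^sup>2) = (of_real ((norm (x - s))\<^sup>2 + (norm s)\<^sup>2) :: 'k)"
    by (simp add: ip_self)
  then have "(norm x)\<^sup>2 = (norm (x - s))\<^sup>2 + (norm s)\<^sup>2" by (simp only: of_real_eq_iff)
  then show "(\<Sum>\<xi>\<in>F. (norm (ip x (e \<xi>)))\<^sup>2) \<le> (norm x)\<^sup>2"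
    using sq[of "\<lambda>\<xi>. ip x (e \<xi>)"] by (simp add: s_def)
qed

text \<open>Bessel's inequality for the one-element orthonormal family made of \<open>y\<close>
  divided by its norm.\<close>

lemma ip_Cauchy_Schwarz: "norm (ip x y) \<le> norm x * norm y"
proof (cases "y = 0")
  case True
  then show ?thesis by (simp add: ip_cnj[of x 0])
next
  case False
  define u where "u = (1 / norm y) *\<^sub>R y"
  have y: "y = norm y *\<^sub>R u" using False by (simp add: u_def)
  have "norm u = 1" using False by (simp add: u_def)
  then have "(norm (ip x u))\<^sup>2 \<le> (norm x)\<^sup>2"
    using norm_sum_orthonormal(2)[of "{u}" id x] by (simp add: ip_self)
  then have "norm (ip x u) \<le> norm x" by (simp add: power2_le_iff_abs_le)
  moreover have "ip x y = norm y *\<^sub>R ip x u" by (metis y ip_scaleR_right)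
  ultimately show ?thesis
    using mult_right_mono[of "norm (ip x u)" "norm x" "norm y"] by (simp add: mult.commute)
qed

lemma bounded_linear_ip: "bounded_linear (\<lambda>x. ip x y)"
  by (rule bounded_linear_intro[where K = "norm y"])
     (auto simp: ip_add_left ip_scaleR_left ip_Cauchy_Schwarz)

end

section \<open>Coefficients with respect to an orthonormal basis\<close>

locale hilbert_basis = hilbert_space scl ip
  for scl :: "'k::{real_normed_field,euclidean_space} \<Rightarrow> 'h::{banach,second_countable_topology} \<Rightarrow> 'h"
    and ip :: "'h \<Rightarrow> 'h \<Rightarrow> 'k" +
  fixes I :: "'i set" and e :: "'i \<Rightarrow> 'h"
  assumes basis: "orthonormal_basis scl ip I e" and countable: "countable I"
begin

lemma orthonormal: "\<xi> \<in> I \<Longrightarrow> \<eta> \<in> I \<Longrightarrow> ip (e \<xi>) (e \<eta>) = (if \<xi> = \<eta> then 1 else 0)"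
  using basis by (auto simp: orthonormal_basis_def)

lemma expansion: "((\<lambda>\<xi>. scl (ip g (e \<xi>)) (e \<xi>)) has_sum g) I"
  using basis by (auto simp: orthonormal_basis_def)

lemma parseval_finite:
  "finite F \<Longrightarrow> F \<subseteq> I \<Longrightarrow> (norm (\<Sum>\<xi>\<in>F. scl (c \<xi>) (e \<xi>)))\<^sup>2 = (\<Sum>\<xi>\<in>F. (norm (c \<xi>))\<^sup>2)"
  by (intro norm_sum_orthonormal orthonormal) auto

lemma bessel: "finite F \<Longrightarrow> F \<subseteq> I \<Longrightarrow> (\<Sum>\<xi>\<in>F. (norm (ip x (e \<xi>)))\<^sup>2) \<le> (norm x)\<^sup>2"
  by (intro norm_sum_orthonormal orthonormal) auto

lemma basis_eqI:
  assumes "\<And>\<xi>. \<xi> \<in> I \<Longrightarrow> ip x (e \<xi>) = ip y (e \<xi>)"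
  shows "x = y"
proof -
  have "((\<lambda>\<xi>. scl (ip x (e \<xi>)) (e \<xi>)) has_sum y) I"
    using expansion[of y] assms by (simp cong: has_sum_cong)
  then show ?thesis using expansion[of x] has_sum_unique by blast
qed

lemma coefficient_has_sum:
  assumes x: "((\<lambda>\<xi>. scl (c \<xi>) (e \<xi>)) has_sum x) I" and \<xi>: "\<xi> \<in> I"
  shows "ip x (e \<xi>) = c \<xi>"
proof -
  have "((\<lambda>\<eta>. ip (scl (c \<eta>) (e \<eta>)) (e \<xi>)) has_sum ip x (e \<xi>)) I"
    by (rule has_sum_bounded_linear[OF bounded_linear_ip x])
  moreover have "((\<lambda>\<eta>. ip (scl (c \<eta>) (e \<eta>)) (e \<xi>)) has_sum c \<xi>) {\<xi>}"
    using orthonormal[OF \<xi> \<xi>] by (intro has_sum_finiteI) (auto simp: ip_scl_left)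
  then have "((\<lambda>\<eta>. ip (scl (c \<eta>) (e \<eta>)) (e \<xi>)) has_sum c \<xi>) I"
    by (rule has_sum_cong_neutral[THEN iffD1, rotated 3]) (use \<xi> orthonormal in \<open>auto simp: ip_scl_left\<close>)
  ultimately show ?thesis by (rule has_sum_unique)
qed

text \<open>By orthonormality the distance of two nested finite partial sums is governed by a tail
  of the scalar series of squares, so the partial sums form a Cauchy filter along the finite
  subsets.\<close>

lemma riesz_fischer:
  assumes B: "\<And>F. finite F \<Longrightarrow> F \<subseteq> I \<Longrightarrow> (\<Sum>\<xi>\<in>F. (norm (c \<xi>))\<^sup>2) \<le> B"
  shows "(\<lambda>\<xi>. scl (c \<xi>) (e \<xi>)) summable_on I"
proof -
  define f where "f \<xi> = scl (c \<xi>) (e \<xi>)" for \<xi>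
  have summ: "(\<lambda>\<xi>. (norm (c \<xi>))\<^sup>2) summable_on I"
    using B by (intro nonneg_bdd_above_summable_on bdd_aboveI[of _ B]) auto
  define S where "S = (\<Sum>\<^sub>\<infinity>\<xi>\<in>I. (norm (c \<xi>))\<^sup>2)"
  have "cauchy_filter (filtermap (sum f) (finite_subsets_at_top I))"
    unfolding cauchy_filter_iff
  proof safe
    fix P :: "'h \<times> 'h \<Rightarrow> bool" assume "eventually P uniformity"
    then obtain \<epsilon> where \<epsilon>: "0 < \<epsilon>" "\<And>x y. dist x y < \<epsilon> \<Longrightarrow> P (x, y)"
      unfolding eventually_uniformity_metric by auto
    \<comment> \<open>Every partial sum containing \<open>F0\<close> lies within
      \<open>\<epsilon> / 3\<close> of the one over \<open>F0\<close>; two of them then differ by at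
      most \<open>2 * \<epsilon> / 3\<close>, which is less than \<epsilon>.\<close>
    obtain F0 where F0: "finite F0" "F0 \<subseteq> I" "dist (\<Sum>\<xi>\<in>F0. (norm (c \<xi>))\<^sup>2) S \<le> (\<epsilon> / 3)\<^sup>2"
      using infsum_finite_approximation[OF summ, of "(\<epsilon> / 3)\<^sup>2"] \<epsilon>(1) unfolding S_def by auto
    define X where "X = {sum f F | F. finite F \<and> F \<subseteq> I \<and> F0 \<subseteq> F}"
    have near: "dist (sum f F) (sum f F0) \<le> \<epsilon> / 3" if F: "finite F" "F \<subseteq> I" "F0 \<subseteq> F" for F
    proof -
      have "(norm (sum f F - sum f F0))\<^sup>2 = (norm (sum f (F - F0)))\<^sup>2"
        using F by (simp add: sum_diff)
      also have "\<dots> = (\<Sum>\<xi>\<in>F - F0. (norm (c \<xi>))\<^sup>2)"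
        unfolding f_def using F by (intro parseval_finite) auto
      also have "\<dots> = (\<Sum>\<xi>\<in>F. (norm (c \<xi>))\<^sup>2) - (\<Sum>\<xi>\<in>F0. (norm (c \<xi>))\<^sup>2)"
        using F by (simp add: sum_diff)
      also have "\<dots> \<le> S - (\<Sum>\<xi>\<in>F0. (norm (c \<xi>))\<^sup>2)"
        unfolding S_def using F summ by (intro diff_right_mono finite_sum_le_infsum) auto
      also have "\<dots> \<le> (\<epsilon> / 3)\<^sup>2" using F0(3) by (simp add: dist_real_def)
      finally show ?thesis
        using \<epsilon>(1) by (simp add: dist_norm power2_le_iff_abs_le)
    qed
    have "eventually (\<lambda>x. x \<in> X) (filtermap (sum f) (finite_subsets_at_top I))"
      unfolding eventually_filtermap eventually_finite_subsets_at_top X_def using F0(1,2) by blast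
    moreover have "P z" if "z \<in> X \<times> X" for z
    proof -
      obtain F G where FG: "z = (sum f F, sum f G)" "finite F" "F \<subseteq> I" "F0 \<subseteq> F" "finite G" "G \<subseteq> I" "F0 \<subseteq> G"
        using \<open>z \<in> X \<times> X\<close> by (auto simp: X_def)
      have "dist (sum f F) (sum f G) \<le> \<epsilon> / 3 + \<epsilon> / 3"
        using near[of F] near[of G] FG dist_triangle2[of "sum f F" "sum f G" "sum f F0"] by simp
      then show ?thesis using \<epsilon> FG by simp
    qed
    ultimately show "\<exists>X. eventually (\<lambda>x. x \<in> X) (filtermap (sum f) (finite_subsets_at_top I)) \<and> (\<forall>z\<in>X \<times> X. P z)"
      by blast
  qed
  then obtain x where "filtermap (sum f) (finite_subsets_at_top I) \<le> nhds x"
    using cauchy_filter_convergent unfolding convergent_filter_iff by blast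
  then show ?thesis
    unfolding summable_on_def has_sum_def filterlim_def f_def[symmetric] by blast
qed

lemma coefficient_infsum:
  assumes "\<And>F. finite F \<Longrightarrow> F \<subseteq> I \<Longrightarrow> (\<Sum>\<xi>\<in>F. (norm (c \<xi>))\<^sup>2) \<le> B" "\<xi> \<in> I"
  shows "ip (\<Sum>\<^sub>\<infinity>\<xi>\<in>I. scl (c \<xi>) (e \<xi>)) (e \<xi>) = c \<xi>"
  using riesz_fischer[OF assms(1)] assms(2) by (intro coefficient_has_sum has_sum_infsum)

lemma norm_le_of_coefficients:
  assumes B: "\<And>F. finite F \<Longrightarrow> F \<subseteq> I \<Longrightarrow> (\<Sum>\<xi>\<in>F. (norm (ip x (e \<xi>)))\<^sup>2) \<le> B"
  shows "(norm x)\<^sup>2 \<le> B"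
proof -
  have "((\<lambda>F. (norm (\<Sum>\<xi>\<in>F. scl (ip x (e \<xi>)) (e \<xi>)))\<^sup>2) \<longlongrightarrow> (norm x)\<^sup>2) (finite_subsets_at_top I)"
    using expansion[of x] unfolding has_sum_def by (intro tendsto_intros)
  then show ?thesis
  proof (rule tendsto_upperbound)
    show "\<forall>\<^sub>F F in finite_subsets_at_top I. (norm (\<Sum>\<xi>\<in>F. scl (ip x (e \<xi>)) (e \<xi>)))\<^sup>2 \<le> B"
      by (rule eventually_finite_subsets_at_top_weakI) (simp add: parseval_finite B)
  qed simp
qed

text \<open>Basis expansions converge along finite subsets; enumerating the countable
  \<open>I\<close> turns this into a sequence, so \<open>f\<close> is a pointwise limit of
  measurable finite sums.\<close>

lemma borel_measurable_coefficientwise: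
  assumes "\<And>\<xi>. \<xi> \<in> I \<Longrightarrow> (\<lambda>t. ip (f t) (e \<xi>)) \<in> borel_measurable M"
  shows "f \<in> borel_measurable M"
proof -
  define F where "F n = {\<xi> \<in> I. to_nat_on I \<xi> < n}" for n
  have fin: "finite (F n)" for n
    unfolding F_def using countable
    by (intro finite_imageD[of "to_nat_on I"]) (auto intro: finite_subset[of _ "{..<n}"] inj_on_subset[OF inj_on_to_nat_on])
  have "filterlim F (finite_subsets_at_top I) sequentially"
    unfolding filterlim_finite_subsets_at_top
  proof safe
    fix X assume X: "finite X" "X \<subseteq> I"
    show "\<forall>\<^sub>F n in sequentially. finite (F n) \<and> X \<subseteq> F n \<and> F n \<subseteq> I"
      using eventually_gt_at_top[of "Max (to_nat_on I ` X)"]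
    proof eventually_elim
      case (elim n)
      have "to_nat_on I \<xi> < n" if "\<xi> \<in> X" for \<xi>
        using elim X(1) that by (meson Max_ge finite_imageI image_eqI le_less_trans)
      then show ?case using fin X by (auto simp: F_def)
    qed
  qed
  then have lim: "(\<lambda>n. \<Sum>\<xi>\<in>F n. scl (ip (f t) (e \<xi>)) (e \<xi>)) \<longlonglongrightarrow> f t" for t
    using expansion[of "f t"] unfolding has_sum_def by (rule filterlim_compose[rotated])
  show ?thesis
  proof (rule borel_measurable_LIMSEQ_metric)
    show "(\<lambda>t. \<Sum>\<xi>\<in>F n. scl (ip (f t) (e \<xi>)) (e \<xi>)) \<in> borel_measurable M" for n
    proof (rule borel_measurable_sum)
      fix \<xi> assume "\<xi> \<in> F n"
      then have "(\<lambda>t. ip (f t) (e \<xi>)) \<in> borel_measurable M" using assms by (simp add: F_def)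
      then show "(\<lambda>t. scl (ip (f t) (e \<xi>)) (e \<xi>)) \<in> borel_measurable M"
        by (rule measurable_compose)
          (intro borel_measurable_continuous_onI linear_continuous_on bounded_linear_scl_left)
    qed
  qed (rule lim)
qed

lemma borel_measurable_coefficient:
  assumes "f \<in> borel_measurable M"
  shows "(\<lambda>t. ip (f t) y) \<in> borel_measurable M"
  using assms by (rule measurable_compose)
    (intro borel_measurable_continuous_onI linear_continuous_on bounded_linear_ip)

lemma diag_domainI:
  assumes "\<And>F. finite F \<Longrightarrow> F \<subseteq> I \<Longrightarrow> (\<Sum>\<xi>\<in>F. (norm (a \<xi> *\<^sub>R ip x (e \<xi>)))\<^sup>2) \<le> B"
  shows "x \<in> diag_domain scl ip I e a"
  using riesz_fischer[OF assms] by (simp add: diag_domain_def scl_scaleR)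

lemma coefficient_diag_op:
  assumes "x \<in> diag_domain scl ip I e a" "\<xi> \<in> I"
  shows "ip (diag_op scl ip I e a x) (e \<xi>) = a \<xi> *\<^sub>R ip x (e \<xi>)"
proof -
  have "((\<lambda>\<xi>. scl (a \<xi> *\<^sub>R ip x (e \<xi>)) (e \<xi>)) has_sum diag_op scl ip I e a x) I"
    using assms(1) by (simp add: diag_domain_def diag_op_def scl_scaleR)
  then show ?thesis using assms(2) by (rule coefficient_has_sum)
qed

text \<open>Testing \<open>A\<close> against eigenvectors gives
  \<open>ip (e \<xi>) (A z) = a \<xi>\<close> times \<open>ip (e \<xi>) z\<close> for
  \<open>z\<close> in \<open>D\<close>. Summed against the expansion of \<open>x\<close>, this shows
  that \<open>x\<close> lies in the domain of the adjoint with the diagonal value, and the adjoint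
  is \<open>A\<close> itself.\<close>

lemma self_adjoint_diag:
  assumes sa: "self_adjoint_operator scl ip D A"
    and eig: "\<And>\<xi>. \<xi> \<in> I \<Longrightarrow> e \<xi> \<in> D \<and> A (e \<xi>) = a \<xi> *\<^sub>R e \<xi>"
    and x: "x \<in> diag_domain scl ip I e a"
  shows "A x = diag_op scl ip I e a x"
proof -
  have adj: "(u \<in> D \<and> A u = v) \<longleftrightarrow> (\<forall>z\<in>D. ip (A z) u = ip z v)" for u v
    using sa unfolding self_adjoint_operator_def by blast
  have "ip (A z) x = ip z (diag_op scl ip I e a x)" if z: "z \<in> D" for z
  proof -
    have A: "ip (e \<xi>) (A z) = a \<xi> *\<^sub>R ip (e \<xi>) z" if "\<xi> \<in> I" for \<xi>
      using adj[of z "A z"] z eig[OF that] by (metis ip_scaleR_left)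
    have "((\<lambda>\<xi>. ip (scl (ip x (e \<xi>)) (e \<xi>)) (A z)) has_sum ip x (A z)) I"
      by (rule has_sum_bounded_linear[OF bounded_linear_ip expansion])
    moreover have "((\<lambda>\<xi>. a \<xi> *\<^sub>R scl (ip x (e \<xi>)) (e \<xi>)) has_sum diag_op scl ip I e a x) I"
      using x by (simp add: diag_domain_def diag_op_def)
    then have "((\<lambda>\<xi>. ip (a \<xi> *\<^sub>R scl (ip x (e \<xi>)) (e \<xi>)) z) has_sum ip (diag_op scl ip I e a x) z) I"
      by (rule has_sum_bounded_linear[OF bounded_linear_ip])
    then have "((\<lambda>\<xi>. ip (scl (ip x (e \<xi>)) (e \<xi>)) (A z)) has_sum ip (diag_op scl ip I e a x) z) I"
      by (rule has_sum_cong[THEN iffD1, rotated]) (simp add: ip_scaleR_left ip_scl_left A)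
    ultimately have "ip x (A z) = ip (diag_op scl ip I e a x) z" by (rule has_sum_unique)
    then show ?thesis by (metis ip_cnj)
  qed
  then show ?thesis using adj by blast
qed

end

lemma (in hilbert_space) ip_set_integral:
  assumes "integrable lebesgue (\<lambda>s. indicator A s *\<^sub>R g s)"
  shows "ip (LINT s:A|lebesgue. g s) y = (LINT s:A|lebesgue. ip (g s) y)"
  unfolding set_lebesgue_integral_def
  using integral_bounded_linear[OF bounded_linear_ip assms, of y] by (simp add: ip_scaleR_left)

lemma (in hilbert_space) AE_ip_rl_integral:
  assumes "0 < \<beta>" and g: "integrable (lebesgue_on {0..T}) g"
  shows "AE t in lebesgue_on {0..T}. \<forall>y. ip (rl_integral \<beta> g t) y = rl_integral \<beta> (\<lambda>s. ip (g s) y) t"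
  using AE_integrable_rl_integrand[OF assms]
  by eventually_elim (auto simp: rl_integral_def ip_scaleR_left ip_set_integral)

text \<open>The inner product passes through the fractional integral wherever the singular integrand
  is integrable, that is for almost every \<open>t\<close>. Vectors with equal coefficients agree,
  and the exceptional null sets can be united because \<open>I\<close> is countable.\<close>

lemma (in hilbert_basis) has_caputo_derivative_coefficientwise:
  assumes \<alpha>: "\<alpha> < 1"
  shows "has_caputo_derivative \<alpha> T g h \<longleftrightarrow>
    integrable (lebesgue_on {0..T}) g \<and> integrable (lebesgue_on {0..T}) h \<and>
    (\<forall>\<xi>\<in>I. AE t in lebesgue_on {0..T}.
       rl_integral (1 - \<alpha>) (\<lambda>s. ip (g s) (e \<xi>) - ip (g 0) (e \<xi>)) t = (LINT s:{0..t}|lebesgue. ip (h s) (e \<xi>)))"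
proof (cases "integrable (lebesgue_on {0..T}) g \<and> integrable (lebesgue_on {0..T}) h")
  case True
  then have g: "integrable (lebesgue_on {0..T}) (\<lambda>s. g s - g 0)" and h: "integrable (lebesgue_on {0..T}) h"
    by auto
  have "AE t in lebesgue_on {0..T}. \<forall>y. ip (rl_integral (1 - \<alpha>) (\<lambda>s. g s - g 0) t) y = rl_integral (1 - \<alpha>) (\<lambda>s. ip (g s - g 0) y) t"
    using \<alpha> g by (intro AE_ip_rl_integral) auto
  moreover have "AE t in lebesgue_on {0..T}. t \<in> {0..T}"
    by (rule AE_I2) simp
  ultimately have ae: "AE t in lebesgue_on {0..T}. rl_integral (1 - \<alpha>) (\<lambda>s. g s - g 0) t = (LINT s:{0..t}|lebesgue. h s)
     \<longleftrightarrow> (\<forall>\<xi>\<in>I. rl_integral (1 - \<alpha>) (\<lambda>s. ip (g s) (e \<xi>) - ip (g 0) (e \<xi>)) t = (LINT s:{0..t}|lebesgue. ip (h s) (e \<xi>)))"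
  proof eventually_elim
    case (elim t)
    have "ip (rl_integral (1 - \<alpha>) (\<lambda>s. g s - g 0) t) (e \<xi>) = rl_integral (1 - \<alpha>) (\<lambda>s. ip (g s) (e \<xi>) - ip (g 0) (e \<xi>)) t" for \<xi>
      using elim(1) by (simp add: ip_diff_left)
    moreover have "ip (LINT s:{0..t}|lebesgue. h s) (e \<xi>) = (LINT s:{0..t}|lebesgue. ip (h s) (e \<xi>))" for \<xi>
      using elim(2) h by (intro ip_set_integral integrable_set_of_lebesgue_on[of T]) auto
    ultimately show ?case by (metis basis_eqI)
  qed
  have "(AE t in lebesgue_on {0..T}. rl_integral (1 - \<alpha>) (\<lambda>s. g s - g 0) t = (LINT s:{0..t}|lebesgue. h s))
     \<longleftrightarrow> (AE t in lebesgue_on {0..T}. \<forall>\<xi>\<in>I. rl_integral (1 - \<alpha>) (\<lambda>s. ip (g s) (e \<xi>) - ip (g 0) (e \<xi>)) t = (LINT s:{0..t}|lebesgue. ip (h s) (e \<xi>)))"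
    using ae by (rule eventually_subst)
  also have "\<dots> \<longleftrightarrow> (\<forall>\<xi>\<in>I. AE t in lebesgue_on {0..T}. rl_integral (1 - \<alpha>) (\<lambda>s. ip (g s) (e \<xi>) - ip (g 0) (e \<xi>)) t = (LINT s:{0..t}|lebesgue. ip (h s) (e \<xi>)))"
    by (rule AE_ball_countable[OF countable])
  finally show ?thesis using True by (simp add: has_caputo_derivative_def)
qed (auto simp: has_caputo_derivative_def)

context hilbert_basis
begin

lemma L2_coefficient:
  assumes h: "h \<in> L2 T" and \<xi>: "\<xi> \<in> I"
  shows "(\<lambda>t. ip (h t) (e \<xi>)) \<in> borel_measurable (lebesgue_on {0..T})"
    and "integrable (lebesgue_on {0..T}) (\<lambda>t. (norm (ip (h t) (e \<xi>)))\<^sup>2)"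
proof -
  show m: "(\<lambda>t. ip (h t) (e \<xi>)) \<in> borel_measurable (lebesgue_on {0..T})"
    using h by (intro borel_measurable_coefficient) (simp add: L2_def)
  show "integrable (lebesgue_on {0..T}) (\<lambda>t. (norm (ip (h t) (e \<xi>)))\<^sup>2)"
  proof (rule Bochner_Integration.integrable_bound)
    show "integrable (lebesgue_on {0..T}) (\<lambda>t. (norm (h t))\<^sup>2)" using h by (simp add: L2_def)
    show "(\<lambda>t. (norm (ip (h t) (e \<xi>)))\<^sup>2) \<in> borel_measurable (lebesgue_on {0..T})"
      using m by measurable
    show "AE t in lebesgue_on {0..T}. norm ((norm (ip (h t) (e \<xi>)))\<^sup>2) \<le> norm ((norm (h t))\<^sup>2)"
      using bessel[of "{\<xi>}"] \<xi> by (intro AE_I2) simp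
  qed
qed

lemma L2_bessel:
  assumes h: "h \<in> L2 T" and F: "finite F" "F \<subseteq> I"
  shows "(\<Sum>\<xi>\<in>F. LINT t|lebesgue_on {0..T}. (norm (ip (h t) (e \<xi>)))\<^sup>2) \<le> (LINT t|lebesgue_on {0..T}. (norm (h t))\<^sup>2)"
proof -
  have i: "integrable (lebesgue_on {0..T}) (\<lambda>t. (norm (ip (h t) (e \<xi>)))\<^sup>2)" if "\<xi> \<in> F" for \<xi>
    using L2_coefficient(2)[OF h] F(2) that by auto
  have "(\<Sum>\<xi>\<in>F. LINT t|lebesgue_on {0..T}. (norm (ip (h t) (e \<xi>)))\<^sup>2)
      = (LINT t|lebesgue_on {0..T}. (\<Sum>\<xi>\<in>F. (norm (ip (h t) (e \<xi>)))\<^sup>2))"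
    using i by (intro Bochner_Integration.integral_sum[symmetric]) auto
  also have "\<dots> \<le> (LINT t|lebesgue_on {0..T}. (norm (h t))\<^sup>2)"
    using i h bessel[OF F] by (intro integral_mono Bochner_Integration.integrable_sum) (auto simp: L2_def)
  finally show ?thesis .
qed

lemma diag_domain_bounded:
  assumes le: "\<And>\<xi>. \<xi> \<in> I \<Longrightarrow> norm (a \<xi> *\<^sub>R ip x (e \<xi>)) \<le> norm (ip y (e \<xi>))"
  shows "x \<in> diag_domain scl ip I e a" and "norm (diag_op scl ip I e a x) \<le> norm y"
proof -
  have B: "(\<Sum>\<xi>\<in>F. (norm (a \<xi> *\<^sub>R ip x (e \<xi>)))\<^sup>2) \<le> (norm y)\<^sup>2" if "finite F" "F \<subseteq> I" for F
  proof -
    have "(\<Sum>\<xi>\<in>F. (norm (a \<xi> *\<^sub>R ip x (e \<xi>)))\<^sup>2) \<le> (\<Sum>\<xi>\<in>F. (norm (ip y (e \<xi>)))\<^sup>2)"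
    proof (rule sum_mono)
      fix \<xi> assume "\<xi> \<in> F"
      then have "norm (a \<xi> *\<^sub>R ip x (e \<xi>)) \<le> norm (ip y (e \<xi>))" using le that by auto
      then show "(norm (a \<xi> *\<^sub>R ip x (e \<xi>)))\<^sup>2 \<le> (norm (ip y (e \<xi>)))\<^sup>2" by (rule power_mono) simp
    qed
    then show ?thesis using bessel[OF that, of y] by (rule order_trans)
  qed
  then show d: "x \<in> diag_domain scl ip I e a" by (rule diag_domainI)
  have "(\<Sum>\<xi>\<in>F. (norm (ip (diag_op scl ip I e a x) (e \<xi>)))\<^sup>2) \<le> (norm y)\<^sup>2" if F: "finite F" "F \<subseteq> I" for F
  proof -
    have "(\<Sum>\<xi>\<in>F. (norm (ip (diag_op scl ip I e a x) (e \<xi>)))\<^sup>2) = (\<Sum>\<xi>\<in>F. (norm (a \<xi> *\<^sub>R ip x (e \<xi>)))\<^sup>2)"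
      using F(2) by (intro sum.cong) (auto simp: coefficient_diag_op[OF d])
    then show ?thesis using B[OF F] by simp
  qed
  then have "(norm (diag_op scl ip I e a x))\<^sup>2 \<le> (norm y)\<^sup>2" by (rule norm_le_of_coefficients)
  then show "norm (diag_op scl ip I e a x) \<le> norm y" by (simp add: power2_le_iff_abs_le)
qed

end

subsection \<open>The diagonal problem\<close>

text \<open>The assumptions on \<open>L\<close> and \<open>M\<close> are what
  \<open>self_adjoint_diag\<close> provides; the multiplier \<open>mu \<xi> / lam \<xi>\<close>
  belongs to \<open>L^(-1) M\<close>.\<close>

locale diagonal_problem = hilbert_basis scl ip I e
  for scl :: "'k::{real_normed_field,euclidean_space} \<Rightarrow> 'h::{banach,second_countable_topology} \<Rightarrow> 'h"
    and ip :: "'h \<Rightarrow> 'h \<Rightarrow> 'k" and I :: "'i set" and e :: "'i \<Rightarrow> 'h" +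
  fixes lam mu :: "'i \<Rightarrow> real" and L M :: "'h \<Rightarrow> 'h" and \<alpha> T :: real and \<phi> :: 'h and f :: "real \<Rightarrow> 'h"
  assumes half: "1 / 2 < \<alpha>" and \<alpha>1: "\<alpha> < 1" and T: "0 < T"
    and lam: "\<xi> \<in> I \<Longrightarrow> 0 < lam \<xi>" and mu: "\<xi> \<in> I \<Longrightarrow> 0 < mu \<xi>"
    and L: "x \<in> diag_domain scl ip I e lam \<Longrightarrow> L x = diag_op scl ip I e lam x"
    and M: "x \<in> diag_domain scl ip I e mu \<Longrightarrow> M x = diag_op scl ip I e mu x"
    and \<phi>L: "\<phi> \<in> diag_domain scl ip I e lam" and \<phi>M: "\<phi> \<in> diag_domain scl ip I e mu"
    and f: "f \<in> L2 T"
    and fLM: "f \<in> L2_space T (diag_domain scl ip I e (\<lambda>\<xi>. mu \<xi> / lam \<xi>)) (diag_op scl ip I e (\<lambda>\<xi>. mu \<xi> / lam \<xi>))"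
begin

abbreviation dom :: "('i \<Rightarrow> real) \<Rightarrow> 'h set" where "dom \<equiv> diag_domain scl ip I e"
abbreviation dop :: "('i \<Rightarrow> real) \<Rightarrow> 'h \<Rightarrow> 'h" where "dop \<equiv> diag_op scl ip I e"

definition rate :: "'i \<Rightarrow> real" where "rate \<xi> = mu \<xi> / (1 + lam \<xi>)"

abbreviation R :: "'i \<Rightarrow> real \<Rightarrow> real" where "R \<xi> \<equiv> fractional_relaxation.resolvent \<alpha> (rate \<xi>)"

definition forced :: "'i \<Rightarrow> real \<Rightarrow> 'k"
  where "forced \<xi> t = (LINT s:{0..t}|lebesgue. R \<xi> (t - s) *\<^sub>R ip (f s) (e \<xi>))"

definition u_coeff :: "'i \<Rightarrow> real \<Rightarrow> 'k"
  where "u_coeff \<xi> t = mittag_leffler \<alpha> 1 (- rate \<xi> * t powr \<alpha>) *\<^sub>R ip \<phi> (e \<xi>) + (1 / (1 + lam \<xi>)) *\<^sub>R forced \<xi> t"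

definition u :: "real \<Rightarrow> 'h"
  where "u t = (\<Sum>\<^sub>\<infinity>\<xi>\<in>I. scl (u_coeff \<xi> t) (e \<xi>))"

section \<open>Coefficient bounds and convergence of the series\<close>

lemma relaxation: "\<xi> \<in> I \<Longrightarrow> fractional_relaxation \<alpha> (rate \<xi>) T"
  using half \<alpha>1 T lam[of \<xi>] mu[of \<xi>] by unfold_locales (auto simp: rate_def)

lemma relaxed_bounds:
  assumes "\<xi> \<in> I"
  shows "\<bar>mittag_leffler \<alpha> 1 (- rate \<xi> * t powr \<alpha>)\<bar> \<le> 1"
  using mittag_leffler_1_bounds[of \<alpha> "rate \<xi> * t powr \<alpha>"] half \<alpha>1 lam[OF assms] mu[OF assms]
  by (simp add: rate_def)

text \<open>\<open>b\<close> is the multiplier taking \<open>f\<close> to \<open>h\<close>. The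
  Cauchy-Schwarz constant is the same for all coefficients, so summation leaves only Bessel's
  inequality for \<open>h\<close>, integrated in time.\<close>

lemma forced_bound:
  assumes h: "h \<in> L2 T" and b: "AE t in lebesgue_on {0..T}. \<forall>\<xi>\<in>I. ip (h t) (e \<xi>) = b \<xi> *\<^sub>R ip (f t) (e \<xi>)"
    and t: "t \<in> {0..T}" and F: "finite F" "F \<subseteq> I"
  shows "(\<Sum>\<xi>\<in>F. (norm (b \<xi> *\<^sub>R forced \<xi> t))\<^sup>2) \<le> kernel_square \<alpha> T * (LINT s|lebesgue_on {0..T}. (norm (h s))\<^sup>2)"
proof -
  have "(norm (b \<xi> *\<^sub>R forced \<xi> t))\<^sup>2 \<le> kernel_square \<alpha> T * (LINT s|lebesgue_on {0..T}. (norm (ip (h s) (e \<xi>)))\<^sup>2)"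
    if "\<xi> \<in> F" for \<xi>
  proof -
    have \<xi>: "\<xi> \<in> I" using that F by auto
    interpret fractional_relaxation \<alpha> "rate \<xi>" T by (rule relaxation[OF \<xi>])
    note hm = L2_coefficient[OF h \<xi>] and fm = L2_coefficient[OF f \<xi>]
    have bm: "(\<lambda>s. b \<xi> *\<^sub>R ip (f s) (e \<xi>)) \<in> borel_measurable (lebesgue_on {0..T})"
      using fm by measurable
    have eq: "(LINT s|lebesgue_on {0..T}. (norm (b \<xi> *\<^sub>R ip (f s) (e \<xi>)))\<^sup>2) = (LINT s|lebesgue_on {0..T}. (norm (ip (h s) (e \<xi>)))\<^sup>2)"
    proof (rule integral_cong_AE)
      show "AE s in lebesgue_on {0..T}. (norm (b \<xi> *\<^sub>R ip (f s) (e \<xi>)))\<^sup>2 = (norm (ip (h s) (e \<xi>)))\<^sup>2"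
        using b by eventually_elim (use \<xi> in simp)
    qed (use hm bm in measurable)
    have "b \<xi> *\<^sub>R forced \<xi> t = (LINT s:{0..t}|lebesgue. b \<xi> *\<^sub>R resolvent (t - s) *\<^sub>R ip (f s) (e \<xi>))"
      unfolding forced_def by (rule set_integral_scaleR[symmetric])
    also have "\<dots> = (LINT s:{0..t}|lebesgue. resolvent (t - s) *\<^sub>R b \<xi> *\<^sub>R ip (f s) (e \<xi>))"
      by (simp add: mult.commute)
    finally have "(norm (b \<xi> *\<^sub>R forced \<xi> t))\<^sup>2 \<le> kernel_square \<alpha> T * (LINT s|lebesgue_on {0..T}. (norm (b \<xi> *\<^sub>R ip (f s) (e \<xi>)))\<^sup>2)"
      using resolvent_integral_bound[OF half bm _ t] fm(2) by (simp add: power_mult_distrib)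
    then show ?thesis by (simp only: eq)
  qed
  then have "(\<Sum>\<xi>\<in>F. (norm (b \<xi> *\<^sub>R forced \<xi> t))\<^sup>2)
      \<le> (\<Sum>\<xi>\<in>F. kernel_square \<alpha> T * (LINT s|lebesgue_on {0..T}. (norm (ip (h s) (e \<xi>)))\<^sup>2))"
    by (rule sum_mono)
  also have "\<dots> \<le> kernel_square \<alpha> T * (LINT s|lebesgue_on {0..T}. (norm (h s))\<^sup>2)"
    unfolding sum_distrib_left[symmetric]
    by (intro mult_left_mono L2_bessel h F kernel_square_nonneg)
  finally show ?thesis .
qed

lemma forced_bound_f:
  assumes "t \<in> {0..T}" "finite F" "F \<subseteq> I"
  shows "(\<Sum>\<xi>\<in>F. (norm (forced \<xi> t))\<^sup>2) \<le> kernel_square \<alpha> T * (LINT s|lebesgue_on {0..T}. (norm (f s))\<^sup>2)"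
  using forced_bound[OF f _ assms, of "\<lambda>_. 1"] by simp

lemma forced_bound_LM:
  assumes "t \<in> {0..T}" "finite F" "F \<subseteq> I"
  shows "(\<Sum>\<xi>\<in>F. (norm ((mu \<xi> / lam \<xi>) *\<^sub>R forced \<xi> t))\<^sup>2)
    \<le> kernel_square \<alpha> T * (LINT s|lebesgue_on {0..T}. (norm (dop (\<lambda>\<xi>. mu \<xi> / lam \<xi>) (f s)))\<^sup>2)"
proof (rule forced_bound[OF _ _ assms])
  show "(\<lambda>s. dop (\<lambda>\<xi>. mu \<xi> / lam \<xi>) (f s)) \<in> L2 T" using fLM by (simp add: L2_space_def)
  have "AE t in lebesgue_on {0..T}. f t \<in> dom (\<lambda>\<xi>. mu \<xi> / lam \<xi>)" using fLM by (simp add: L2_space_def)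
  then show "AE t in lebesgue_on {0..T}. \<forall>\<xi>\<in>I. ip (dop (\<lambda>\<xi>. mu \<xi> / lam \<xi>) (f t)) (e \<xi>) = (mu \<xi> / lam \<xi>) *\<^sub>R ip (f t) (e \<xi>)"
    by eventually_elim (simp add: coefficient_diag_op)
qed

text \<open>The initial value is multiplied by a Mittag-Leffler factor of modulus at most
  \<open>1\<close>, so \<phi> must carry the full weight \<open>a\<close>; the forcing comes with
  \<open>1 / (1 + lam \<xi>)\<close>, so it need only carry \<open>b\<close>. The pairs used for
  \<open>(a, b)\<close> are \<open>(1, 1)\<close>, \<open>(lam, 1)\<close> and
  \<open>(mu, mu / lam)\<close>.\<close>

lemma u_coeff_weighted_bound:
  assumes a: "\<And>\<xi>. \<xi> \<in> I \<Longrightarrow> 0 \<le> a \<xi> \<and> a \<xi> / (1 + lam \<xi>) \<le> b \<xi>" and dom: "\<phi> \<in> dom a"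
    and N: "\<And>F. finite F \<Longrightarrow> F \<subseteq> I \<Longrightarrow> (\<Sum>\<xi>\<in>F. (norm (b \<xi> *\<^sub>R forced \<xi> t))\<^sup>2) \<le> N"
    and F: "finite F" "F \<subseteq> I"
  shows "(\<Sum>\<xi>\<in>F. (norm (a \<xi> *\<^sub>R u_coeff \<xi> t))\<^sup>2) \<le> 2 * (norm (dop a \<phi>))\<^sup>2 + 2 * N"
proof -
  have "(norm (a \<xi> *\<^sub>R u_coeff \<xi> t))\<^sup>2 \<le> 2 * (norm (ip (dop a \<phi>) (e \<xi>)))\<^sup>2 + 2 * (norm (b \<xi> *\<^sub>R forced \<xi> t))\<^sup>2" if "\<xi> \<in> F" for \<xi>
  proof -
    have \<xi>: "\<xi> \<in> I" using that F by auto
    define E where "E = mittag_leffler \<alpha> 1 (- rate \<xi> * t powr \<alpha>)"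
    have E: "\<bar>E\<bar> \<le> 1" unfolding E_def by (rule relaxed_bounds[OF \<xi>])
    have "norm (a \<xi> *\<^sub>R u_coeff \<xi> t) \<le> norm (E *\<^sub>R ip (dop a \<phi>) (e \<xi>)) + norm ((a \<xi> / (1 + lam \<xi>)) *\<^sub>R forced \<xi> t)"
      using norm_triangle_ineq[of "E *\<^sub>R ip (dop a \<phi>) (e \<xi>)" "(a \<xi> / (1 + lam \<xi>)) *\<^sub>R forced \<xi> t"]
      by (simp only: coefficient_diag_op[OF dom \<xi>]) (simp add: u_coeff_def E_def scaleR_add_right mult.commute)
    also have "\<dots> \<le> norm (ip (dop a \<phi>) (e \<xi>)) + norm (b \<xi> *\<^sub>R forced \<xi> t)"
    proof (rule add_mono)
      have "\<bar>a \<xi> / (1 + lam \<xi>)\<bar> \<le> \<bar>b \<xi>\<bar>" using a[OF \<xi>] lam[OF \<xi>] by auto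
      then show "norm ((a \<xi> / (1 + lam \<xi>)) *\<^sub>R forced \<xi> t) \<le> norm (b \<xi> *\<^sub>R forced \<xi> t)"
        unfolding norm_scaleR by (rule mult_right_mono) simp
    qed (use E in \<open>auto intro: mult_left_le_one_le\<close>)
    finally have "(norm (a \<xi> *\<^sub>R u_coeff \<xi> t))\<^sup>2 \<le> (norm (ip (dop a \<phi>) (e \<xi>)) + norm (b \<xi> *\<^sub>R forced \<xi> t))\<^sup>2"
      by (rule power_mono) simp
    then show ?thesis using square_add_le by (rule order_trans)
  qed
  then have "(\<Sum>\<xi>\<in>F. (norm (a \<xi> *\<^sub>R u_coeff \<xi> t))\<^sup>2)
      \<le> (\<Sum>\<xi>\<in>F. 2 * (norm (ip (dop a \<phi>) (e \<xi>)))\<^sup>2 + 2 * (norm (b \<xi> *\<^sub>R forced \<xi> t))\<^sup>2)"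
    by (rule sum_mono)
  also have "\<dots> = 2 * (\<Sum>\<xi>\<in>F. (norm (ip (dop a \<phi>) (e \<xi>)))\<^sup>2) + 2 * (\<Sum>\<xi>\<in>F. (norm (b \<xi> *\<^sub>R forced \<xi> t))\<^sup>2)"
    by (simp add: sum.distrib sum_distrib_left)
  also have "\<dots> \<le> 2 * (norm (dop a \<phi>))\<^sup>2 + 2 * N"
    using bessel[OF F] N[OF F] by (intro add_mono mult_left_mono) auto
  finally show ?thesis .
qed

lemma in_dom_1: "x \<in> dom (\<lambda>_. 1)"
  using expansion[of x] by (auto simp: diag_domain_def summable_on_def)

lemma dop_1: "dop (\<lambda>_. 1) x = x"
  using expansion[of x] by (simp add: diag_op_def infsumI)

definition "forcing_energy = kernel_square \<alpha> T * (LINT s|lebesgue_on {0..T}. (norm (f s))\<^sup>2)"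
definition "weighted_forcing_energy = kernel_square \<alpha> T * (LINT s|lebesgue_on {0..T}. (norm (dop (\<lambda>\<xi>. mu \<xi> / lam \<xi>) (f s)))\<^sup>2)"

lemma u_coeff_bounds:
  assumes t: "t \<in> {0..T}" and F: "finite F" "F \<subseteq> I"
  shows "(\<Sum>\<xi>\<in>F. (norm (u_coeff \<xi> t))\<^sup>2) \<le> 2 * (norm \<phi>)\<^sup>2 + 2 * forcing_energy"
    and "(\<Sum>\<xi>\<in>F. (norm (lam \<xi> *\<^sub>R u_coeff \<xi> t))\<^sup>2) \<le> 2 * (norm (dop lam \<phi>))\<^sup>2 + 2 * forcing_energy"
    and "(\<Sum>\<xi>\<in>F. (norm (mu \<xi> *\<^sub>R u_coeff \<xi> t))\<^sup>2) \<le> 2 * (norm (dop mu \<phi>))\<^sup>2 + 2 * weighted_forcing_energy"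
proof -
  show "(\<Sum>\<xi>\<in>F. (norm (u_coeff \<xi> t))\<^sup>2) \<le> 2 * (norm \<phi>)\<^sup>2 + 2 * forcing_energy"
  proof -
    have "0 \<le> (1::real) \<and> 1 / (1 + lam \<xi>) \<le> 1" if "\<xi> \<in> I" for \<xi>
      using lam[OF that] by simp
    then show ?thesis
      using u_coeff_weighted_bound[of "\<lambda>_. 1" "\<lambda>_. 1" t forcing_energy, OF _ in_dom_1 _ F] forced_bound_f[OF t]
      by (simp add: dop_1 forcing_energy_def)
  qed
  show "(\<Sum>\<xi>\<in>F. (norm (lam \<xi> *\<^sub>R u_coeff \<xi> t))\<^sup>2) \<le> 2 * (norm (dop lam \<phi>))\<^sup>2 + 2 * forcing_energy"
  proof (rule u_coeff_weighted_bound[of lam "\<lambda>_. 1", OF _ \<phi>L _ F])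
    show "0 \<le> lam \<xi> \<and> lam \<xi> / (1 + lam \<xi>) \<le> 1" if "\<xi> \<in> I" for \<xi>
      using lam[OF that] by simp
  qed (use forced_bound_f[OF t] in \<open>simp add: forcing_energy_def\<close>)
  show "(\<Sum>\<xi>\<in>F. (norm (mu \<xi> *\<^sub>R u_coeff \<xi> t))\<^sup>2) \<le> 2 * (norm (dop mu \<phi>))\<^sup>2 + 2 * weighted_forcing_energy"
  proof (rule u_coeff_weighted_bound[of mu "\<lambda>\<xi>. mu \<xi> / lam \<xi>", OF _ \<phi>M _ F])
    show "0 \<le> mu \<xi> \<and> mu \<xi> / (1 + lam \<xi>) \<le> mu \<xi> / lam \<xi>" if "\<xi> \<in> I" for \<xi>
      using lam[OF that] mu[OF that] by (simp add: frac_le)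
  qed (use forced_bound_LM[OF t] in \<open>simp only: weighted_forcing_energy_def\<close>)
qed

lemma u_coefficient: "t \<in> {0..T} \<Longrightarrow> \<xi> \<in> I \<Longrightarrow> ip (u t) (e \<xi>) = u_coeff \<xi> t"
  unfolding u_def using u_coeff_bounds(1) by (intro coefficient_infsum)

lemma u_series:
  assumes t: "t \<in> {0..T}"
  shows "(\<lambda>\<xi>. scl (mittag_leffler \<alpha> 1 (- rate \<xi> * t powr \<alpha>) *\<^sub>R ip \<phi> (e \<xi>)) (e \<xi>)) summable_on I" (is "?h summable_on I")
    and "(\<lambda>\<xi>. scl ((1 / (1 + lam \<xi>)) *\<^sub>R forced \<xi> t) (e \<xi>)) summable_on I" (is "?g summable_on I")
    and "u t = (\<Sum>\<^sub>\<infinity>\<xi>\<in>I. scl (mittag_leffler \<alpha> 1 (- rate \<xi> * t powr \<alpha>) *\<^sub>R ip \<phi> (e \<xi>)) (e \<xi>))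
        + (\<Sum>\<^sub>\<infinity>\<xi>\<in>I. scl ((1 / (1 + lam \<xi>)) *\<^sub>R forced \<xi> t) (e \<xi>))"
proof -
  have le: "(norm (c *\<^sub>R x))\<^sup>2 \<le> (norm x)\<^sup>2" if "\<bar>c\<bar> \<le> 1" for c and x :: 'k
    using that by (intro power_mono) (auto intro: mult_left_le_one_le)
  show h: "?h summable_on I"
  proof (rule riesz_fischer)
    fix F assume F: "finite F" "F \<subseteq> I"
    have "(\<Sum>\<xi>\<in>F. (norm (mittag_leffler \<alpha> 1 (- rate \<xi> * t powr \<alpha>) *\<^sub>R ip \<phi> (e \<xi>)))\<^sup>2) \<le> (\<Sum>\<xi>\<in>F. (norm (ip \<phi> (e \<xi>)))\<^sup>2)"
      using F by (intro sum_mono le relaxed_bounds) auto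
    then show "(\<Sum>\<xi>\<in>F. (norm (mittag_leffler \<alpha> 1 (- rate \<xi> * t powr \<alpha>) *\<^sub>R ip \<phi> (e \<xi>)))\<^sup>2) \<le> (norm \<phi>)\<^sup>2"
      using bessel[OF F, of \<phi>] by simp
  qed
  show g: "?g summable_on I"
  proof (rule riesz_fischer)
    fix F assume F: "finite F" "F \<subseteq> I"
    have "\<bar>1 / (1 + lam \<xi>)\<bar> \<le> 1" if "\<xi> \<in> F" for \<xi>
      using lam[of \<xi>] that F by auto
    then have "(\<Sum>\<xi>\<in>F. (norm ((1 / (1 + lam \<xi>)) *\<^sub>R forced \<xi> t))\<^sup>2) \<le> (\<Sum>\<xi>\<in>F. (norm (forced \<xi> t))\<^sup>2)"
      by (intro sum_mono le)
    then show "(\<Sum>\<xi>\<in>F. (norm ((1 / (1 + lam \<xi>)) *\<^sub>R forced \<xi> t))\<^sup>2) \<le> forcing_energy"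
      using forced_bound_f[OF t F] by (simp add: forcing_energy_def)
  qed
  show "u t = infsum ?h I + infsum ?g I"
    unfolding infsum_add[OF h g, symmetric] by (simp add: u_def u_coeff_def scale_left_distrib)
qed


section \<open>The scalar equations of the coefficients\<close>

lemma f_coefficient_integrable: "\<xi> \<in> I \<Longrightarrow> integrable (lebesgue_on {0..T}) (\<lambda>s. ip (f s) (e \<xi>))"
  using L2_integrable[OF f] by (rule integrable_bounded_linear[OF bounded_linear_ip])

lemma u_coeff_measurable:
  assumes \<xi>: "\<xi> \<in> I"
  shows "u_coeff \<xi> \<in> borel_measurable (lebesgue_on {0..T})"
proof -
  interpret fractional_relaxation \<alpha> "rate \<xi>" T by (rule relaxation[OF \<xi>])
  have "forced \<xi> \<in> borel_measurable (lebesgue_on {0..T})"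
    by (rule resolvent_solves(1)[OF f_coefficient_integrable[OF \<xi>]]) (simp add: forced_def)
  moreover have "(\<lambda>t. mittag_leffler \<alpha> 1 (- rate \<xi> * t powr \<alpha>)) \<in> borel_measurable borel"
    by (rule measurable_compose[OF _ borel_measurable_mittag_leffler]) (use \<alpha> in auto)
  then have "(\<lambda>t. mittag_leffler \<alpha> 1 (- rate \<xi> * t powr \<alpha>)) \<in> borel_measurable (lebesgue_on {0..T})"
    by (rule borel_measurable_lebesgue_onI)
  ultimately show ?thesis unfolding u_coeff_def[abs_def] by measurable
qed

text \<open>Right-hand side of the relaxation equation for the coefficient minus its initial value,
  the quantity that enters the weak Caputo derivative.\<close>

definition source :: "'i \<Rightarrow> real \<Rightarrow> 'k"
  where "source \<xi> s = (1 / (1 + lam \<xi>)) *\<^sub>R ip (f s) (e \<xi>) - rate \<xi> *\<^sub>R ip \<phi> (e \<xi>)"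

lemma source_integrable:
  assumes \<xi>: "\<xi> \<in> I"
  shows "integrable (lebesgue_on {0..T}) (source \<xi>)"
  unfolding source_def[abs_def]
  by (intro Bochner_Integration.integrable_diff integrable_scaleR_right f_coefficient_integrable \<xi>
      finite_measure.integrable_const finite_measure_lebesgue_on) simp

text \<open>As \<open>E\<^bsub>\<alpha>,1\<^esub>(-k t\<^sup>\<alpha>) - 1 = -k (R * 1)(t)\<close>, the initial value can be treated as a constant source.\<close>

lemma u_coeff_eq_resolvent:
  assumes \<xi>: "\<xi> \<in> I" and t: "t \<in> {0..T}"
  shows "u_coeff \<xi> t - ip \<phi> (e \<xi>) = (LINT s:{0..t}|lebesgue. R \<xi> (t - s) *\<^sub>R source \<xi> s)"
proof -
  interpret fractional_relaxation \<alpha> "rate \<xi>" T by (rule relaxation[OF \<xi>])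
  define J where "J = (LINT s:{0..t}|lebesgue. resolvent (t - s))"
  have i1: "integrable lebesgue (\<lambda>s. indicator {0..t} s *\<^sub>R resolvent (t - s) *\<^sub>R ip (f s) (e \<xi>))"
    by (intro integrable_resolvent_integrand half L2_coefficient f \<xi> t)
  have "integrable lebesgue (\<lambda>s. indicator {0..t} s *\<^sub>R resolvent (t - s) *\<^sub>R (1::real))"
    by (intro integrable_resolvent_integrand half t) (simp_all add: integrable_lebesgue_on_const)
  then have i2: "integrable lebesgue (\<lambda>s. indicator {0..t} s *\<^sub>R resolvent (t - s))" by simp
  have J: "(LINT s|lebesgue. (indicator {0..t} s *\<^sub>R resolvent (t - s)) *\<^sub>R c) = J *\<^sub>R c" for c :: 'k
    unfolding J_def set_lebesgue_integral_def by (rule integral_scaleR_left) (rule i2)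
  have "(LINT s:{0..t}|lebesgue. resolvent (t - s) *\<^sub>R source \<xi> s)
     = (LINT s|lebesgue. (1 / (1 + lam \<xi>)) *\<^sub>R (indicator {0..t} s *\<^sub>R resolvent (t - s) *\<^sub>R ip (f s) (e \<xi>))
          - (indicator {0..t} s *\<^sub>R resolvent (t - s)) *\<^sub>R (rate \<xi> *\<^sub>R ip \<phi> (e \<xi>)))"
    unfolding set_lebesgue_integral_def
    by (intro Bochner_Integration.integral_cong refl) (simp add: source_def scaleR_diff_right mult_ac)
  also have "\<dots> = (1 / (1 + lam \<xi>)) *\<^sub>R (LINT s|lebesgue. indicator {0..t} s *\<^sub>R resolvent (t - s) *\<^sub>R ip (f s) (e \<xi>))
      - J *\<^sub>R (rate \<xi> *\<^sub>R ip \<phi> (e \<xi>))"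
    unfolding J[symmetric] integral_scaleR_right[symmetric]
    by (intro Bochner_Integration.integral_diff integrable_scaleR_right integrable_scaleR_left i1 i2)
  also have "\<dots> = (1 / (1 + lam \<xi>)) *\<^sub>R forced \<xi> t - (rate \<xi> * J) *\<^sub>R ip \<phi> (e \<xi>)"
    by (simp add: forced_def set_lebesgue_integral_def mult.commute)
  also have "\<dots> = u_coeff \<xi> t - ip \<phi> (e \<xi>)"
    unfolding u_coeff_def set_integral_resolvent[OF t] J_def[symmetric] by (simp add: scaleR_diff_left)
  finally show ?thesis by simp
qed

text \<open>Undoes the shift by the initial value: the damping of the constant part cancels the
  constant in \<open>source\<close>, and \<open>rate \<xi>\<close> is \<open>mu \<xi>\<close> with
  \<open>1 / (1 + lam \<xi>)\<close> factored out.\<close>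

lemma source_diff:
  assumes "\<xi> \<in> I"
  shows "source \<xi> s - rate \<xi> *\<^sub>R (x - ip \<phi> (e \<xi>)) = (1 / (1 + lam \<xi>)) *\<^sub>R (ip (f s) (e \<xi>) - mu \<xi> *\<^sub>R x)"
  by (simp add: source_def rate_def scaleR_diff_right)

lemma u_coeff_equation:
  assumes \<xi>: "\<xi> \<in> I"
  shows "AE t in lebesgue_on {0..T}. rl_integral (1 - \<alpha>) (\<lambda>s. u_coeff \<xi> s - ip \<phi> (e \<xi>)) t
      = (LINT s:{0..t}|lebesgue. (1 / (1 + lam \<xi>)) *\<^sub>R (ip (f s) (e \<xi>) - mu \<xi> *\<^sub>R u_coeff \<xi> s))"
proof -
  interpret fractional_relaxation \<alpha> "rate \<xi>" T by (rule relaxation[OF \<xi>])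
  show ?thesis
    using resolvent_solves(2)[OF source_integrable[OF \<xi>] u_coeff_eq_resolvent[OF \<xi>]]
    by (simp only: source_diff[OF \<xi>])
qed

lemma u_coeff_unique:
  assumes \<xi>: "\<xi> \<in> I" and x: "integrable (lebesgue_on {0..T}) x"
    and eq: "AE t in lebesgue_on {0..T}. rl_integral (1 - \<alpha>) (\<lambda>s. x s - ip \<phi> (e \<xi>)) t
      = (LINT s:{0..t}|lebesgue. (1 / (1 + lam \<xi>)) *\<^sub>R (ip (f s) (e \<xi>) - mu \<xi> *\<^sub>R x s))"
  shows "AE t in lebesgue_on {0..T}. x t = u_coeff \<xi> t"
proof -
  interpret fractional_relaxation \<alpha> "rate \<xi>" T by (rule relaxation[OF \<xi>])
  have "integrable (lebesgue_on {0..T}) (\<lambda>s. x s - ip \<phi> (e \<xi>))"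
    by (intro Bochner_Integration.integrable_diff x finite_measure.integrable_const finite_measure_lebesgue_on) simp
  then have "AE t in lebesgue_on {0..T}. x t - ip \<phi> (e \<xi>) = (LINT s:{0..t}|lebesgue. resolvent (t - s) *\<^sub>R source \<xi> s)"
    by (rule resolvent_unique[OF source_integrable[OF \<xi>]]) (use eq in \<open>simp only: source_diff[OF \<xi>]\<close>)
  moreover have "AE t in lebesgue_on {0..T}. t \<in> {0..T}" by (rule AE_I2) simp
  ultimately show ?thesis
    by eventually_elim (use u_coeff_eq_resolvent[OF \<xi>] in \<open>metis diff_add_cancel\<close>)
qed

lemma u_dom:
  assumes t: "t \<in> {0..T}"
  shows "u t \<in> dom lam" "u t \<in> dom mu"
    and "(norm (u t))\<^sup>2 \<le> 2 * (norm \<phi>)\<^sup>2 + 2 * forcing_energy"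
    and "(norm (dop lam (u t)))\<^sup>2 \<le> 2 * (norm (dop lam \<phi>))\<^sup>2 + 2 * forcing_energy"
    and "(norm (dop mu (u t)))\<^sup>2 \<le> 2 * (norm (dop mu \<phi>))\<^sup>2 + 2 * weighted_forcing_energy"
proof -
  have c: "(\<Sum>\<xi>\<in>F. (norm (a \<xi> *\<^sub>R ip (u t) (e \<xi>)))\<^sup>2) = (\<Sum>\<xi>\<in>F. (norm (a \<xi> *\<^sub>R u_coeff \<xi> t))\<^sup>2)"
    if "finite F" "F \<subseteq> I" for F and a :: "'i \<Rightarrow> real"
    using that u_coefficient[OF t] by (intro sum.cong) auto
  show 1: "u t \<in> dom lam" using u_coeff_bounds(2)[OF t] by (intro diag_domainI) (simp only: c)
  show 2: "u t \<in> dom mu" using u_coeff_bounds(3)[OF t] by (intro diag_domainI) (simp only: c)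
  have d: "(\<Sum>\<xi>\<in>F. (norm (ip (dop a (u t)) (e \<xi>)))\<^sup>2) = (\<Sum>\<xi>\<in>F. (norm (a \<xi> *\<^sub>R u_coeff \<xi> t))\<^sup>2)"
    if "u t \<in> dom a" "finite F" "F \<subseteq> I" for F a
    using that u_coefficient[OF t] coefficient_diag_op[OF that(1)] by (intro sum.cong) auto
  show "(norm (u t))\<^sup>2 \<le> 2 * (norm \<phi>)\<^sup>2 + 2 * forcing_energy"
    using u_coeff_bounds(1)[OF t] c[of _ "\<lambda>_. 1"] by (intro norm_le_of_coefficients) simp
  show "(norm (dop lam (u t)))\<^sup>2 \<le> 2 * (norm (dop lam \<phi>))\<^sup>2 + 2 * forcing_energy"
    using u_coeff_bounds(2)[OF t] by (intro norm_le_of_coefficients) (simp only: d[OF 1])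
  show "(norm (dop mu (u t)))\<^sup>2 \<le> 2 * (norm (dop mu \<phi>))\<^sup>2 + 2 * weighted_forcing_energy"
    using u_coeff_bounds(3)[OF t] by (intro norm_le_of_coefficients) (simp only: d[OF 2])
qed

lemma measurable_of_coefficients_on:
  assumes "\<And>\<xi>. \<xi> \<in> I \<Longrightarrow> c \<xi> \<in> borel_measurable (lebesgue_on {0..T})"
    and "\<And>\<xi> t. \<xi> \<in> I \<Longrightarrow> t \<in> {0..T} \<Longrightarrow> ip (g t) (e \<xi>) = c \<xi> t"
  shows "g \<in> borel_measurable (lebesgue_on {0..T})"
proof (rule borel_measurable_coefficientwise)
  fix \<xi> assume "\<xi> \<in> I"
  then show "(\<lambda>t. ip (g t) (e \<xi>)) \<in> borel_measurable (lebesgue_on {0..T})"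
    using assms by (subst measurable_cong[where g = "c \<xi>"]) auto
qed

lemma u_L2: "u \<in> L2 T" "(\<lambda>t. dop lam (u t)) \<in> L2 T" "(\<lambda>t. dop mu (u t)) \<in> L2 T"
proof -
  have m: "(\<lambda>t. dop a (u t)) \<in> borel_measurable (lebesgue_on {0..T})" if "\<And>t. t \<in> {0..T} \<Longrightarrow> u t \<in> dom a" for a
  proof (rule measurable_of_coefficients_on)
    show "(\<lambda>t. a \<xi> *\<^sub>R u_coeff \<xi> t) \<in> borel_measurable (lebesgue_on {0..T})" if "\<xi> \<in> I" for \<xi>
      using u_coeff_measurable[OF that] by measurable
    show "ip (dop a (u t)) (e \<xi>) = a \<xi> *\<^sub>R u_coeff \<xi> t" if "\<xi> \<in> I" "t \<in> {0..T}" for \<xi> t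
      using that \<open>\<And>t. t \<in> {0..T} \<Longrightarrow> u t \<in> dom a\<close> by (simp add: coefficient_diag_op u_coefficient)
  qed
  show "u \<in> L2 T" using m[of "\<lambda>_. 1"] u_dom(3) in_dom_1 by (intro L2_bounded) (auto simp: dop_1)
  show "(\<lambda>t. dop lam (u t)) \<in> L2 T" using m[OF u_dom(1)] u_dom(4) by (intro L2_bounded) auto
  show "(\<lambda>t. dop mu (u t)) \<in> L2 T" using m[OF u_dom(2)] u_dom(5) by (intro L2_bounded) auto
qed

section \<open>Existence and uniqueness for the full problem\<close>

lemma u_initial: "u 0 = \<phi>"
proof (rule basis_eqI)
  fix \<xi> assume \<xi>: "\<xi> \<in> I"
  have "ip (u 0) (e \<xi>) - ip \<phi> (e \<xi>) = (LINT s:{0..0}|lebesgue. R \<xi> (0 - s) *\<^sub>R source \<xi> s)"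
    using T u_coefficient[OF _ \<xi>, of 0] u_coeff_eq_resolvent[OF \<xi>, of 0] by simp
  also have "\<dots> = 0"
  proof -
    interpret fractional_relaxation \<alpha> "rate \<xi>" T by (rule relaxation[OF \<xi>])
    have "(\<lambda>s. indicator {0..0} s *\<^sub>R R \<xi> (0 - s) *\<^sub>R source \<xi> s) = (\<lambda>s. 0)"
      by (auto simp: fun_eq_iff resolvent_def split: split_indicator)
    then show ?thesis unfolding set_lebesgue_integral_def by simp
  qed
  finally show "ip (u 0) (e \<xi>) = ip \<phi> (e \<xi>)" by simp
qed

definition is_solution :: "(real \<Rightarrow> 'h) \<Rightarrow> bool"
  where "is_solution v \<longleftrightarrow> solves_problem \<alpha> T L M \<phi> f v \<and> v \<in> L2_space T (dom mu) (dop mu) \<and>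
    v \<in> frac_sobolev \<alpha> T (dom lam) (dop lam)"

text \<open>\<open>w = f - M u\<close> satisfies the equation by construction, so the task is to
  recognise it as the Caputo derivative of \<open>u + L u\<close>; that of \<open>u\<close> is
  \<open>h = (1 + L)^(-1) w\<close>. Since \<open>lam \<xi> / (1 + lam \<xi>) <= 1\<close>, the norm
  of \<open>L h\<close> is at most that of \<open>w\<close>, which puts \<open>u\<close> into the
  fractional Sobolev space.\<close>

lemma u_is_solution: "is_solution u"
proof -
  define w where "w t = f t - dop mu (u t)" for t
  define h where "h t = dop (\<lambda>\<xi>. 1 / (1 + lam \<xi>)) (w t)" for t
  have T0: "0 \<in> {0..T}" using T by simp
  have w: "w \<in> L2 T" unfolding w_def[abs_def] by (intro L2_diff f u_L2)
  have w_coeff: "ip (w t) (e \<xi>) = ip (f t) (e \<xi>) - mu \<xi> *\<^sub>R u_coeff \<xi> t" if "\<xi> \<in> I" "t \<in> {0..T}" for \<xi> t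
    using that u_dom(2) by (simp add: w_def ip_diff_left coefficient_diag_op u_coefficient)
  have one: "norm ((1 / (1 + lam \<xi>)) *\<^sub>R ip x (e \<xi>)) \<le> norm (ip x (e \<xi>))"
      "norm (lam \<xi> *\<^sub>R (1 / (1 + lam \<xi>)) *\<^sub>R ip x (e \<xi>)) \<le> norm (ip x (e \<xi>))" if "\<xi> \<in> I" for \<xi> x
    using lam[OF that] by (auto simp: field_simps mult_left_le_one_le)
  have hd: "w t \<in> dom (\<lambda>\<xi>. 1 / (1 + lam \<xi>))" for t
    using diag_domain_bounded(1)[OF one(1)] .
  have hn: "norm (h t) \<le> norm (w t)" for t
    unfolding h_def using diag_domain_bounded(2)[OF one(1)] .
  have h_coeff: "ip (h t) (e \<xi>) = (1 / (1 + lam \<xi>)) *\<^sub>R ip (w t) (e \<xi>)" if "\<xi> \<in> I" for \<xi> t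
    unfolding h_def by (rule coefficient_diag_op[OF hd that])
  have hle: "norm (lam \<xi> *\<^sub>R ip (h t) (e \<xi>)) \<le> norm (ip (w t) (e \<xi>))" if "\<xi> \<in> I" for \<xi> t
    unfolding h_coeff[OF that] by (rule one(2)[OF that])
  have hL: "h t \<in> dom lam" "norm (dop lam (h t)) \<le> norm (w t)" for t
    using diag_domain_bounded[of lam "h t" "w t"] hle by blast+
  have wm: "(\<lambda>t. ip (w t) (e \<xi>)) \<in> borel_measurable (lebesgue_on {0..T})" if "\<xi> \<in> I" for \<xi>
    by (rule L2_coefficient(1)[OF w that])
  have "h \<in> borel_measurable (lebesgue_on {0..T})"
    by (rule measurable_of_coefficients_on[OF _ h_coeff]) (use wm in measurable)
  then have h: "h \<in> L2 T"
    by (rule L2_mono[where N = "\<lambda>t. (norm (w t))\<^sup>2"]) (use w hn in \<open>auto simp: L2_def intro: power_mono\<close>)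
  have "(\<lambda>t. dop lam (h t)) \<in> borel_measurable (lebesgue_on {0..T})"
  proof (rule measurable_of_coefficients_on)
    show "(\<lambda>t. lam \<xi> *\<^sub>R (1 / (1 + lam \<xi>)) *\<^sub>R ip (w t) (e \<xi>)) \<in> borel_measurable (lebesgue_on {0..T})" if "\<xi> \<in> I" for \<xi>
      using wm[OF that] by measurable
    show "ip (dop lam (h t)) (e \<xi>) = lam \<xi> *\<^sub>R (1 / (1 + lam \<xi>)) *\<^sub>R ip (w t) (e \<xi>)" if "\<xi> \<in> I" for \<xi> t
      by (simp only: coefficient_diag_op[OF hL(1) that] h_coeff[OF that])
  qed
  then have hL2: "(\<lambda>t. dop lam (h t)) \<in> L2 T"
    by (rule L2_mono[where N = "\<lambda>t. (norm (w t))\<^sup>2"]) (use w hL(2) in \<open>auto simp: L2_def intro: power_mono\<close>)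
  \<comment> \<open>One computation serves both derivatives, since their coefficients differ by a
    factor: \<open>c = 1\<close> for \<open>u\<close> and \<open>h\<close>,
    \<open>c = 1 + lam \<xi>\<close> for \<open>u + L u\<close> and \<open>w\<close>.\<close>
  have rl: "rl_integral (1 - \<alpha>) (\<lambda>s. ip (g s) (e \<xi>) - ip (g 0) (e \<xi>)) t = (LINT s:{0..t}|lebesgue. ip (k s) (e \<xi>))"
    if \<xi>: "\<xi> \<in> I" and t: "t \<in> {0..T}"
      and eq: "rl_integral (1 - \<alpha>) (\<lambda>s. u_coeff \<xi> s - ip \<phi> (e \<xi>)) t
        = (LINT s:{0..t}|lebesgue. (1 / (1 + lam \<xi>)) *\<^sub>R (ip (f s) (e \<xi>) - mu \<xi> *\<^sub>R u_coeff \<xi> s))"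
      and g: "\<And>s. s \<in> {0..T} \<Longrightarrow> ip (g s) (e \<xi>) = c *\<^sub>R u_coeff \<xi> s"
      and k: "\<And>s. s \<in> {0..T} \<Longrightarrow> ip (k s) (e \<xi>) = c *\<^sub>R (1 / (1 + lam \<xi>)) *\<^sub>R (ip (f s) (e \<xi>) - mu \<xi> *\<^sub>R u_coeff \<xi> s)"
    for \<xi> t c g k
  proof -
    have "u_coeff \<xi> 0 = ip \<phi> (e \<xi>)" using u_coefficient[OF T0 \<xi>] by (simp add: u_initial)
    then have "rl_integral (1 - \<alpha>) (\<lambda>s. ip (g s) (e \<xi>) - ip (g 0) (e \<xi>)) t
        = rl_integral (1 - \<alpha>) (\<lambda>s. c *\<^sub>R (u_coeff \<xi> s - ip \<phi> (e \<xi>))) t"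
      using t T0 by (intro rl_integral_cong) (simp add: g scaleR_diff_right)
    also have "\<dots> = c *\<^sub>R (LINT s:{0..t}|lebesgue. (1 / (1 + lam \<xi>)) *\<^sub>R (ip (f s) (e \<xi>) - mu \<xi> *\<^sub>R u_coeff \<xi> s))"
      by (simp only: rl_integral_scaleR eq)
    also have "\<dots> = (LINT s:{0..t}|lebesgue. ip (k s) (e \<xi>))"
      unfolding set_integral_scaleR[symmetric] by (intro set_integral_cong_Icc k[symmetric]) (use t in auto)
    finally show ?thesis .
  qed
  have ae_in: "AE t in lebesgue_on {0..T}. t \<in> {0..T}" by (rule AE_I2) simp
  have cap1: "has_caputo_derivative \<alpha> T u h"
    unfolding has_caputo_derivative_coefficientwise[OF \<alpha>1]
  proof (intro conjI ballI L2_integrable u_L2 h)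
    fix \<xi> assume \<xi>: "\<xi> \<in> I"
    show "AE t in lebesgue_on {0..T}. rl_integral (1 - \<alpha>) (\<lambda>s. ip (u s) (e \<xi>) - ip (u 0) (e \<xi>)) t = (LINT s:{0..t}|lebesgue. ip (h s) (e \<xi>))"
      using u_coeff_equation[OF \<xi>] ae_in
      by eventually_elim (rule rl[OF \<xi>, where c = 1]; simp add: u_coefficient \<xi> h_coeff w_coeff)
  qed
  have uL: "L (u t) = dop lam (u t)" "M (u t) = dop mu (u t)" if "t \<in> {0..T}" for t
    using L M u_dom(1,2)[OF that] by auto
  have uLc: "ip (u t + L (u t)) (e \<xi>) = (1 + lam \<xi>) *\<^sub>R u_coeff \<xi> t" if "t \<in> {0..T}" "\<xi> \<in> I" for t \<xi>
    using that u_dom(1) by (simp add: uL ip_add_left coefficient_diag_op u_coefficient scaleR_add_left)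
  have "integrable (lebesgue_on {0..T}) (\<lambda>t. u t + dop lam (u t))"
    by (intro Bochner_Integration.integrable_add L2_integrable u_L2)
  then have int: "integrable (lebesgue_on {0..T}) (\<lambda>t. u t + L (u t))"
    by (subst Bochner_Integration.integrable_cong[OF refl, where g = "\<lambda>t. u t + dop lam (u t)"]) (simp_all add: uL)
  have cap2: "has_caputo_derivative \<alpha> T (\<lambda>t. u t + L (u t)) w"
    unfolding has_caputo_derivative_coefficientwise[OF \<alpha>1]
  proof (intro conjI ballI int L2_integrable[OF w])
    fix \<xi> assume \<xi>: "\<xi> \<in> I"
    have "1 + lam \<xi> \<noteq> 0" using lam[OF \<xi>] by simp
    then show "AE t in lebesgue_on {0..T}. rl_integral (1 - \<alpha>) (\<lambda>s. ip (u s + L (u s)) (e \<xi>) - ip (u 0 + L (u 0)) (e \<xi>)) t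
        = (LINT s:{0..t}|lebesgue. ip (w s) (e \<xi>))"
      using u_coeff_equation[OF \<xi>] ae_in
      by (intro eventually_elim2[OF u_coeff_equation[OF \<xi>] ae_in] rl[OF \<xi>, where c = "1 + lam \<xi>"])
        (simp_all add: uLc \<xi> w_coeff)
  qed
  have "solves_problem \<alpha> T L M \<phi> f u"
    unfolding solves_problem_def using cap2 u_initial
    by (intro conjI exI[of _ w] AE_I2) (auto simp: w_def uL)
  moreover have "u \<in> L2_space T (dom mu) (dop mu)" "u \<in> L2_space T (dom lam) (dop lam)"
    using u_L2 u_dom(1,2) by (auto simp: L2_space_def intro!: AE_I2)
  moreover have "h \<in> L2_space T (dom lam) (dop lam)"
    using hL2 hL(1) by (simp add: L2_space_def)
  ultimately show ?thesis
    using cap1 by (auto simp: is_solution_def frac_sobolev_def)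
qed

text \<open>Off a null set \<open>v\<close> lies in both diagonal domains, where \<open>L\<close>
  and \<open>M\<close> multiply coefficients. After division by \<open>1 + lam \<xi>\<close> each
  coefficient satisfies the scalar equation with initial value \<open>ip \<phi> (e \<xi>)\<close>,
  so \<open>u_coeff_unique\<close> applies.\<close>

lemma solution_unique:
  assumes v: "is_solution v"
  shows "AE t in lebesgue_on {0..T}. v t = u t"
proof -
  obtain w where cap: "has_caputo_derivative \<alpha> T (\<lambda>t. v t + L (v t)) w"
      and weq: "AE t in lebesgue_on {0..T}. w t + M (v t) = f t" and v0: "v 0 = \<phi>"
    using v by (auto simp: is_solution_def solves_problem_def)
  have vM: "AE t in lebesgue_on {0..T}. v t \<in> dom mu" and vL: "AE t in lebesgue_on {0..T}. v t \<in> dom lam"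
    using v by (auto simp: is_solution_def L2_space_def frac_sobolev_def)
  obtain h where "has_caputo_derivative \<alpha> T v h"
    using v by (auto simp: is_solution_def frac_sobolev_def)
  then have iv: "integrable (lebesgue_on {0..T}) v" by (simp add: has_caputo_derivative_def)
  note cap' = cap[unfolded has_caputo_derivative_coefficientwise[OF \<alpha>1]]
  have ae_in: "AE t in lebesgue_on {0..T}. t \<in> {0..T}" by (rule AE_I2) simp
  have "AE t in lebesgue_on {0..T}. ip (v t) (e \<xi>) = u_coeff \<xi> t" if \<xi>: "\<xi> \<in> I" for \<xi>
  proof (rule u_coeff_unique[OF \<xi>])
    have lam1: "1 + lam \<xi> \<noteq> 0" using lam[OF \<xi>] by simp
    show iv\<xi>: "integrable (lebesgue_on {0..T}) (\<lambda>t. ip (v t) (e \<xi>))"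
      by (rule integrable_bounded_linear[OF bounded_linear_ip iv])
    have ig: "integrable (lebesgue_on {0..T}) (\<lambda>t. ip (v t + L (v t)) (e \<xi>))"
        and iw: "integrable (lebesgue_on {0..T}) (\<lambda>t. ip (w t) (e \<xi>))"
      using cap' by (auto intro: integrable_bounded_linear[OF bounded_linear_ip])
    note [measurable] = borel_measurable_integrable[OF iv\<xi>] borel_measurable_integrable[OF ig]
      borel_measurable_integrable[OF iw] borel_measurable_integrable[OF f_coefficient_integrable[OF \<xi>]]
    \<comment> \<open>A single point, yet it enters the equation as the constant subtracted under
      the fractional integral; here the initial condition is used pointwise.\<close>
    have g0: "ip (v 0 + L (v 0)) (e \<xi>) = (1 + lam \<xi>) *\<^sub>R ip \<phi> (e \<xi>)"
      unfolding v0 L[OF \<phi>L] using coefficient_diag_op[OF \<phi>L \<xi>] by (simp add: ip_add_left scaleR_add_left)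
    have g: "AE t in lebesgue_on {0..T}. ip (v t + L (v t)) (e \<xi>) - ip (v 0 + L (v 0)) (e \<xi>)
        = (1 + lam \<xi>) *\<^sub>R (ip (v t) (e \<xi>) - ip \<phi> (e \<xi>))"
      unfolding g0 using vL
    proof eventually_elim
      case (elim t)
      then show ?case
        using coefficient_diag_op[OF elim \<xi>] by (simp add: L[OF elim] ip_add_left scaleR_add_left scaleR_diff_right)
    qed
    have k: "AE t in lebesgue_on {0..T}. ip (w t) (e \<xi>)
        = (1 + lam \<xi>) *\<^sub>R (1 / (1 + lam \<xi>)) *\<^sub>R (ip (f t) (e \<xi>) - mu \<xi> *\<^sub>R ip (v t) (e \<xi>))"
      using vM weq
    proof eventually_elim
      case (elim t)
      have "w t = f t - dop mu (v t)" using elim by (simp add: M[symmetric] algebra_simps)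
      then show ?case using lam1 coefficient_diag_op[OF elim(1) \<xi>] by (simp add: ip_diff_left)
    qed
    have "AE t in lebesgue_on {0..T}. rl_integral (1 - \<alpha>) (\<lambda>s. ip (v s + L (v s)) (e \<xi>) - ip (v 0 + L (v 0)) (e \<xi>)) t
        = (LINT s:{0..t}|lebesgue. ip (w s) (e \<xi>))"
      using cap' \<xi> by blast
    then show "AE t in lebesgue_on {0..T}. rl_integral (1 - \<alpha>) (\<lambda>s. ip (v s) (e \<xi>) - ip \<phi> (e \<xi>)) t
        = (LINT s:{0..t}|lebesgue. (1 / (1 + lam \<xi>)) *\<^sub>R (ip (f s) (e \<xi>) - mu \<xi> *\<^sub>R ip (v s) (e \<xi>)))"
      using ae_in
    proof eventually_elim
      case (elim t)
      have "(1 + lam \<xi>) *\<^sub>R rl_integral (1 - \<alpha>) (\<lambda>s. ip (v s) (e \<xi>) - ip \<phi> (e \<xi>)) t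
          = rl_integral (1 - \<alpha>) (\<lambda>s. ip (v s + L (v s)) (e \<xi>) - ip (v 0 + L (v 0)) (e \<xi>)) t"
        unfolding rl_integral_scaleR[symmetric]
        by (rule rl_integral_cong_AE[OF elim(2), symmetric]; (rule g)?) measurable
      also have "\<dots> = (LINT s:{0..t}|lebesgue. (1 + lam \<xi>) *\<^sub>R (1 / (1 + lam \<xi>)) *\<^sub>R (ip (f s) (e \<xi>) - mu \<xi> *\<^sub>R ip (v s) (e \<xi>)))"
        unfolding elim(1) by (rule set_integral_cong_AE_Icc[OF elim(2)]; (rule k)?) measurable
      also have "\<dots> = (1 + lam \<xi>) *\<^sub>R (LINT s:{0..t}|lebesgue. (1 / (1 + lam \<xi>)) *\<^sub>R (ip (f s) (e \<xi>) - mu \<xi> *\<^sub>R ip (v s) (e \<xi>)))"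
        by (rule set_integral_scaleR)
      finally show ?case using lam1 by (simp only: scaleR_cancel_left) simp
    qed
  qed
  then have "AE t in lebesgue_on {0..T}. \<forall>\<xi>\<in>I. ip (v t) (e \<xi>) = u_coeff \<xi> t"
    by (simp add: AE_ball_countable[OF countable])
  then show ?thesis
    using ae_in by eventually_elim (rule basis_eqI, simp add: u_coefficient)
qed

end

lemma diag_cong:
  assumes "\<And>\<xi>. \<xi> \<in> I \<Longrightarrow> a \<xi> = b \<xi>"
  shows "diag_domain scl ip I e a = diag_domain scl ip I e b" and "diag_op scl ip I e a = diag_op scl ip I e b"
  using assms by (auto simp: diag_domain_def diag_op_def fun_eq_iff cong: summable_on_cong infsum_cong)

theorem theorem2p2:
  fixes scl :: "'k::{real_normed_field,euclidean_space}
                 \<Rightarrow> 'h::{banach,second_countable_topology} \<Rightarrow> 'h"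
    and ip :: "'h \<Rightarrow> 'h \<Rightarrow> 'k"
    and I :: "'i set" and e :: "'i \<Rightarrow> 'h"
    and D\<^sub>L D\<^sub>M :: "'h set" and L M :: "'h \<Rightarrow> 'h"
    and lam mu :: "'i \<Rightarrow> real" and c\<^sub>L c\<^sub>M :: real
    and \<alpha> T :: real and \<phi> :: 'h and f :: "real \<Rightarrow> 'h"
  defines "space_of \<equiv> diag_domain scl ip I e"
    and "power_of \<equiv> diag_op scl ip I e"
    and "L_pow \<equiv> \<lambda>l \<xi>. lam \<xi> powr l"
    and "M_pow \<equiv> \<lambda>m \<xi>. mu \<xi> powr m"
    and "LM_pow \<equiv> \<lambda>l m \<xi>. lam \<xi> powr l * mu \<xi> powr m"
  defines "is_solution \<equiv> \<lambda>u.
      solves_problem \<alpha> T L M \<phi> f u \<and>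
      u \<in> L2_space T (space_of (M_pow 1)) (power_of (M_pow 1)) \<and>
      u \<in> frac_sobolev \<alpha> T (space_of (L_pow 1)) (power_of (L_pow 1))"
    and "homog_term \<equiv> \<lambda>t \<xi>.
      mittag_leffler \<alpha> 1 (- (mu \<xi> / (1 + lam \<xi>)) * t powr \<alpha>) *\<^sub>R scl (ip \<phi> (e \<xi>)) (e \<xi>)"
    and "forced_term \<equiv> \<lambda>t \<xi>.
      scl ((1 / (1 + lam \<xi>)) *\<^sub>R
           (LINT s:{0..t}|lebesgue.
              (s powr (\<alpha> - 1) * mittag_leffler \<alpha> \<alpha> (- (mu \<xi> / (1 + lam \<xi>)) * s powr \<alpha>))
                *\<^sub>R ip (f (t - s)) (e \<xi>)))
          (e \<xi>)"
  assumes "1 / 2 < \<alpha>" "\<alpha> < 1" "0 < T"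
    and "hilbert_space scl ip"
    and "countable I" "orthonormal_basis scl ip I e"
    and "self_adjoint_operator scl ip D\<^sub>L L" "self_adjoint_operator scl ip D\<^sub>M M"
    and "\<forall>\<xi>\<in>I. e \<xi> \<in> D\<^sub>L \<and> L (e \<xi>) = lam \<xi> *\<^sub>R e \<xi>"
    and "\<forall>\<xi>\<in>I. e \<xi> \<in> D\<^sub>M \<and> M (e \<xi>) = mu \<xi> *\<^sub>R e \<xi>"
    and "0 < c\<^sub>L" "\<forall>\<xi>\<in>I. c\<^sub>L \<le> lam \<xi>"
    and "0 < c\<^sub>M" "\<forall>\<xi>\<in>I. c\<^sub>M \<le> mu \<xi>"
    and "\<phi> \<in> space_of (L_pow 1) \<inter> space_of (M_pow 1)"
    and "f \<in> L2 T \<inter> L2_space T (space_of (LM_pow (- 1) 1)) (power_of (LM_pow (- 1) 1))"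
  shows "\<exists>u. is_solution u \<and>
             (\<forall>v. is_solution v \<longrightarrow> (AE t in lebesgue_on {0..T}. v t = u t)) \<and>
             (\<forall>t\<in>{0..T}. homog_term t summable_on I \<and> forced_term t summable_on I \<and>
                u t = (\<Sum>\<^sub>\<infinity>\<xi>\<in>I. homog_term t \<xi>) + (\<Sum>\<^sub>\<infinity>\<xi>\<in>I. forced_term t \<xi>))"
proof -
  have lam: "\<And>\<xi>. \<xi> \<in> I \<Longrightarrow> 0 < lam \<xi>" and mu: "\<And>\<xi>. \<xi> \<in> I \<Longrightarrow> 0 < mu \<xi>"
    using assms by (auto intro: less_le_trans)
  interpret hilbert_basis scl ip I e
    using assms by (simp add: hilbert_basis_def hilbert_basis_axioms_def)
  \<comment> \<open>Positivity of the eigenvalues turns \<open>powr 1\<close> into the identity and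
    \<open>powr (- 1)\<close> into the reciprocal, so the power spaces become plain diagonal
    domains.\<close>
  have Lp: "space_of (L_pow 1) = diag_domain scl ip I e lam" "power_of (L_pow 1) = diag_op scl ip I e lam"
    unfolding space_of_def power_of_def L_pow_def by (rule diag_cong, use lam in \<open>simp add: less_imp_le\<close>)+
  have Mp: "space_of (M_pow 1) = diag_domain scl ip I e mu" "power_of (M_pow 1) = diag_op scl ip I e mu"
    unfolding space_of_def power_of_def M_pow_def by (rule diag_cong, use mu in \<open>simp add: less_imp_le\<close>)+
  have LMp: "space_of (LM_pow (- 1) 1) = diag_domain scl ip I e (\<lambda>\<xi>. mu \<xi> / lam \<xi>)"
      "power_of (LM_pow (- 1) 1) = diag_op scl ip I e (\<lambda>\<xi>. mu \<xi> / lam \<xi>)"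
    unfolding space_of_def power_of_def LM_pow_def
    by (rule diag_cong, use lam mu in \<open>simp add: less_imp_le powr_minus divide_inverse mult.commute\<close>)+
  interpret P: diagonal_problem scl ip I e lam mu L M \<alpha> T \<phi> f
  proof
    show "L x = diag_op scl ip I e lam x" if "x \<in> diag_domain scl ip I e lam" for x
      using self_adjoint_diag[of D\<^sub>L L lam, OF _ _ that] assms by blast
    show "M x = diag_op scl ip I e mu x" if "x \<in> diag_domain scl ip I e mu" for x
      using self_adjoint_diag[of D\<^sub>M M mu, OF _ _ that] assms by blast
    show "\<phi> \<in> diag_domain scl ip I e lam" "\<phi> \<in> diag_domain scl ip I e mu"
      using \<open>\<phi> \<in> space_of (L_pow 1) \<inter> space_of (M_pow 1)\<close> by (simp_all add: Lp Mp)
    show "f \<in> L2 T" "f \<in> L2_space T (diag_domain scl ip I e (\<lambda>\<xi>. mu \<xi> / lam \<xi>)) (diag_op scl ip I e (\<lambda>\<xi>. mu \<xi> / lam \<xi>))"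
      using \<open>f \<in> L2 T \<inter> L2_space T (space_of (LM_pow (- 1) 1)) (power_of (LM_pow (- 1) 1))\<close>
      by (simp_all add: LMp)
  qed (use lam mu \<open>1 / 2 < \<alpha>\<close> \<open>\<alpha> < 1\<close> \<open>0 < T\<close> in auto)
  have sol: "is_solution v \<longleftrightarrow> P.is_solution v" for v
    unfolding is_solution_def P.is_solution_def Lp Mp by simp
  have homog: "homog_term t = (\<lambda>\<xi>. scl (mittag_leffler \<alpha> 1 (- P.rate \<xi> * t powr \<alpha>) *\<^sub>R ip \<phi> (e \<xi>)) (e \<xi>))" for t
    by (simp add: homog_term_def P.rate_def scl_scaleR fun_eq_iff)
  have forced: "forced_term t \<xi> = scl ((1 / (1 + lam \<xi>)) *\<^sub>R P.forced \<xi> t) (e \<xi>)" if "\<xi> \<in> I" for t \<xi>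
  proof -
    interpret fractional_relaxation \<alpha> "P.rate \<xi>" T by (rule P.relaxation[OF that])
    have "(LINT s:{0..t}|lebesgue. resolvent s *\<^sub>R ip (f (t - s)) (e \<xi>)) = P.forced \<xi> t"
      unfolding P.forced_def by (rule set_integral_reflect)
    from this[unfolded resolvent_def, unfolded P.rate_def] show ?thesis
      by (simp only: forced_term_def)
  qed
  show ?thesis
  proof (intro exI[of _ P.u] conjI allI impI ballI)
    show "is_solution P.u" using P.u_is_solution by (simp only: sol)
    show "AE t in lebesgue_on {0..T}. v t = P.u t" if "is_solution v" for v
      using P.solution_unique that by (simp only: sol)
    fix t assume t: "t \<in> {0..T}"
    show "homog_term t summable_on I" unfolding homog by (rule P.u_series(1)[OF t])
    show "forced_term t summable_on I"
      using P.u_series(2)[OF t] by (simp only: forced cong: summable_on_cong)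
    show "P.u t = (\<Sum>\<^sub>\<infinity>\<xi>\<in>I. homog_term t \<xi>) + (\<Sum>\<^sub>\<infinity>\<xi>\<in>I. forced_term t \<xi>)"
      using P.u_series(3)[OF t] by (simp only: homog forced cong: infsum_cong)
  qed
qed

end
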